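(* Let $n\ge 2$, let $\mathbb{B}^n_1(\mathbf{0})=\{x\in\mathbb{R}^n:|x|<1\}$ and let $\mathsf{B}$ be Berwald's metric $$\mathsf{B}(x,y)=\frac{\big(\sqrt{(1-|x|^2)|y|^2+\langle x,y\rangle^2}+\langle x,y\rangle\big)^2}{(1-|x|^2)^2\sqrt{(1-|x|^2)|y|^2+\langle x,y\rangle^2}},\qquad (x,y)\in T\mathbb{B}^n_1(\mathbf{0}).$$ Then $(\mathbb{B}^n_1(\mathbf{0}),\mathsf{B})$ is a flat Cartan--Hadamard manifold (it is simply connected, forward complete, and has flag curvature identically $0$), and moreover: (i) $(\mathbb{B}^n_1(\mathbf{0}),\mathsf{B})$ admits no isometric embedding into any Minkowski space; (ii) for every $p\in(1,+\infty)$ the Sobolev space $W^{1,p}_0(\mathbb{B}^n_1(\mathbf{0}),\mathsf{B},\mathscr{L}^n)$ is not a vector space; (iii) for every $p\in(1,n)$, $$\inf_{f\in C^\infty_0(\mathbb{B}^n_1(\mathbf{0}))\setminus\{0\}}\frac{\int_{\mathbb{B}^n_1(\mathbf{0})}\mathsf{B}^p(\nabla f)\,dx}{\int_{\mathbb{B}^n_1(\mathbf{0})}|f|^p\,d_{\mathsf{B}}(\mathbf{0},\cdot)^{-p}\,dx}=0;$$ (iv) for every $s,p$ with $-p+1<s\le 1<p<n$, writing $p'=p/(p-1)$, $$\inf_{f\in C^\infty_0(\mathbb{B}^n_1(\mathbf{0}))\setminus\{0\}}\frac{\left(\int_{\mathbb{B}^n_1(\mathbf{0})}\mathsf{B}^p(\nabla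 f)\,dx\right)^{1/p}\left(\int_{\mathbb{B}^n_1(\mathbf{0})}|f|^p\,d_{\mathsf{B}}(\mathbf{0},\cdot)^{p's}\,dx\right)^{1/p'}}{\int_{\mathbb{B}^n_1(\mathbf{0})}|f|^p\,d_{\mathsf{B}}(\mathbf{0},\cdot)^{s-1}\,dx}=0.$$
   Context: $|\cdot|$ and $\langle\cdot,\cdot\rangle$ are the Euclidean norm and inner product; $dx$ and $\mathscr{L}^n$ denote Lebesgue measure. A Finsler metric $F$ on a manifold $M$ is a function on $TM$, smooth on $TM\setminus\{0\}$, such that each $F(x,\cdot)$ is a Minkowski norm (positive on nonzero vectors, positively $1$-homogeneous, with positive definite fundamental tensor $g_{ij}(x,y)=\frac12\partial^2F^2/\partial y^i\partial y^j$ for $y\neq0$). A Minkowski space is a vector space with a Minkowski norm, viewed as the Finsler manifold with $F(x,y)=\phi(y)$. The co-metric is $F^*(x,\eta)=\sup_{y\ne0}\eta(y)/F(x,y)$; the gradient of a differentiable $f$ is $\nabla f=\mathfrak{L}^{-1}(df)$, where $\mathfrak{L}(x,y)=g_{ij}(x,y)y^i dx^j$ (and $\mathfrak{L}(x,0)=0$); thus $F(\nabla f)=F^*(df)$. The distance $d_F(x_1,x_2)$ is the infimum of $\int_0^1F(\zeta,\dot\zeta)dt$ over Lipschitz paths from $x_1$ to $x_2$ (in general non-symmetric). Geodesics solve $\ddot\gamma^i+2G^i(\gamma,\dot\gamma)=0$ with $G^i=\frac14g^{il}(2\partial_{x^k}g_{jl}-\partial_{x^l}g_{jk})y^jy^k$;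 $F$ is forward complete if every geodesic on $[0,1)$ extends to $[0,\infty)$. Flag curvature is the Finslerian analogue of sectional curvature, $\mathbf K(y,v)=g_y(R_y(v),v)/(g_y(y,y)g_y(v,v)-g_y(y,v)^2)$ with $R_y$ the Riemann curvature of $F$. Isometric embedding means a map preserving $F$ on tangent vectors. Sobolev space: for a smooth positive measure $\mathfrak m$ and $p\in[1,\infty)$, set $\|u\|_{W^{1,p}_{\mathfrak m}}=(\int_M|u|^pd\mathfrak m)^{1/p}+(\int_MF^{*p}(du)d\mathfrak m)^{1/p}$ (possibly $+\infty$); $W^{1,p}_0(M,F,\mathfrak m)$ is the set of functions $u$ for which there exist $u_k\in C^\infty_0(M)$ with $\|u-u_k\|_{W^{1,p}_{\mathfrak m}}\to0$. *)

theory Defs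
  imports "HOL-Analysis.Analysis"
begin

fun Ck_on :: "nat \<Rightarrow> 'a::euclidean_space set \<Rightarrow> ('a \<Rightarrow> 'b::euclidean_space) \<Rightarrow> bool" where
  "Ck_on 0 S f = continuous_on S f"
| "Ck_on (Suc k) S f =
     (\<exists>f'. (\<forall>x\<in>S. (f has_derivative f' x) (at x)) \<and> (\<forall>v. Ck_on k S (\<lambda>x. f' x v)))"

definition Cinf_on :: "'a::euclidean_space set \<Rightarrow> ('a \<Rightarrow> 'b::euclidean_space) \<Rightarrow> bool" where
  "Cinf_on S f \<longleftrightarrow> (\<forall>k. Ck_on k S f)"

definition test_fun :: "('a::euclidean_space) set \<Rightarrow> ('a \<Rightarrow> real) \<Rightarrow> bool" where
  "test_fun S f \<longleftrightarrow> Cinf_on UNIV f \<and> compact (closure {x. f x \<noteq> 0}) \<and> closure {x. f x \<noteq> 0} \<subseteq> S"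

definition fund_quad :: "('v::euclidean_space \<Rightarrow> real) \<Rightarrow> 'v \<Rightarrow> 'v \<Rightarrow> real" where
  "fund_quad \<phi> y v = 1/2 * deriv (deriv (\<lambda>t. (\<phi> (y + t *\<^sub>R v))\<^sup>2)) 0"

definition minkowski_norm :: "('v::euclidean_space \<Rightarrow> real) \<Rightarrow> bool" where
  "minkowski_norm \<phi> \<longleftrightarrow>
     (\<forall>y. y \<noteq> 0 \<longrightarrow> \<phi> y > 0) \<and>
     (\<forall>c y. c > 0 \<longrightarrow> \<phi> (c *\<^sub>R y) = c * \<phi> y) \<and>
     Cinf_on (UNIV - {0}) \<phi> \<and>
     (\<forall>y v. y \<noteq> 0 \<longrightarrow> v \<noteq> 0 \<longrightarrow> fund_quad \<phi> y v > 0)"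

definition finsler_metric :: "(real^'n) set \<Rightarrow> (real^'n \<Rightarrow> real^'n \<Rightarrow> real) \<Rightarrow> bool" where
  "finsler_metric S F \<longleftrightarrow>
     Cinf_on (S \<times> (UNIV - {0})) (\<lambda>(x, y). F x y) \<and> (\<forall>x\<in>S. minkowski_norm (F x))"

definition dX :: "'n \<Rightarrow> (real^'n \<Rightarrow> real^'n \<Rightarrow> real) \<Rightarrow> real^'n \<Rightarrow> real^'n \<Rightarrow> real" where
  "dX i h x y = deriv (\<lambda>t. h (x + t *\<^sub>R axis i 1) y) 0"

definition dY :: "'n \<Rightarrow> (real^'n \<Rightarrow> real^'n \<Rightarrow> real) \<Rightarrow> real^'n \<Rightarrow> real^'n \<Rightarrow> real" where
  "dY i h x y = deriv (\<lambda>t. h x (y + t *\<^sub>R axis i 1)) 0"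

definition gten :: "(real^'n \<Rightarrow> real^'n \<Rightarrow> real) \<Rightarrow> 'n \<Rightarrow> 'n \<Rightarrow> real^'n \<Rightarrow> real^'n \<Rightarrow> real" where
  "gten F i j x y = 1/2 * dY i (dY j (\<lambda>x y. (F x y)\<^sup>2)) x y"

definition gmat :: "(real^'n \<Rightarrow> real^'n \<Rightarrow> real) \<Rightarrow> real^'n \<Rightarrow> real^'n \<Rightarrow> real^'n^'n" where
  "gmat F x y = (\<chi> i j. gten F i j x y)"

definition gprod :: "(real^'n \<Rightarrow> real^'n \<Rightarrow> real) \<Rightarrow> real^'n \<Rightarrow> real^'n \<Rightarrow> real^'n \<Rightarrow> real^'n \<Rightarrow> real" where
  "gprod F x y u v = (\<Sum>i\<in>UNIV. \<Sum>j\<in>UNIV. gten F i j x y * u $ i * v $ j)"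

definition spray :: "(real^'n \<Rightarrow> real^'n \<Rightarrow> real) \<Rightarrow> 'n \<Rightarrow> real^'n \<Rightarrow> real^'n \<Rightarrow> real" where
  "spray F i x y = (if y = 0 then 0 else
     1/4 * (\<Sum>l\<in>UNIV. matrix_inv (gmat F x y) $ i $ l *
       (\<Sum>j\<in>UNIV. \<Sum>k\<in>UNIV.
          (2 * dX k (gten F j l) x y - dX l (gten F j k) x y) * y $ j * y $ k)))"

text \<open>Riemann curvature R^i_k (Berwald's formula).\<close>
definition riem :: "(real^'n \<Rightarrow> real^'n \<Rightarrow> real) \<Rightarrow> 'n \<Rightarrow> 'n \<Rightarrow> real^'n \<Rightarrow> real^'n \<Rightarrow> real" where
  "riem F i k x y =
      2 * dX k (spray F i) x y
    - (\<Sum>j\<in>UNIV. y $ j * dX j (dY k (spray F i)) x y)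
    + 2 * (\<Sum>j\<in>UNIV. spray F j x y * dY j (dY k (spray F i)) x y)
    - (\<Sum>j\<in>UNIV. dY j (spray F i) x y * dY k (spray F j) x y)"

definition riem_op :: "(real^'n \<Rightarrow> real^'n \<Rightarrow> real) \<Rightarrow> real^'n \<Rightarrow> real^'n \<Rightarrow> real^'n \<Rightarrow> real^'n" where
  "riem_op F x y v = (\<chi> i. \<Sum>k\<in>UNIV. riem F i k x y * v $ k)"

definition flag_curvature :: "(real^'n \<Rightarrow> real^'n \<Rightarrow> real) \<Rightarrow> real^'n \<Rightarrow> real^'n \<Rightarrow> real^'n \<Rightarrow> real" where
  "flag_curvature F x y v =
     gprod F x y (riem_op F x y v) v /
     (gprod F x y y y * gprod F x y v v - (gprod F x y y v)\<^sup>2)"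

definition flag_curvature_const :: "(real^'n) set \<Rightarrow> (real^'n \<Rightarrow> real^'n \<Rightarrow> real) \<Rightarrow> real \<Rightarrow> bool" where
  "flag_curvature_const S F c \<longleftrightarrow>
     (\<forall>x\<in>S. \<forall>y v. y \<noteq> 0 \<longrightarrow> (\<forall>a. v \<noteq> a *\<^sub>R y) \<longrightarrow> flag_curvature F x y v = c)"

definition geodesic_on :: "(real^'n) set \<Rightarrow> (real^'n \<Rightarrow> real^'n \<Rightarrow> real) \<Rightarrow> real set \<Rightarrow> (real \<Rightarrow> real^'n) \<Rightarrow> bool" where
  "geodesic_on S F I \<gamma> \<longleftrightarrow> (\<exists>\<gamma>'. \<forall>t\<in>I. \<gamma> t \<in> S \<and>
      (\<gamma> has_vector_derivative \<gamma>' t) (at t within I) \<and>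
      (\<gamma>' has_vector_derivative (\<chi> i. - 2 * spray F i (\<gamma> t) (\<gamma>' t))) (at t within I))"

definition forward_complete :: "(real^'n) set \<Rightarrow> (real^'n \<Rightarrow> real^'n \<Rightarrow> real) \<Rightarrow> bool" where
  "forward_complete S F \<longleftrightarrow>
     (\<forall>\<gamma>. geodesic_on S F {0..<1} \<gamma> \<longrightarrow>
        (\<exists>\<eta>. geodesic_on S F {0..} \<eta> \<and> (\<forall>t\<in>{0..<1}. \<eta> t = \<gamma> t)))"

definition finsler_dist :: "(real^'n) set \<Rightarrow> (real^'n \<Rightarrow> real^'n \<Rightarrow> real) \<Rightarrow> real^'n \<Rightarrow> real^'n \<Rightarrow> real" where
  "finsler_dist S F a b = enn2real
     (INF \<zeta>\<in>{\<zeta>. \<zeta> 0 = a \<and> \<zeta> 1 = b \<and> \<zeta> ` {0..1} \<subseteq> S \<and> (\<exists>L. L-lipschitz_on {0..1} \<zeta>)}.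
        \<integral>\<^sup>+ t\<in>{0..1}. ennreal (F (\<zeta> t) (vector_derivative \<zeta> (at t))) \<partial>lborel)"

definition cometric :: "(real^'n \<Rightarrow> real^'n \<Rightarrow> real) \<Rightarrow> real^'n \<Rightarrow> (real^'n \<Rightarrow> real) \<Rightarrow> real" where
  "cometric F x \<eta> = (SUP y\<in>UNIV - {0}. \<eta> y / F x y)"

definition enn_powr :: "ennreal \<Rightarrow> real \<Rightarrow> ennreal" where
  "enn_powr a r = (if a = \<infinity> then \<infinity> else ennreal (enn2real a powr r))"

definition weak_gradient :: "(real^'n) set \<Rightarrow> (real^'n \<Rightarrow> real) \<Rightarrow> (real^'n \<Rightarrow> real^'n) \<Rightarrow> bool" where
  "weak_gradient S u G \<longleftrightarrow>
     (\<forall>K. compact K \<and> K \<subseteq> S \<longrightarrow> set_integrable lborel K u \<and> set_integrable lborel K G) \<and>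
     (\<forall>\<phi> i. test_fun S \<phi> \<longrightarrow>
        (LINT x:S|lborel. u x * frechet_derivative \<phi> (at x) (axis i 1))
          = - (LINT x:S|lborel. G x $ i * \<phi> x))"

text \<open>W^{1,p}_0(S, F, Lebesgue): limits of test functions in the (nonsymmetric) W^{1,p} norm;
  the differential of u is its weak differential v \<mapsto> G x \<bullet> v.\<close>
definition sobolev_W0 :: "real \<Rightarrow> (real^'n) set \<Rightarrow> (real^'n \<Rightarrow> real^'n \<Rightarrow> real) \<Rightarrow> (real^'n \<Rightarrow> real) set" where
  "sobolev_W0 p S F = {u. \<exists>G uk. weak_gradient S u G \<and> (\<forall>k. test_fun S (uk k)) \<and>
      (\<lambda>k. enn_powr (\<integral>\<^sup>+ x\<in>S. ennreal (\<bar>u x - uk k x\<bar> powr p) \<partial>lborel) (1/p)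
         + enn_powr (\<integral>\<^sup>+ x\<in>S. ennreal (cometric F x
              (\<lambda>v. G x \<bullet> v - frechet_derivative (uk k) (at x) v) powr p) \<partial>lborel) (1/p))
      \<longlonglongrightarrow> 0}"

definition is_vector_space :: "('a \<Rightarrow> real) set \<Rightarrow> bool" where
  "is_vector_space W \<longleftrightarrow> (\<lambda>_. 0) \<in> W \<and> (\<forall>u\<in>W. \<forall>v\<in>W. (\<lambda>x. u x + v x) \<in> W) \<and>
     (\<forall>c. \<forall>u\<in>W. (\<lambda>x. c * u x) \<in> W)"

definition berwald :: "real^'n \<Rightarrow> real^'n \<Rightarrow> real" where
  "berwald x y =
    (sqrt ((1 - (norm x)\<^sup>2) * (norm y)\<^sup>2 + (x \<bullet> y)\<^sup>2) + x \<bullet> y)\<^sup>2 /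
    ((1 - (norm x)\<^sup>2)\<^sup>2 * sqrt ((1 - (norm x)\<^sup>2) * (norm y)\<^sup>2 + (x \<bullet> y)\<^sup>2))"

end

theory Submission
  imports Defs
begin

text \<open>
  Write \<open>\<Theta>\<close> for the Funk metric of the ball and \<open>D = sqrt ((1 - |x|\<^sup>2) |y|\<^sup>2 + \<langle>x, y\<rangle>\<^sup>2)\<close>, so
  that Berwald's metric is \<open>\<Theta>\<^sup>2 / D\<close>. The identity \<open>\<partial>\<Theta>/\<partial>x = \<Theta> \<partial>\<Theta>/\<partial>y\<close> and the constancy of
  \<open>D\<close> along straight lines give the spray coefficients \<open>\<Theta> y\<^sup>i\<close>. Hence the Riemann curvature
  cancels, geodesics are straight segments, and along a geodesic \<open>q = \<Theta>\<close> satisfies \<open>q' = - q\<^sup>2\<close>,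
  so the exit point of the ball is not reached in finite time.

  In the radial unit direction at radius \<open>r\<close> the metric equals \<open>1 / (1 - r)\<^sup>2\<close> outwards but
  \<open>1 / (1 + r)\<^sup>2\<close> inwards. A Minkowski norm has bounded ratio of forward to backward lengths, which
  rules out embeddings. Dually, the co-metric of \<open>c dr\<close> with \<open>c > 0\<close> is of order \<open>c (1 - r)\<^sup>2\<close>, so
  the negative of a cutoff function that falls from 1 to 0 in a boundary layer of width \<open>\<epsilon>\<close> has
  energy \<open>o(\<epsilon>\<^sup>p)\<close>. This makes both quotients arbitrarily small and puts the constant 1 into the
  Sobolev space. The constant -1 is not in it: an approximating sequence would have to rise from
  -1 to 0 towards the boundary, and integration by parts against a monotone ramp bounds that rise
  by the energy.
\<close>

section \<open>Smooth functions and a smooth step\<close>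

text \<open>Since \<open>F(grad f) = F*(df)\<close>, gradient energies are integrals of powers of
  the co-metric. For an outward radial covector, \<open>a D / (D + a)^2 \<le> 1/4\<close> with
  \<open>a = x \<bullet> y\<close> and \<open>D = disc x y\<close> makes the co-metric decay like
  \<open>(1 - |x|^2)^2\<close>. A boundary layer of width \<epsilon> has slope of order
  \<open>1/\<epsilon>\<close>, hence co-metric O(\<epsilon>). In the uncertainty quotient the
  weighted mass may grow like the power \<open>- p'\<close> of \<epsilon>, because the distance is
  at most \<open>2/\<epsilon>\<close> where the cutoff lives. After taking roots the powers of
  \<epsilon> cancel, and the vanishing volume of the layer, to the power \<open>1/p\<close>,
  remains. So bounds \<open>r/4 \<le> d \<le> r/(1 - r)\<close> replace the exact distance. The
  lower bound must hold for every Lipschitz path, whose derivative exists only almost everywhere;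
  this calls for the fundamental theorem of calculus for Lipschitz functions. On the curvature side
  the derivatives of the metric tensor are not written out: spray and curvature use only
  contractions with \<open>y\<close>, which Euler's relation and differentiation along a line give
  in closed form.\<close>

lemma Ck_on_SucI:
  assumes "\<And>x. x \<in> S \<Longrightarrow> (f has_derivative f' x) (at x)" "\<And>v. Ck_on k S (\<lambda>x. f' x v)"
  shows "Ck_on (Suc k) S f"
  using assms by auto

lemma Ck_on_SucE:
  assumes "Ck_on (Suc k) S f"
  obtains f' where "\<And>x. x \<in> S \<Longrightarrow> (f has_derivative f' x) (at x)" "\<And>v. Ck_on k S (\<lambda>x. f' x v)"
  using assms by auto

lemma Ck_on_UNIV_SucE:
  assumes "Ck_on (Suc k) UNIV f"
  obtains f' where "\<And>x. (f has_derivative f' x) (at x)" "\<And>v. Ck_on k UNIV (\<lambda>x. f' x v)"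
  using assms by auto

lemma Ck_on_imp_continuous_on: "Ck_on k S f \<Longrightarrow> continuous_on S f"
  by (cases k) (auto intro!: continuous_at_imp_continuous_on dest!: has_derivative_continuous)

text \<open>Product and chain rules multiply a derivative by an undifferentiated factor, so the
  inductions below need the original function at the lower order as well.\<close>

lemma Ck_on_lower: "Ck_on (Suc k) S f \<Longrightarrow> Ck_on k S f"
proof (induction k arbitrary: f)
  case 0
  then show ?case using Ck_on_imp_continuous_on by (metis Ck_on.simps(1))
next
  case (Suc k)
  obtain f' where "\<And>x. x \<in> S \<Longrightarrow> (f has_derivative f' x) (at x)" "\<And>v. Ck_on (Suc k) S (\<lambda>x. f' x v)"
    using Suc.prems by (rule Ck_on_SucE) blast
  then show ?case using Suc.IH by (blast intro: Ck_on_SucI)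
qed

lemma Ck_on_const: "Ck_on k S (\<lambda>x. c)"
  by (induction k arbitrary: c) (auto intro!: exI[of _ "\<lambda>_ _. 0"])

lemma Ck_on_bounded_linear: "bounded_linear f \<Longrightarrow> Ck_on k S f"
  by (cases k)
    (auto simp: linear_continuous_on intro!: exI[of _ "\<lambda>_. f"] bounded_linear_imp_has_derivative Ck_on_const)

lemma Ck_on_add: "Ck_on k S f \<Longrightarrow> Ck_on k S g \<Longrightarrow> Ck_on k S (\<lambda>x. f x + g x)"
proof (induction k arbitrary: f g)
  case 0
  then show ?case by (auto intro: continuous_intros)
next
  case (Suc k)
  obtain f' where f: "\<And>x. x \<in> S \<Longrightarrow> (f has_derivative f' x) (at x)" "\<And>v. Ck_on k S (\<lambda>x. f' x v)"
    using Suc.prems(1) by (rule Ck_on_SucE) blast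
  obtain g' where g: "\<And>x. x \<in> S \<Longrightarrow> (g has_derivative g' x) (at x)" "\<And>v. Ck_on k S (\<lambda>x. g' x v)"
    using Suc.prems(2) by (rule Ck_on_SucE) blast
  show ?case
    using f g Suc.IH by (intro Ck_on_SucI[of S _ "\<lambda>x v. f' x v + g' x v"]) (auto intro!: derivative_intros)
qed

lemma Ck_on_mult:
  fixes f g :: "'a::euclidean_space \<Rightarrow> real"
  shows "Ck_on k S f \<Longrightarrow> Ck_on k S g \<Longrightarrow> Ck_on k S (\<lambda>x. f x * g x)"
proof (induction k arbitrary: f g)
  case 0
  then show ?case by (auto intro: continuous_intros)
next
  case (Suc k)
  obtain f' where f: "\<And>x. x \<in> S \<Longrightarrow> (f has_derivative f' x) (at x)" "\<And>v. Ck_on k S (\<lambda>x. f' x v)"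
    using Suc.prems(1) by (rule Ck_on_SucE) blast
  obtain g' where g: "\<And>x. x \<in> S \<Longrightarrow> (g has_derivative g' x) (at x)" "\<And>v. Ck_on k S (\<lambda>x. g' x v)"
    using Suc.prems(2) by (rule Ck_on_SucE) blast
  show ?case
    using f g Suc.IH Suc.prems[THEN Ck_on_lower]
    by (intro Ck_on_SucI[of S _ "\<lambda>x v. f x * g' x v + f' x v * g x"])
      (auto intro!: derivative_eq_intros Ck_on_add)
qed

lemma Ck_on_minus:
  fixes f :: "'a::euclidean_space \<Rightarrow> real"
  shows "Ck_on k S f \<Longrightarrow> Ck_on k S (\<lambda>x. - f x)"
  using Ck_on_mult[OF Ck_on_const[of k S "- 1"]] by simp

lemma Ck_on_diff:
  fixes f :: "'a::euclidean_space \<Rightarrow> real"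
  shows "Ck_on k S f \<Longrightarrow> Ck_on k S g \<Longrightarrow> Ck_on k S (\<lambda>x. f x - g x)"
  using Ck_on_add[OF _ Ck_on_minus] by auto

lemma Ck_on_power:
  fixes f :: "'a::euclidean_space \<Rightarrow> real"
  shows "Ck_on k S f \<Longrightarrow> Ck_on k S (\<lambda>x. f x ^ n)"
  by (induction n) (auto intro: Ck_on_const Ck_on_mult)

lemma Ck_on_sum:
  fixes f :: "'i \<Rightarrow> 'a::euclidean_space \<Rightarrow> real"
  shows "finite I \<Longrightarrow> (\<And>i. i \<in> I \<Longrightarrow> Ck_on k S (f i)) \<Longrightarrow> Ck_on k S (\<lambda>x. \<Sum>i\<in>I. f i x)"
  by (induction I rule: finite_induct) (auto intro: Ck_on_const Ck_on_add)

lemma Ck_on_inner: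
  fixes f g :: "'a::euclidean_space \<Rightarrow> 'b::euclidean_space"
  assumes "bounded_linear f" "bounded_linear g"
  shows "Ck_on k S (\<lambda>x. f x \<bullet> g x)"
proof -
  have "Ck_on k S (\<lambda>x. \<Sum>b\<in>Basis. (f x \<bullet> b) * (g x \<bullet> b))"
    by (intro Ck_on_sum Ck_on_mult Ck_on_bounded_linear bounded_linear_compose[OF bounded_linear_inner_left] assms) auto
  then show ?thesis by (simp only: euclidean_inner[symmetric])
qed

lemma Ck_on_inverse:
  fixes f :: "'a::euclidean_space \<Rightarrow> real"
  assumes nz: "\<And>x. x \<in> S \<Longrightarrow> f x \<noteq> 0"
  shows "Ck_on k S f \<Longrightarrow> Ck_on k S (\<lambda>x. inverse (f x))"
proof (induction k)
  case 0
  then show ?case using nz by (auto intro: continuous_intros)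
next
  case (Suc k)
  obtain f' where f: "\<And>x. x \<in> S \<Longrightarrow> (f has_derivative f' x) (at x)" "\<And>v. Ck_on k S (\<lambda>x. f' x v)"
    using Suc.prems(1) by (rule Ck_on_SucE) blast
  show ?case
    using f Suc.IH[OF Suc.prems[THEN Ck_on_lower]] nz
    by (intro Ck_on_SucI[of S _ "\<lambda>x v. - (inverse (f x) * f' x v * inverse (f x))"])
      (auto intro!: Ck_on_minus Ck_on_mult has_derivative_inverse)
qed

lemma Ck_on_divide:
  fixes f :: "'a::euclidean_space \<Rightarrow> real"
  assumes "\<And>x. x \<in> S \<Longrightarrow> g x \<noteq> 0" "Ck_on k S f" "Ck_on k S g"
  shows "Ck_on k S (\<lambda>x. f x / g x)"
  using Ck_on_mult[OF assms(2) Ck_on_inverse[OF assms(1,3)]] by (simp add: divide_inverse)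

lemma Ck_on_sqrt:
  fixes f :: "'a::euclidean_space \<Rightarrow> real"
  assumes pos: "\<And>x. x \<in> S \<Longrightarrow> f x > 0"
  shows "Ck_on k S f \<Longrightarrow> Ck_on k S (\<lambda>x. sqrt (f x))"
proof (induction k)
  case 0
  then show ?case by (auto intro: continuous_intros)
next
  case (Suc k)
  obtain f' where f: "\<And>x. x \<in> S \<Longrightarrow> (f has_derivative f' x) (at x)" "\<And>v. Ck_on k S (\<lambda>x. f' x v)"
    using Suc.prems(1) by (rule Ck_on_SucE) blast
  have nz: "sqrt (f x) \<noteq> 0" if "x \<in> S" for x using pos[OF that] by simp
  show ?case
    using f Suc.IH[OF Suc.prems[THEN Ck_on_lower]] pos nz
    by (intro Ck_on_SucI[of S _ "\<lambda>x v. f' x v * ((1/2) * inverse (sqrt (f x)))"]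
        Ck_on_mult Ck_on_inverse Ck_on_const) (auto intro!: derivative_eq_intros simp: divide_simps)
qed

lemma Ck_on_compose_real:
  fixes f :: "'a::euclidean_space \<Rightarrow> real" and g :: "real \<Rightarrow> real"
  shows "Ck_on k UNIV g \<Longrightarrow> Ck_on k S f \<Longrightarrow> Ck_on k S (\<lambda>x. g (f x))"
proof (induction k arbitrary: g)
  case 0
  then show ?case by (auto intro: continuous_on_compose2)
next
  case (Suc k)
  obtain f' where f: "\<And>x. x \<in> S \<Longrightarrow> (f has_derivative f' x) (at x)" "\<And>v. Ck_on k S (\<lambda>x. f' x v)"
    using Suc.prems(2) by (rule Ck_on_SucE) blast
  obtain g' where g: "\<And>x. (g has_derivative g' x) (at x)" "\<And>v. Ck_on k UNIV (\<lambda>x. g' x v)"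
    using Suc.prems(1) by (rule Ck_on_UNIV_SucE) blast
  \<comment> \<open>A linear map on the reals is multiplication by its value at 1, so the derivative
    of the composite is a product to which the product rule and the induction hypothesis
    apply.\<close>
  have lin: "g' (f x) w = g' (f x) 1 * w" for x w
    using linear_scale[OF has_derivative_linear[OF g(1)], of "f x" w 1] by (simp add: mult.commute)
  show ?case
  proof (rule Ck_on_SucI)
    fix x assume "x \<in> S"
    then have "((g \<circ> f) has_derivative g' (f x) \<circ> f' x) (at x)"
      using f(1) g(1) by (intro diff_chain_at)
    then show "((\<lambda>x. g (f x)) has_derivative (\<lambda>v. g' (f x) 1 * f' x v)) (at x)"
      by (simp add: o_def lin[symmetric])
  next
    show "Ck_on k S (\<lambda>x. g' (f x) 1 * f' x v)" for v
      by (rule Ck_on_mult[OF Suc.IH[OF g(2) Ck_on_lower[OF Suc.prems(2)]] f(2)])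
  qed
qed

lemma Cinf_on_differentiable:
  assumes "Cinf_on S f" "x \<in> S"
  shows "f differentiable (at x)"
proof -
  obtain f' where "\<And>x. x \<in> S \<Longrightarrow> (f has_derivative f' x) (at x)"
    by (rule Ck_on_SucE[OF assms(1)[unfolded Cinf_on_def, rule_format]]) blast
  then show ?thesis using assms(2) differentiable_def by blast
qed

lemma Cinf_on_continuous_on: "Cinf_on S f \<Longrightarrow> continuous_on S f"
  unfolding Cinf_on_def using Ck_on_imp_continuous_on by blast

lemma Cinf_on_frechet_derivative:
  assumes "Cinf_on UNIV f"
  shows "Cinf_on UNIV (\<lambda>x. frechet_derivative f (at x) v)"
  unfolding Cinf_on_def
proof
  fix k
  obtain f' where f: "\<And>x. (f has_derivative f' x) (at x)" "\<And>v. Ck_on k UNIV (\<lambda>x. f' x v)"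
    by (rule Ck_on_UNIV_SucE[OF assms[unfolded Cinf_on_def, rule_format]]) blast
  have "frechet_derivative f (at x) = f' x" for x
    using frechet_derivative_at[OF f(1)] by simp
  then show "Ck_on k UNIV (\<lambda>x. frechet_derivative f (at x) v)" using f(2) by simp
qed

section \<open>Flat functions \<open>p(1/t) exp(-1/t)\<close> and the smooth step built from
  them\<close>

definition exp_poly :: "real poly \<Rightarrow> real \<Rightarrow> real" where
  "exp_poly p t = (if t > 0 then poly p (1 / t) * exp (- (1 / t)) else 0)"

lemma poly_over_exp_tendsto_0: "((\<lambda>x::real. poly p x * exp (- x)) \<longlongrightarrow> 0) at_top"
proof -
  have "((\<lambda>x::real. \<Sum>i\<le>degree p. coeff p i * (x ^ i / exp x)) \<longlongrightarrow> (\<Sum>i\<le>degree p. coeff p i * 0)) at_top"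
    by (intro tendsto_intros tendsto_power_div_exp_0)
  then show ?thesis
    by (simp add: poly_altdef sum_distrib_right exp_minus divide_inverse mult.assoc)
qed

lemma exp_poly_quotient_tendsto_0: "((\<lambda>h. exp_poly p h / h) \<longlongrightarrow> 0) (at 0)"
proof -
  \<comment> \<open>\<open>pCons 0 p\<close> is \<open>p\<close> times its variable; evaluated at
    \<open>1/h\<close> this is the division by \<open>h\<close> in the difference quotient.\<close>
  have "((\<lambda>h. poly (pCons 0 p) (inverse h) * exp (- inverse h)) \<longlongrightarrow> 0) (at_right 0)"
    by (rule filterlim_compose[OF poly_over_exp_tendsto_0 filterlim_inverse_at_top_right])
  then have "((\<lambda>h. exp_poly p h / h) \<longlongrightarrow> 0) (at_right 0)"
    by (rule Lim_transform_eventually) (auto simp: eventually_at_filter exp_poly_def divide_inverse)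
  moreover have "((\<lambda>h. exp_poly p h / h) \<longlongrightarrow> 0) (at_left 0)"
    by (rule Lim_transform_eventually[OF tendsto_const]) (auto simp: eventually_at_filter exp_poly_def)
  ultimately show ?thesis
    by (simp add: filterlim_split_at)
qed

text \<open>The family is closed under differentiation: \<open>1/t\<close> has derivative
  \<open>-1/t^2\<close>, so \<open>p\<close> is replaced by \<open>X^2 (p - p')\<close>, and
  \<open>[:0, 0, 1:]\<close> is \<open>X^2\<close>. Smoothness across 0 then follows by one
  induction over all polynomials at once.\<close>

lemma exp_poly_deriv:
  "(exp_poly p has_real_derivative exp_poly ([:0, 0, 1:] * (p - pderiv p)) t) (at t)"
proof (cases t "0::real" rule: linorder_cases)
  case less
  have "((\<lambda>t. 0) has_real_derivative 0) (at t)" by simp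
  then have "(exp_poly p has_real_derivative 0) (at t)"
    using less by (elim DERIV_cong_ev[THEN iffD1, OF refl _ refl, rotated])
      (auto simp: exp_poly_def eventually_nhds intro!: exI[of _ "{..<0}"])
  then show ?thesis using less by (simp add: exp_poly_def)
next
  case equal
  have "(exp_poly p has_real_derivative 0) (at 0)"
    using exp_poly_quotient_tendsto_0[of p] by (simp add: has_field_derivative_iff exp_poly_def)
  then show ?thesis using equal by (simp add: exp_poly_def)
next
  case greater
  have "((\<lambda>t. poly p (1 / t) * exp (- (1 / t))) has_real_derivative
      poly ([:0, 0, 1:] * (p - pderiv p)) (1 / t) * exp (- (1 / t))) (at t)"
    using greater by (auto intro!: derivative_eq_intros simp: field_simps power2_eq_square)
  then have "(exp_poly p has_real_derivative poly ([:0, 0, 1:] * (p - pderiv p)) (1 / t) * exp (- (1 / t))) (at t)"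
    using greater by (elim DERIV_cong_ev[THEN iffD1, OF refl _ refl, rotated])
      (auto simp: exp_poly_def eventually_nhds intro!: exI[of _ "{0<..}"])
  then show ?thesis using greater by (simp add: exp_poly_def)
qed

lemma Ck_on_exp_poly: "Ck_on k S (exp_poly p)"
proof (induction k arbitrary: p)
  case 0
  then show ?case
    using exp_poly_deriv by (auto intro!: continuous_at_imp_continuous_on DERIV_isCont)
next
  case (Suc k)
  show ?case
    by (rule Ck_on_SucI[OF exp_poly_deriv[unfolded has_field_derivative_def]])
      (intro Ck_on_mult Ck_on_const Suc.IH)
qed

text \<open>The standard smooth transition, constant outside \<open>(0, 1)\<close>. The denominator
  is positive because \<open>t\<close> or \<open>1 - t\<close> is.\<close>

definition step :: "real \<Rightarrow> real" where
  "step t = exp_poly 1 t / (exp_poly 1 t + exp_poly 1 (1 - t))"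

lemma step_denom: "exp_poly 1 t + exp_poly 1 (1 - t) > 0"
  by (cases "t > 0") (auto simp: exp_poly_def add_pos_nonneg)

lemma step_bounds: "0 \<le> step t" "step t \<le> 1"
  using step_denom[of t] by (auto simp: step_def exp_poly_def)

lemma step_eq_0: "t \<le> 0 \<Longrightarrow> step t = 0"
  by (simp add: step_def exp_poly_def)

lemma step_eq_1: "t \<ge> 1 \<Longrightarrow> step t = 1"
  by (simp add: step_def exp_poly_def)

lemma Ck_on_step: "Ck_on k UNIV step"
proof -
  have "Ck_on k UNIV (\<lambda>t. exp_poly 1 t / (exp_poly 1 t + exp_poly 1 (1 - t)))"
    using step_denom less_imp_neq[OF step_denom]
    by (intro Ck_on_divide Ck_on_add Ck_on_exp_poly Ck_on_compose_real[OF Ck_on_exp_poly]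
        Ck_on_diff Ck_on_const Ck_on_bounded_linear bounded_linear_ident) auto
  then show ?thesis by (simp add: step_def[abs_def])
qed

lemma step_deriv: "(step has_real_derivative deriv step t) (at t)"
proof -
  have "step differentiable (at t)"
    unfolding differentiable_def using Ck_on_step[of "Suc 0"] by (rule Ck_on_UNIV_SucE) blast
  then show ?thesis by (simp add: DERIV_deriv_iff_real_differentiable)
qed

lemma continuous_on_deriv_step: "continuous_on UNIV (deriv step)"
proof -
  obtain f' where f: "\<And>x. (step has_derivative f' x) (at x)" "\<And>v. Ck_on 0 UNIV (\<lambda>x. f' x v)"
    using Ck_on_step[of "Suc 0"] by (rule Ck_on_UNIV_SucE) blast
  have "f' x 1 = deriv step x" for x
    using has_derivative_unique[OF f(1) step_deriv[unfolded has_field_derivative_def]] by simp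
  then show ?thesis using f(2)[of 1] by simp
qed

lemma exp_1_mono: "s \<le> t \<Longrightarrow> exp_poly 1 s \<le> exp_poly 1 t"
  by (auto simp: exp_poly_def frac_le)

lemma mono_step: "mono step"
proof
  fix s t :: real assume "s \<le> t"
  \<comment> \<open>This is the claim after clearing denominators and cancelling the common product
    of the values at \<open>s\<close> and \<open>t\<close>.\<close>
  then have "exp_poly 1 s * exp_poly 1 (1 - t) \<le> exp_poly 1 t * exp_poly 1 (1 - s)"
    by (intro mult_mono exp_1_mono) (auto simp: exp_poly_def)
  then show "step s \<le> step t"
    using step_denom[of s] step_denom[of t] by (simp add: step_def divide_simps algebra_simps)
qed

lemma deriv_step_nonneg: "deriv step t \<ge> 0"
  using mono_on_imp_deriv_nonneg[OF mono_step step_deriv] by simp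

lemma deriv_step_eq_0: 
  assumes "t \<notin> {0<..<1}" shows "deriv step t = 0"
proof -
  have "isCont (deriv step) t" using continuous_on_deriv_step by (simp add: continuous_on_eq_continuous_at)
  have "\<forall>s\<in>{..<0} \<union> {1<..}. deriv step s = 0"
  proof
    fix s :: real assume "s \<in> {..<0} \<union> {1<..}"
    then have "(\<forall>\<^sub>F u in nhds s. step u = 0) \<or> (\<forall>\<^sub>F u in nhds s. step u = 1)"
      using eventually_mono[OF eventually_nhds_in_open[of "{..<0}" s], of "\<lambda>u. step u = 0"]
        eventually_mono[OF eventually_nhds_in_open[of "{1<..}" s], of "\<lambda>u. step u = 1"]
      by (auto simp: step_eq_0 step_eq_1)
    then show "deriv step s = 0"
      using deriv_cong_ev[of step "\<lambda>_. 0" s s] deriv_cong_ev[of step "\<lambda>_. 1" s s] by auto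
  qed
  \<comment> \<open>The points 0 and 1 are reached by continuity of the derivative from the open set
    where \<open>step\<close> is locally constant.\<close>
  then have "deriv step ` closure ({..<0} \<union> {1<..}) \<subseteq> {0}"
    by (intro image_closure_subset[OF continuous_on_subset[OF continuous_on_deriv_step]]) auto
  moreover have "t \<in> closure ({..<0} \<union> {1<..})"
    using assms by (auto simp: closure_Un closure_lessThan closure_greaterThan)
  ultimately show ?thesis by auto
qed

lemma deriv_step_bounded:
  obtains M where "M > 0" "\<And>t. \<bar>deriv step t\<bar> \<le> M"
proof -
  have "bounded (deriv step ` {0..1})"
    by (intro compact_imp_bounded compact_continuous_image continuous_on_subset[OF continuous_on_deriv_step]) auto
  then obtain M where M: "M > 0" "\<And>t. t \<in> {0..1} \<Longrightarrow> \<bar>deriv step t\<bar> \<le> M"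
    by (auto simp: bounded_pos)
  then have "\<bar>deriv step t\<bar> \<le> M" for t
    using deriv_step_eq_0[of t] by (cases "t \<in> {0<..<1}") auto
  then show ?thesis using M(1) that by blast
qed

lemma deriv_step_pos: obtains t where "t \<in> {0<..<1}" "deriv step t > 0"
proof -
  obtain t where "0 < t" "t < 1" "step 1 - step 0 = (1 - 0) * deriv step t"
    using MVT2[of 0 1 step "deriv step"] step_deriv by auto
  then show ?thesis using that by (simp add: step_eq_0 step_eq_1)
qed

section \<open>Derivatives of Berwald's metric\<close>

definition conf :: "'a::real_inner \<Rightarrow> real" where
  "conf x = 1 - x \<bullet> x"

definition disc :: "'a::real_inner \<Rightarrow> 'a \<Rightarrow> real" where
  "disc x y = sqrt (conf x * (y \<bullet> y) + (x \<bullet> y)\<^sup>2)"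

definition funk :: "'a::real_inner \<Rightarrow> 'a \<Rightarrow> real" where
  "funk x y = (disc x y + x \<bullet> y) / conf x"

lemma conf_pos: "norm x < 1 \<Longrightarrow> conf x > 0"
  by (simp add: conf_def power2_norm_eq_inner[symmetric] power_less_one_iff abs_square_less_1)

lemma disc_sq: "norm x < 1 \<Longrightarrow> (disc x y)\<^sup>2 = conf x * (y \<bullet> y) + (x \<bullet> y)\<^sup>2"
  using conf_pos[of x] by (simp add: disc_def)

lemma disc_pos: "norm x < 1 \<Longrightarrow> y \<noteq> 0 \<Longrightarrow> disc x y > 0"
  using conf_pos[of x] by (simp add: disc_def add_pos_nonneg)

lemma abs_inner_less_disc: "norm x < 1 \<Longrightarrow> y \<noteq> 0 \<Longrightarrow> \<bar>x \<bullet> y\<bar> < disc x y"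
  using conf_pos[of x] by (auto simp: disc_def intro!: real_less_rsqrt)

lemma abs_inner_le_disc: "norm x < 1 \<Longrightarrow> \<bar>x \<bullet> y\<bar> \<le> disc x y"
  using abs_inner_less_disc[of x y] by (cases "y = 0") (auto simp: disc_def)

lemma conf_funk: "norm x < 1 \<Longrightarrow> conf x * funk x y = disc x y + x \<bullet> y"
  using conf_pos[of x] by (simp add: funk_def)

lemma funk_pos: "norm x < 1 \<Longrightarrow> y \<noteq> 0 \<Longrightarrow> funk x y > 0"
  using abs_inner_less_disc[of x y] conf_pos[of x] by (simp add: funk_def)

lemma funk_nonneg: "norm x < 1 \<Longrightarrow> funk x y \<ge> 0"
  using abs_inner_le_disc[of x y] conf_pos[of x] by (simp add: funk_def)

text \<open>The rationalised counterpart of \<open>conf_funk\<close>: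
  \<open>D^2 - (x \<bullet> y)^2 = conf x |y|^2\<close>. These two relations eliminate the square
  root from every later computation.\<close>

lemma funk_disc_minus: "norm x < 1 \<Longrightarrow> funk x y * (disc x y - x \<bullet> y) = y \<bullet> y"
  using conf_pos[of x] disc_sq[of x y] by (simp add: funk_def field_simps power2_eq_square)

lemma disc_scale: "c > 0 \<Longrightarrow> disc x (c *\<^sub>R y) = c * disc x y"
proof -
  assume "c > 0"
  have "conf x * (c *\<^sub>R y \<bullet> c *\<^sub>R y) + (x \<bullet> c *\<^sub>R y)\<^sup>2 = c\<^sup>2 * (conf x * (y \<bullet> y) + (x \<bullet> y)\<^sup>2)"
    by (simp add: algebra_simps power2_eq_square)
  then show ?thesis using \<open>c > 0\<close> unfolding disc_def by (simp add: real_sqrt_mult)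
qed

lemma funk_scale: "c > 0 \<Longrightarrow> funk x (c *\<^sub>R y) = c * funk x y"
  by (simp add: funk_def disc_scale algebra_simps)

lemma berwald_eq:
  "norm x < 1 \<Longrightarrow> berwald x y = (funk x y)\<^sup>2 / disc x y"
  using conf_pos[of x]
  by (simp add: berwald_def funk_def disc_def conf_def power2_norm_eq_inner power_divide)

text \<open>With the square expanded, \<open>disc\<close> is the only irrational ingredient; this is
  the form that is differentiated in \<open>y\<close>.\<close>

lemma berwald_eq':
  "norm x < 1 \<Longrightarrow> y \<noteq> 0 \<Longrightarrow> berwald x y = (disc x y + 2 * (x \<bullet> y) + (x \<bullet> y)\<^sup>2 / disc x y) / (conf x)\<^sup>2"
  using conf_pos[of x] disc_pos[of x y]
  by (simp add: berwald_eq funk_def field_simps power2_eq_square)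

lemma berwald_pos: "norm x < 1 \<Longrightarrow> y \<noteq> 0 \<Longrightarrow> berwald x y > 0"
  using funk_pos[of x y] disc_pos[of x y] by (simp add: berwald_eq)

lemma berwald_scale: "norm x < 1 \<Longrightarrow> c > 0 \<Longrightarrow> berwald x (c *\<^sub>R y) = c * berwald x y"
  by (simp add: berwald_eq disc_scale funk_scale power2_eq_square)

text \<open>The defining property of the Funk metric is that \<open>x + y / funk x y\<close> lies on
  the unit sphere, that is \<open>|y + funk x y x| = funk x y\<close>. The triangle inequality and
  \<open>|x| < 1\<close> give the factor 2.\<close>

lemma norm_le_2_funk: assumes "norm x < 1" shows "norm y \<le> 2 * funk x y"
proof -
  have "(norm (y + funk x y *\<^sub>R x))\<^sup>2 = y \<bullet> y + 2 * funk x y * (x \<bullet> y) + (funk x y)\<^sup>2 * (x \<bullet> x)"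
    unfolding power2_norm_eq_inner
    by (simp add: inner_add_left inner_add_right inner_commute algebra_simps power2_eq_square)
  also have "\<dots> = funk x y * (disc x y - x \<bullet> y) + 2 * funk x y * (x \<bullet> y) + (funk x y)\<^sup>2 * (1 - conf x)"
    by (simp add: funk_disc_minus[OF assms] conf_def)
  also have "\<dots> = funk x y * (disc x y + x \<bullet> y - conf x * funk x y) + (funk x y)\<^sup>2"
    by (simp add: algebra_simps power2_eq_square)
  also have "\<dots> = (funk x y)\<^sup>2"
    by (simp add: conf_funk[OF assms])
  finally have eq: "norm (y + funk x y *\<^sub>R x) = funk x y"
    using funk_nonneg[OF assms] by (simp add: power2_eq_iff_nonneg)
  have "norm y \<le> norm (y + funk x y *\<^sub>R x) + norm (funk x y *\<^sub>R x)"
    by (metis add_diff_cancel_right' norm_triangle_ineq4)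
  also have "norm (funk x y *\<^sub>R x) \<le> funk x y"
    using assms funk_nonneg[OF assms, of y] by (simp add: mult_left_le)
  finally show ?thesis using eq by simp
qed

lemma disc_le_norm: assumes "norm x < 1" shows "disc x y \<le> norm y"
proof -
  have "(x \<bullet> y)\<^sup>2 \<le> (x \<bullet> x) * (y \<bullet> y)" by (rule Cauchy_Schwarz_ineq)
  then have "conf x * (y \<bullet> y) + (x \<bullet> y)\<^sup>2 \<le> (norm y)\<^sup>2"
    by (simp add: conf_def power2_norm_eq_inner algebra_simps)
  then show ?thesis unfolding disc_def by (intro real_le_lsqrt) auto
qed

text \<open>In \<open>funk^2 / disc\<close> the numerator is at least \<open>|y|^2 / 4\<close> and
  the denominator at most \<open>|y|\<close>. This uniform bound makes the co-metric finite and
  bounds distances from below.\<close>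

lemma norm_le_4_berwald: assumes "norm x < 1" shows "norm y \<le> 4 * berwald x y"
proof (cases "y = 0")
  case False
  have "(norm y)\<^sup>2 \<le> (2 * funk x y)\<^sup>2"
    using norm_le_2_funk[OF assms] by (intro power_mono) auto
  then have "norm y * disc x y \<le> 4 * (funk x y)\<^sup>2"
    using disc_le_norm[OF assms, of y] mult_left_mono[of "disc x y" "norm y" "norm y"]
    by (simp add: power2_eq_square)
  then show ?thesis
    using disc_pos[OF assms False] by (simp add: berwald_eq[OF assms] pos_le_divide_eq)
qed (simp add: berwald_def)

text \<open>
  The suffixes 1 and 2 mark first and second derivatives in the variable \<open>y\<close>, in the directions
  given by the trailing arguments.
\<close>

definition disc1 :: "'a::real_inner \<Rightarrow> 'a \<Rightarrow> 'a \<Rightarrow> real" where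
  "disc1 x y v = (conf x * (y \<bullet> v) + (x \<bullet> y) * (x \<bullet> v)) / disc x y"

definition disc2 :: "'a::real_inner \<Rightarrow> 'a \<Rightarrow> 'a \<Rightarrow> 'a \<Rightarrow> real" where
  "disc2 x y u v = (conf x * (u \<bullet> v) + (x \<bullet> u) * (x \<bullet> v) - disc1 x y u * disc1 x y v) / disc x y"

definition funk1 :: "'a::real_inner \<Rightarrow> 'a \<Rightarrow> 'a \<Rightarrow> real" where
  "funk1 x y v = (funk x y * (x \<bullet> v) + y \<bullet> v) / disc x y"

definition ber1 :: "'a::real_inner \<Rightarrow> 'a \<Rightarrow> 'a \<Rightarrow> real" where
  "ber1 x y v = (disc1 x y v * (1 - (x \<bullet> y)\<^sup>2 / (disc x y)\<^sup>2) + 2 * (x \<bullet> v)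
     + 2 * (x \<bullet> y) * (x \<bullet> v) / disc x y) / (conf x)\<^sup>2"

text \<open>The derivative of \<open>funk^2 / disc\<close> in the base point \<open>x\<close>, in
  direction \<open>w\<close>, already simplified by the relation between the two derivatives of
  \<open>funk\<close>.\<close>

definition ber_x :: "'a::real_inner \<Rightarrow> 'a \<Rightarrow> 'a \<Rightarrow> real" where
  "ber_x x y w = 2 * (funk x y)\<^sup>2 * funk1 x y w / disc x y
     - (funk x y)\<^sup>2 * ((x \<bullet> y) * (y \<bullet> w) - (x \<bullet> w) * (y \<bullet> y)) / (disc x y) ^ 3"

text \<open>Arranged as \<open>disc2\<close> times a positive factor plus a symmetric product that
  becomes a square for \<open>u = v\<close>, so that symmetry and positivity can be read
  off.\<close>

definition ber2 :: "'a::real_inner \<Rightarrow> 'a \<Rightarrow> 'a \<Rightarrow> 'a \<Rightarrow> real" where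
  "ber2 x y u v = (disc2 x y u v * (1 - (x \<bullet> y)\<^sup>2 / (disc x y)\<^sup>2)
     + 2 / disc x y * (x \<bullet> u - (x \<bullet> y) * disc1 x y u / disc x y) * (x \<bullet> v - (x \<bullet> y) * disc1 x y v / disc x y))
     / (conf x)\<^sup>2"

lemma has_derivative_disc_y:
  assumes "norm x < 1" "y \<noteq> 0"
  shows "(disc x has_derivative disc1 x y) (at y)"
proof -
  have "conf x * (y \<bullet> y) + (x \<bullet> y)\<^sup>2 > 0"
    using disc_sq[OF assms(1)] disc_pos[OF assms] by (metis zero_less_power)
  then show ?thesis
    unfolding disc_def[abs_def] disc1_def[abs_def]
    by (auto intro!: derivative_eq_intros simp: inner_commute field_simps)
qed

lemma has_derivative_disc_x:
  assumes "norm x < 1" "y \<noteq> 0"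
  shows "((\<lambda>x. disc x y) has_derivative (\<lambda>w. ((x \<bullet> y) * (y \<bullet> w) - (x \<bullet> w) * (y \<bullet> y)) / disc x y)) (at x)"
proof -
  have "conf x * (y \<bullet> y) + (x \<bullet> y)\<^sup>2 > 0"
    using disc_sq[OF assms(1)] disc_pos[OF assms] by (metis zero_less_power)
  then show ?thesis
    unfolding disc_def[abs_def] conf_def[abs_def]
    by (auto intro!: derivative_eq_intros simp: inner_commute field_simps)
qed

lemma has_derivative_funk_y:
  assumes "norm x < 1" "y \<noteq> 0"
  shows "(funk x has_derivative funk1 x y) (at y)"
proof -
  have eq: "(disc1 x y v + x \<bullet> v) / conf x = funk1 x y v" for v
  proof -
    have "funk1 x y v = (conf x * funk x y * (x \<bullet> v) + conf x * (y \<bullet> v)) / (conf x * disc x y)"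
      using conf_pos[OF assms(1)] disc_pos[OF assms] by (simp add: funk1_def field_simps)
    then show ?thesis
      using conf_pos[OF assms(1)] disc_pos[OF assms]
      by (simp add: conf_funk[OF assms(1)] disc1_def field_simps)
  qed
  have "(funk x has_derivative (\<lambda>v. (disc1 x y v + x \<bullet> v) / conf x)) (at y)"
    unfolding funk_def[abs_def] using conf_pos[OF assms(1)]
    by (auto intro!: derivative_eq_intros has_derivative_disc_y assms)
  then show ?thesis by (simp add: eq[abs_def] eq)
qed

text \<open>Okada's identity for Funk metrics. After clearing \<open>conf x * disc x y\<close> it is
  a polynomial identity modulo \<open>conf_funk\<close> and \<open>funk_disc_minus\<close>.\<close>

lemma has_derivative_funk_x:
  assumes "norm x < 1" "y \<noteq> 0"
  shows "((\<lambda>x. funk x y) has_derivative (\<lambda>w. funk x y * funk1 x y w)) (at x)"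
proof -
  let ?d = "\<lambda>w. ((x \<bullet> y) * (y \<bullet> w) - (x \<bullet> w) * (y \<bullet> y)) / disc x y"
  note c = conf_pos[OF assms(1)] and d = disc_pos[OF assms]
  have eq: "(?d w + y \<bullet> w) / conf x + 2 * funk x y * (x \<bullet> w) / conf x = funk x y * funk1 x y w" for w
  proof -
    have "conf x * disc x y * (funk x y * funk1 x y w) = conf x * funk x y * (funk x y * (x \<bullet> w) + y \<bullet> w)"
      using d by (simp add: funk1_def)
    also have "\<dots> = (x \<bullet> y) * (y \<bullet> w) - (x \<bullet> w) * (funk x y * (disc x y - x \<bullet> y)) + disc x y * (y \<bullet> w)
        + 2 * disc x y * funk x y * (x \<bullet> w)"
      unfolding conf_funk[OF assms(1)] by (simp add: algebra_simps)
    also have "\<dots> = conf x * disc x y * ((?d w + y \<bullet> w) / conf x + 2 * funk x y * (x \<bullet> w) / conf x)"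
      unfolding funk_disc_minus[OF assms(1)] using c d by (simp add: field_simps)
    finally show ?thesis using c d by simp
  qed
  have "((\<lambda>x. conf x) has_derivative (\<lambda>w. - 2 * (x \<bullet> w))) (at x)"
    unfolding conf_def by (auto intro!: derivative_eq_intros simp: inner_commute)
  then have "((\<lambda>x. funk x y) has_derivative (\<lambda>w. (?d w + y \<bullet> w) / conf x + 2 * funk x y * (x \<bullet> w) / conf x)) (at x)"
    unfolding funk_def using c
    by (auto intro!: derivative_eq_intros has_derivative_disc_x assms simp: inner_commute field_simps)
  then show ?thesis by (simp only: eq)
qed

lemma eventually_ne: "(y::'a::real_normed_vector) \<noteq> 0 \<Longrightarrow> \<forall>\<^sub>F z in nhds y. z \<noteq> 0"
  using t1_space_nhds by blast

lemma eventually_norm_less: "norm x < 1 \<Longrightarrow> \<forall>\<^sub>F z in nhds x. norm z < 1"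
  using eventually_nhds_in_open[of "ball 0 1" x] by simp

lemma has_derivative_cong_nhds:
  assumes "\<forall>\<^sub>F z in nhds x. f z = g z" "(f has_derivative f') (at x)"
  shows "(g has_derivative f') (at x)"
proof -
  have "f x = g x" using assms(1) by (rule eventually_nhds_x_imp_x)
  moreover have "\<forall>\<^sub>F z in at x. f z = g z"
    using assms(1) unfolding eventually_at_filter by eventually_elim simp
  ultimately show ?thesis
    using has_derivative_transform_eventually[OF assms(2)] by simp
qed

lemma has_derivative_berwald_y:
  fixes x y :: "real^'n"
  assumes "norm x < 1" "y \<noteq> 0"
  shows "(berwald x has_derivative ber1 x y) (at y)"
proof -
  note c = conf_pos[OF assms(1)] and d = disc_pos[OF assms]
  have "((\<lambda>y. (disc x y + 2 * (x \<bullet> y) + (x \<bullet> y)\<^sup>2 / disc x y) / (conf x)\<^sup>2) has_derivative ber1 x y) (at y)"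
    unfolding ber1_def[abs_def] using c d
    by (auto intro!: derivative_eq_intros has_derivative_disc_y assms simp: field_simps power2_eq_square)
  then show ?thesis
    by (rule has_derivative_cong_nhds[rotated])
      (use eventually_ne[OF assms(2)] in eventually_elim, simp add: berwald_eq'[OF assms(1)])
qed

text \<open>Both sides are derivatives of the same function, differentiated once in expanded form
  and once as \<open>funk^2 / disc\<close>; uniqueness of the derivative replaces an algebraic
  comparison.\<close>

lemma ber1_eq:
  fixes x y :: "real^'n"
  assumes "norm x < 1" "y \<noteq> 0"
  shows "ber1 x y v = 2 * funk x y * funk1 x y v / disc x y - (funk x y)\<^sup>2 * disc1 x y v / (disc x y)\<^sup>2"
    (is "_ = ?f v")
proof -
  have "((\<lambda>y. (funk x y)\<^sup>2 / disc x y) has_derivative ?f) (at y)"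
    using disc_pos[OF assms]
    by (auto intro!: derivative_eq_intros has_derivative_disc_y has_derivative_funk_y assms simp: field_simps power2_eq_square)
  then have "(berwald x has_derivative ?f) (at y)"
    by (simp add: berwald_eq[OF assms(1), abs_def])
  from has_derivative_unique[OF has_derivative_berwald_y[OF assms] this] show ?thesis
    by (simp add: fun_eq_iff)
qed

lemma has_derivative_berwald_x:
  fixes x y :: "real^'n"
  assumes "norm x < 1" "y \<noteq> 0"
  shows "((\<lambda>x. berwald x y) has_derivative ber_x x y) (at x)"
proof -
  note d = disc_pos[OF assms]
  have "((\<lambda>x. (funk x y)\<^sup>2 / disc x y) has_derivative ber_x x y) (at x)"
    unfolding ber_x_def[abs_def] using d
    by (auto intro!: derivative_eq_intros has_derivative_disc_x has_derivative_funk_x assms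
        simp: field_simps power2_eq_square power3_eq_cube)
  then show ?thesis
    by (rule has_derivative_cong_nhds[rotated])
      (use eventually_norm_less[OF assms(1)] in eventually_elim, simp add: berwald_eq)
qed

lemma has_derivative_disc1_y:
  assumes "norm x < 1" "y \<noteq> 0"
  shows "((\<lambda>y. disc1 x y u) has_derivative (disc2 x y u)) (at y)"
  unfolding disc1_def disc2_def[abs_def] using disc_pos[OF assms]
  by (auto intro!: derivative_eq_intros has_derivative_disc_y assms
     simp: disc1_def inner_commute field_simps power2_eq_square)

lemma has_derivative_ber1_y:
  assumes "norm x < 1" "y \<noteq> 0"
  shows "((\<lambda>y. ber1 x y u) has_derivative (ber2 x y u)) (at y)"
proof -
  note c = conf_pos[OF assms(1)] and d = disc_pos[OF assms]
  define R where "R = (\<lambda>y. x \<bullet> y / disc x y)"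
  define R' where "R' = (\<lambda>v. (x \<bullet> v - x \<bullet> y * disc1 x y v / disc x y) / disc x y)"
  have r: "(R has_derivative R') (at y)"
    unfolding R_def R'_def using d
    by (auto intro!: derivative_eq_intros has_derivative_disc_y assms simp: field_simps)
  have "((\<lambda>y. (disc1 x y u * (1 - (R y)\<^sup>2) + 2 * (x \<bullet> u) + 2 * (x \<bullet> u) * R y))
      has_derivative (\<lambda>v. disc2 x y u v * (1 - (R y)\<^sup>2) - disc1 x y u * (2 * R y * R' v)
        + 2 * (x \<bullet> u) * R' v)) (at y)"
    by (auto intro!: derivative_eq_intros r has_derivative_disc1_y assms)
  from bounded_linear.has_derivative[OF bounded_linear_mult_left this, of "inverse ((conf x)\<^sup>2)"]
  have "((\<lambda>y. ber1 x y u) has_derivative (\<lambda>v. (disc2 x y u v * (1 - (R y)\<^sup>2) - disc1 x y u * (2 * R y * R' v)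
        + 2 * (x \<bullet> u) * R' v) / (conf x)\<^sup>2)) (at y)"
    by (simp add: ber1_def R_def power_mult_distrib power_inverse divide_inverse mult_ac)
  \<comment> \<open>The last two terms combine to
    \<open>2 R' v (x \<bullet> u - R disc1 x y u)\<close>, which is the symmetric product in
    \<open>ber2\<close>.\<close>
  moreover have "(disc2 x y u v * (1 - (R y)\<^sup>2) - disc1 x y u * (2 * R y * R' v) + 2 * (x \<bullet> u) * R' v) / (conf x)\<^sup>2
      = ber2 x y u v" for v
    by (simp add: ber2_def R_def R'_def power_divide algebra_simps diff_divide_distrib)
  ultimately show ?thesis
    by (simp add: fun_eq_iff)
qed

section \<open>The fundamental tensor as a bilinear form, half the y-Hessian of
  \<open>berwald^2\<close>, and its positivity\<close>

definition gform :: "real^'n \<Rightarrow> real^'n \<Rightarrow> real^'n \<Rightarrow> real^'n \<Rightarrow> real" where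
  "gform x y u v = ber1 x y u * ber1 x y v + berwald x y * ber2 x y u v"

lemma disc1_linear: "linear (disc1 x y)"
  by (rule linearI) (auto simp: disc1_def inner_add_right algebra_simps add_divide_distrib)

lemma ber1_linear: "linear (ber1 x y)"
proof -
  interpret linear "disc1 x y" by (rule disc1_linear)
  show ?thesis
    by (rule linearI)
      (auto simp: ber1_def add scale inner_add_right divide_inverse algebra_simps)
qed

lemma gform_commute: "gform x y u v = gform x y v u"
  by (simp only: gform_def ber2_def disc2_def inner_commute mult_ac)

lemma disc2_linear: "linear (disc2 x y u)"
proof -
  interpret linear "disc1 x y" by (rule disc1_linear)
  show ?thesis
    by (rule linearI)
      (auto simp: disc2_def add scale inner_add_right divide_inverse algebra_simps)
qed

lemma gform_linear: "linear (gform x y u)"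
proof -
  interpret d1: linear "disc1 x y" by (rule disc1_linear)
  interpret d2: linear "disc2 x y u" by (rule disc2_linear)
  interpret b1: linear "ber1 x y" by (rule ber1_linear)
  show ?thesis
    by (rule linearI)
      (auto simp: gform_def ber2_def d1.add d1.scale d2.add d2.scale b1.add b1.scale
        inner_add_right divide_inverse algebra_simps)
qed

text \<open>Contracts an index: sums over coordinates in the spray and curvature formulas become
  values of a linear map at a vector.\<close>

lemma linear_axis_sum:
  fixes f :: "real^'n \<Rightarrow> real"
  assumes "linear f"
  shows "(\<Sum>i\<in>UNIV. f (axis i 1) * v $ i) = f v"
proof -
  have "f v = f (\<Sum>i\<in>UNIV. v $ i *\<^sub>R axis i 1)"
    using basis_expansion[of v] by (simp add: scalar_mult_eq_scaleR)
  also have "\<dots> = (\<Sum>i\<in>UNIV. f (axis i 1) * v $ i)"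
    using assms by (simp add: linear_sum linear_scale mult.commute)
  finally show ?thesis by simp
qed

lemma gform_axis_sum: "(\<Sum>i\<in>UNIV. \<Sum>j\<in>UNIV. gform x y (axis i 1) (axis j 1) * u $ i * v $ j) = gform x y u v"
proof -
  have "(\<Sum>i\<in>UNIV. \<Sum>j\<in>UNIV. gform x y (axis i 1) (axis j 1) * u $ i * v $ j)
      = (\<Sum>i\<in>UNIV. (\<Sum>j\<in>UNIV. gform x y (axis i 1) (axis j 1) * v $ j) * u $ i)"
    by (simp add: sum_distrib_right sum_distrib_left mult_ac)
  also have "\<dots> = (\<Sum>i\<in>UNIV. gform x y v (axis i 1) * u $ i)"
    by (simp add: linear_axis_sum[OF gform_linear] gform_commute)
  finally show ?thesis by (simp add: linear_axis_sum[OF gform_linear] gform_commute)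
qed

text \<open>This and the next lemmas are Euler's relations for functions of \<open>y\<close>
  homogeneous of degree 1: the radial derivative returns the function, and the Hessian annihilates
  \<open>y\<close>.\<close>

lemma disc1_self: "norm x < 1 \<Longrightarrow> disc1 x y y = disc x y"
  using disc_sq[of x y] by (cases "disc x y = 0") (auto simp: disc1_def power2_eq_square field_simps)

lemma ber1_self: "norm x < 1 \<Longrightarrow> y \<noteq> 0 \<Longrightarrow> ber1 x y y = berwald x y"
  using disc_pos[of x y] conf_pos[of x]
  by (simp add: berwald_eq' ber1_def disc1_self field_simps power2_eq_square)

lemma ber2_self: "norm x < 1 \<Longrightarrow> y \<noteq> 0 \<Longrightarrow> ber2 x y y v = 0"
  using disc_pos[of x y] by (simp add: ber2_def disc2_def disc1_self) (simp add: disc1_def)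

lemma gform_self: "norm x < 1 \<Longrightarrow> y \<noteq> 0 \<Longrightarrow> gform x y y v = berwald x y * ber1 x y v"
  by (simp add: gform_def ber1_self ber2_self)

text \<open>\<open>disc x\<close> is the norm of the inner product
  \<open>conf x (u \<bullet> v) + (x \<bullet> u) (x \<bullet> v)\<close>, so this is strict
  Cauchy-Schwarz. The defect is \<open>conf^2\<close> times the Gram determinant of
  \<open>y, v\<close> plus \<open>conf\<close> times the square of
  \<open>(x \<bullet> v) y - (x \<bullet> y) v\<close>; the auxiliary \<open>w\<close> is
  \<open>|y|^2\<close> times the part of \<open>v\<close> orthogonal to \<open>y\<close>.\<close>

lemma disc2_pos:
  assumes "norm x < 1" "y \<noteq> 0" "v \<noteq> ((y \<bullet> v) / (y \<bullet> y)) *\<^sub>R y"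
  shows "disc2 x y v v > 0"
proof -
  let ?c = "conf x"
  note c = conf_pos[OF assms(1)] and d = disc_pos[OF assms(1,2)]
  define w where "w = (y \<bullet> y) *\<^sub>R v - (y \<bullet> v) *\<^sub>R y"
  have "v = ((y \<bullet> v) / (y \<bullet> y)) *\<^sub>R y" if "w = 0"
  proof -
    have "v = (1 / (y \<bullet> y)) *\<^sub>R ((y \<bullet> y) *\<^sub>R v)" using assms(2) by simp
    also have "(y \<bullet> y) *\<^sub>R v = (y \<bullet> v) *\<^sub>R y" using that by (simp add: w_def)
    finally show ?thesis by simp
  qed
  then have "w \<noteq> 0" using assms(3) by blast
  then have "w \<bullet> w > 0" by simp
  also have "w \<bullet> w = (y \<bullet> y) * ((y \<bullet> y) * (v \<bullet> v) - (y \<bullet> v)\<^sup>2)"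
    by (simp add: w_def inner_diff_left inner_diff_right inner_commute algebra_simps power2_eq_square)
  finally have pos: "(y \<bullet> y) * (v \<bullet> v) - (y \<bullet> v)\<^sup>2 > 0"
    by (rule zero_less_mult_pos) (use assms(2) in simp)
  have "0 \<le> ((x \<bullet> v) *\<^sub>R y - (x \<bullet> y) *\<^sub>R v) \<bullet> ((x \<bullet> v) *\<^sub>R y - (x \<bullet> y) *\<^sub>R v)" by simp
  then have nn: "0 \<le> (x \<bullet> v)\<^sup>2 * (y \<bullet> y) - 2 * (x \<bullet> v) * (x \<bullet> y) * (y \<bullet> v) + (x \<bullet> y)\<^sup>2 * (v \<bullet> v)"
    by (simp add: inner_diff_left inner_diff_right inner_commute algebra_simps power2_eq_square)
  have dd: "disc x y * disc1 x y v = ?c * (y \<bullet> v) + (x \<bullet> y) * (x \<bullet> v)"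
    using d by (simp add: disc1_def)
  have "(disc x y)\<^sup>2 * (?c * (v \<bullet> v) + (x \<bullet> v)\<^sup>2) - (disc x y * disc1 x y v)\<^sup>2
     = ?c\<^sup>2 * ((y \<bullet> y) * (v \<bullet> v) - (y \<bullet> v)\<^sup>2)
       + ?c * ((x \<bullet> v)\<^sup>2 * (y \<bullet> y) - 2 * (x \<bullet> v) * (x \<bullet> y) * (y \<bullet> v) + (x \<bullet> y)\<^sup>2 * (v \<bullet> v))"
    unfolding disc_sq[OF assms(1)] dd by (simp add: algebra_simps power2_eq_square)
  also have "\<dots> > 0" using pos nn c by (intro add_pos_nonneg mult_pos_pos mult_nonneg_nonneg) auto
  finally have "(disc x y)\<^sup>2 * (?c * (v \<bullet> v) + (x \<bullet> v) * (x \<bullet> v) - disc1 x y v * disc1 x y v) > 0"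
    by (simp add: power_mult_distrib algebra_simps power2_eq_square)
  then show ?thesis using d unfolding disc2_def by (simp add: zero_less_mult_iff)
qed

text \<open>On multiples \<open>k y\<close> the form equals \<open>(k F)^2\<close> by Euler's
  relations; off that line the Hessian part is already strictly positive.\<close>

lemma gform_pos:
  assumes "norm x < 1" "y \<noteq> 0" "v \<noteq> 0"
  shows "gform x y v v > 0"
proof -
  note c = conf_pos[OF assms(1)] and d = disc_pos[OF assms(1,2)] and b = berwald_pos[OF assms(1,2)]
  have "(x \<bullet> y)\<^sup>2 < (disc x y)\<^sup>2"
    using power_strict_mono[OF abs_inner_less_disc[OF assms(1,2)], of 2] by simp
  then have f: "1 - (x \<bullet> y)\<^sup>2 / (disc x y)\<^sup>2 > 0" using d by simp
  have "2 / disc x y * (x \<bullet> v - (x \<bullet> y) * disc1 x y v / disc x y)\<^sup>2 \<ge> 0"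
    using d by simp
  then have sq: "2 / disc x y * (x \<bullet> v - (x \<bullet> y) * disc1 x y v / disc x y) * (x \<bullet> v - (x \<bullet> y) * disc1 x y v / disc x y) \<ge> 0"
    by (simp only: power2_eq_square mult.assoc)
  show ?thesis
  proof (cases "v = ((y \<bullet> v) / (y \<bullet> y)) *\<^sub>R y")
    case True
    then obtain k where k: "v = k *\<^sub>R y" by blast
    have "gform x y v v = k * gform x y y v"
      unfolding k by (simp add: linear_scale[OF gform_linear] gform_commute[of x y "k *\<^sub>R y" y])
    also have "\<dots> = k\<^sup>2 * gform x y y y"
      unfolding k by (simp add: linear_scale[OF gform_linear] power2_eq_square)
    also have "\<dots> = (k * berwald x y)\<^sup>2"
      by (simp add: gform_self ber1_self assms power2_eq_square)
    finally show ?thesis using k b assms(3) by auto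
  next
    case False
    have "ber2 x y v v > 0"
      unfolding ber2_def using c f sq disc2_pos[OF assms(1,2) False]
      by (intro divide_pos_pos add_pos_nonneg mult_pos_pos) auto
    then show ?thesis using b unfolding gform_def by (intro add_nonneg_pos) auto
  qed
qed

section \<open>Coordinate derivatives of the metric expressed by total derivatives\<close>

lemma has_derivative_along:
  assumes "(h has_derivative h') (at (z::'a::real_normed_vector))"
  shows "((\<lambda>t. h (z + t *\<^sub>R v)) has_real_derivative h' v) (at 0)"
proof -
  have "((\<lambda>t. h (z + t *\<^sub>R v)) has_derivative (\<lambda>t. h' (t *\<^sub>R v))) (at 0)"
    by (rule has_derivative_compose[where g = h and f = "\<lambda>t. z + t *\<^sub>R v" and x = 0 and s = UNIV])
      (use assms in \<open>auto intro!: derivative_eq_intros\<close>)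
  then show ?thesis
    by (simp add: has_field_derivative_def linear_scale[OF has_derivative_linear[OF assms]] mult_commute_abs)
qed

lemma deriv_along: "(h has_derivative h') (at z) \<Longrightarrow> deriv (\<lambda>t. h (z + t *\<^sub>R v)) 0 = h' v"
  by (intro DERIV_imp_deriv has_derivative_along)

lemma dX_eq: "((\<lambda>x. h x y) has_derivative h') (at x) \<Longrightarrow> dX i h x y = h' (axis i 1)"
  unfolding dX_def by (rule deriv_along)

lemma dY_eq: "(h x has_derivative h') (at y) \<Longrightarrow> dY i h x y = h' (axis i 1)"
  unfolding dY_def by (rule deriv_along)

lemma has_derivative_berwald_sq_y:
  fixes x y :: "real^'n"
  assumes "norm x < 1" "y \<noteq> 0"
  shows "((\<lambda>y. (berwald x y)\<^sup>2) has_derivative (\<lambda>v. 2 * berwald x y * ber1 x y v)) (at y)"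
  by (auto intro!: derivative_eq_intros has_derivative_berwald_y assms)

lemma has_derivative_half_berwald_sq_y:
  fixes x y :: "real^'n"
  assumes "norm x < 1" "y \<noteq> 0"
  shows "((\<lambda>y. 2 * berwald x y * ber1 x y u) has_derivative (\<lambda>v. 2 * gform x y u v)) (at y)"
  by (auto intro!: derivative_eq_intros has_derivative_berwald_y has_derivative_ber1_y assms
      simp: gform_def algebra_simps)

lemma gten_berwald:
  fixes x y :: "real^'n"
  assumes "norm x < 1" "y \<noteq> 0"
  shows "gten berwald i j x y = gform x y (axis i 1) (axis j 1)"
proof -
  have "((dY j (\<lambda>x y. (berwald x y)\<^sup>2) x) has_derivative (\<lambda>v. 2 * gform x y (axis j 1) v)) (at y)"
  proof (rule has_derivative_cong_nhds)
    show "\<forall>\<^sub>F z in nhds y. 2 * berwald x z * ber1 x z (axis j 1) = dY j (\<lambda>x y. (berwald x y)\<^sup>2) x z"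
      using eventually_ne[OF assms(2)]
      by eventually_elim (use dY_eq[where h = "\<lambda>x y. (berwald x y)\<^sup>2", OF has_derivative_berwald_sq_y[OF assms(1)]] in simp)
  qed (rule has_derivative_half_berwald_sq_y[OF assms])
  then show ?thesis
    by (simp add: gten_def dY_eq gform_commute)
qed

lemma fund_quad_berwald:
  fixes x y v :: "real^'n"
  assumes "norm x < 1" "y \<noteq> 0"
  shows "fund_quad (berwald x) y v = gform x y v v"
proof -
  have lim: "((\<lambda>t. y + t *\<^sub>R v) \<longlongrightarrow> y) (nhds 0)"
    by (rule tendsto_eq_intros | simp add: tendsto_ident_at | rule filterlim_ident)+
  have "\<forall>\<^sub>F t in nhds 0. y + t *\<^sub>R v \<noteq> 0"
    using topological_tendstoD[OF lim, of "- {0}"] assms(2) by auto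
  then have "\<forall>\<^sub>F t in nhds 0. deriv (\<lambda>t. (berwald x (y + t *\<^sub>R v))\<^sup>2) t
      = 2 * berwald x (y + t *\<^sub>R v) * ber1 x (y + t *\<^sub>R v) v"
  proof eventually_elim
    case (elim t)
    have "((\<lambda>s. (berwald x (y + (s + t) *\<^sub>R v))\<^sup>2) has_real_derivative
        2 * berwald x (y + t *\<^sub>R v) * ber1 x (y + t *\<^sub>R v) v) (at 0)"
      using has_derivative_along[OF has_derivative_berwald_sq_y[OF assms(1) elim], of v]
      by (simp add: algebra_simps)
    then have "((\<lambda>s. (berwald x (y + s *\<^sub>R v))\<^sup>2) has_real_derivative
        2 * berwald x (y + t *\<^sub>R v) * ber1 x (y + t *\<^sub>R v) v) (at (0 + t))"
      by (subst DERIV_shift)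
    then show ?case by (simp add: DERIV_imp_deriv)
  qed
  then have "deriv (deriv (\<lambda>t. (berwald x (y + t *\<^sub>R v))\<^sup>2)) 0
      = deriv (\<lambda>t. 2 * berwald x (y + t *\<^sub>R v) * ber1 x (y + t *\<^sub>R v) v) 0"
    by (intro deriv_cong_ev) auto
  also have "\<dots> = 2 * gform x y v v"
    by (rule deriv_along[OF has_derivative_half_berwald_sq_y[OF assms]])
  finally show ?thesis by (simp add: fund_quad_def)
qed

lemma gmat_berwald_mult:
  fixes x y :: "real^'n"
  assumes "norm x < 1" "y \<noteq> 0"
  shows "(gmat berwald x y *v v) $ i = gform x y v (axis i 1)"
proof -
  have "(gmat berwald x y *v v) $ i = (\<Sum>j\<in>UNIV. gform x y (axis i 1) (axis j 1) * v $ j)"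
    by (simp add: gmat_def matrix_vector_mult_def gten_berwald[OF assms])
  then show ?thesis
    by (simp only: linear_axis_sum[OF gform_linear] gform_commute[of x y "axis i 1" v])
qed

lemma invertible_gmat_berwald:
  fixes x y :: "real^'n"
  assumes "norm x < 1" "y \<noteq> 0"
  shows "invertible (gmat berwald x y)"
proof -
  have "v = 0" if "gmat berwald x y *v v = 0" for v
  proof -
    have "gform x y v v = (\<Sum>i\<in>UNIV. (gmat berwald x y *v v) $ i * v $ i)"
      by (simp add: gmat_berwald_mult[OF assms] linear_axis_sum[OF gform_linear])
    then show ?thesis using that gform_pos[OF assms, of v] by auto
  qed
  then show ?thesis
    by (simp add: invertible_left_inverse matrix_left_invertible_ker)
qed

section \<open>The spray coefficients\<close>

lemma differentiable_disc_x: "norm x < 1 \<Longrightarrow> y \<noteq> 0 \<Longrightarrow> (\<lambda>x. disc x y) differentiable (at x)"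
  using has_derivative_disc_x differentiableI by blast

lemma differentiable_conf: "conf differentiable (at x)"
  unfolding conf_def[abs_def] by (intro derivative_intros) auto

text \<open>Differentiability suffices here: the spray formula contracts the x-derivatives of the
  tensor with \<open>y\<close>, and the contractions \<open>g(y, u) = F F_u\<close> and
  \<open>g(y, y) = F^2\<close> have closed forms.\<close>

lemma differentiable_gform_x:
  assumes "norm x < 1" "y \<noteq> 0"
  shows "(\<lambda>x. gform x y u v) differentiable (at x)"
proof -
  note c = conf_pos[OF assms(1)] and d = disc_pos[OF assms]
  have b: "(\<lambda>x. berwald x y) differentiable (at x)"
    using has_derivative_berwald_x[OF assms] differentiableI by blast
  note D = differentiable_disc_x[OF assms] and C = differentiable_conf
  have i: "(\<lambda>x. x \<bullet> w) differentiable (at x)" for w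
    by (intro differentiable_inner) auto
  have d1: "(\<lambda>x. disc1 x y w) differentiable (at x)" for w
    unfolding disc1_def using d
    by (intro differentiable_add differentiable_mult differentiable_divide D C i differentiable_const) auto
  have d2: "(\<lambda>x. disc2 x y u v) differentiable (at x)"
    unfolding disc2_def using d
    by (intro differentiable_add differentiable_diff differentiable_mult differentiable_divide D C i d1 differentiable_const) auto
  have b1: "(\<lambda>x. ber1 x y w) differentiable (at x)" for w
    unfolding ber1_def using c d
    by (intro differentiable_add differentiable_diff differentiable_mult differentiable_divide differentiable_power D C i d1 differentiable_const) auto
  have b2: "(\<lambda>x. ber2 x y u v) differentiable (at x)"
    unfolding ber2_def using c d
    by (intro differentiable_add differentiable_diff differentiable_mult differentiable_divide differentiable_power D C i d1 d2 differentiable_const) auto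
  show ?thesis
    unfolding gform_def by (intro differentiable_add differentiable_mult b b1 b2)
qed

text \<open>The radicand is \<open>|y|^2\<close> minus the Gram determinant of \<open>x\<close> and
  \<open>y\<close>, which does not change when a multiple of \<open>y\<close> is added to
  \<open>x\<close>.\<close>

lemma disc_along: "disc (x + t *\<^sub>R y) y = disc x y"
  by (simp add: disc_def conf_def inner_add_left inner_add_right inner_commute algebra_simps power2_eq_square)

lemma funk1_self: assumes "norm x < 1" "y \<noteq> 0" shows "funk1 x y y = funk x y"
  using funk_disc_minus[OF assms(1), of y] disc_pos[OF assms]
  by (simp add: funk1_def field_simps inner_commute)

lemma DERIV_funk_along:
  assumes "norm x < 1" "y \<noteq> 0"
  shows "((\<lambda>t. funk (x + t *\<^sub>R y) y) has_real_derivative (funk x y)\<^sup>2) (at 0)"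
  using has_derivative_along[OF has_derivative_funk_x[OF assms], of y]
  by (simp add: funk1_self[OF assms] power2_eq_square)

lemma berwald_ber1_eq:
  fixes x y :: "real^'n"
  assumes "norm x < 1" "y \<noteq> 0"
  shows "berwald x y * ber1 x y u = 2 * (funk x y) ^ 3 * (funk x y * (x \<bullet> u) + y \<bullet> u) / (disc x y) ^ 3
      - (funk x y) ^ 4 * (conf x * (y \<bullet> u) + (x \<bullet> y) * (x \<bullet> u)) / (disc x y) ^ 4"
  using disc_pos[OF assms]
  by (simp add: berwald_eq[OF assms(1)] ber1_eq[OF assms] funk1_def disc1_def right_diff_distrib
      power2_eq_square power3_eq_cube power4_eq_xxxx mult_ac)

text \<open>The derivative of \<open>F F_u\<close> in the base point along \<open>y\<close>. It
  comes from \<open>berwald_ber1_eq\<close>, where along the line \<open>disc\<close> is constant,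
  \<open>funk\<close> has derivative \<open>funk^2\<close>, and \<open>conf\<close> has derivative
  \<open>-2 (x \<bullet> y)\<close>.\<close>

definition ray_deriv :: "'a::real_inner \<Rightarrow> 'a \<Rightarrow> 'a \<Rightarrow> real" where
  "ray_deriv x y u = 8 * (funk x y) ^ 4 * (funk x y * (x \<bullet> u) + y \<bullet> u) / (disc x y) ^ 3
     - 4 * (funk x y) ^ 5 * (conf x * (y \<bullet> u) + (x \<bullet> y) * (x \<bullet> u)) / (disc x y) ^ 4
     - (funk x y) ^ 4 * ((y \<bullet> y) * (x \<bullet> u) - (x \<bullet> y) * (y \<bullet> u)) / (disc x y) ^ 4"

lemma DERIV_berwald_ber1_along:
  fixes x y :: "real^'n"
  assumes "norm x < 1" "y \<noteq> 0"
  shows "((\<lambda>t. berwald (x + t *\<^sub>R y) y * ber1 (x + t *\<^sub>R y) y u) has_real_derivative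
     ray_deriv x y u) (at 0)"
proof -
  define D where "D = disc x y"
  define f where "f = (\<lambda>t. funk (x + t *\<^sub>R y) y)"
  have f: "(f has_real_derivative (f 0)\<^sup>2) (at 0)" and f0: "f 0 = funk x y"
    using DERIV_funk_along[OF assms] by (simp_all add: f_def)
  define c where "c = (\<lambda>t. conf x - 2 * t * (x \<bullet> y) - t\<^sup>2 * (y \<bullet> y))"
  have c: "conf (x + t *\<^sub>R y) = c t" for t
    by (simp add: conf_def c_def inner_add_left inner_add_right inner_commute algebra_simps power2_eq_square)
  have D: "D > 0" using disc_pos[OF assms] by (simp add: D_def)
  have lim: "((\<lambda>t. x + t *\<^sub>R y) \<longlongrightarrow> x) (nhds 0)"
    by (rule tendsto_eq_intros | simp | rule filterlim_ident)+
  have ev: "\<forall>\<^sub>F t in nhds 0. berwald (x + t *\<^sub>R y) y * ber1 (x + t *\<^sub>R y) y u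
      = 2 * (f t) ^ 3 * (f t * (x \<bullet> u + t * (y \<bullet> u)) + y \<bullet> u) / D ^ 3
      - (f t) ^ 4 * (c t * (y \<bullet> u) + (x \<bullet> y + t * (y \<bullet> y)) * (x \<bullet> u + t * (y \<bullet> u))) / D ^ 4"
    (is "\<forall>\<^sub>F t in _. _ = ?g t")
    using topological_tendstoD[OF lim, of "ball 0 1"] assms(1)
    by (auto simp: elim!: eventually_mono)
      (simp add: berwald_ber1_eq[OF _ assms(2)] disc_along f_def D_def inner_add_left flip: c)
  have c': "(c has_real_derivative - 2 * (x \<bullet> y)) (at 0)"
    unfolding c_def by (auto intro!: derivative_eq_intros)
  have c0: "c 0 = conf x" by (simp add: c_def)
  have "((\<lambda>t. ?g t) has_real_derivative
      (8 * (f 0) ^ 4 * (f 0 * (x \<bullet> u) + y \<bullet> u)) / D ^ 3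
     - (4 * (f 0) ^ 5 * (c 0 * (y \<bullet> u) + (x \<bullet> y) * (x \<bullet> u))
     + (f 0) ^ 4 * ((y \<bullet> y) * (x \<bullet> u) - (x \<bullet> y) * (y \<bullet> u))) / D ^ 4) (at 0)"
    by (rule DERIV_diff DERIV_cdivide | (rule derivative_eq_intros f c' refl)+,
        simp add: algebra_simps power2_eq_square power3_eq_cube power4_eq_xxxx eval_nat_numeral)+
  from DERIV_cong_ev[OF refl ev refl, THEN iffD2, OF this] show ?thesis
    by (simp add: ray_deriv_def f0 c0 D_def add_divide_distrib diff_diff_eq)
qed

text \<open>The left side is the bracket of the spray formula paired with \<open>u\<close>; the
  right side is \<open>4 funk g(y, u)\<close>. This is what turns the spray into
  \<open>funk x y\<close> times \<open>y\<close>. Over the common denominator \<open>D^4\<close> it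
  is a polynomial identity modulo \<open>m T = D + a\<close> and
  \<open>|y|^2 = T (D - a)\<close>.\<close>

lemma spray_identity:
  fixes x y :: "real^'n"
  assumes "norm x < 1" "y \<noteq> 0"
  shows "2 * ray_deriv x y u
   - 2 * berwald x y * ber_x x y u
   = 4 * funk x y * (berwald x y * ber1 x y u)"
proof -
  define D T a b c m where defs: "D = disc x y" "T = funk x y" "a = x \<bullet> y" "b = x \<bullet> u" "c = y \<bullet> u" "m = conf x"
  have D: "D > 0" using disc_pos[OF assms] by (simp add: defs)
  have yy: "y \<bullet> y = T * (D - a)" using funk_disc_minus[OF assms(1), of y] by (simp add: defs)
  have m: "m * T = D + a" using conf_funk[OF assms(1), of y] by (simp add: defs)
  have d34: "z / D ^ 3 = z * D / D ^ 4" for z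
    using D by (simp add: eval_nat_numeral)
  have p2: "2 * (T\<^sup>2 / D) * (2 * T\<^sup>2 * ((T * b + c) / D) / D - T\<^sup>2 * z / D ^ 3)
      = 2 * (2 * T ^ 4 * (T * b + c) * D - T ^ 4 * z) / D ^ 4" for z
    using D by (simp add: right_diff_distrib diff_divide_distrib eval_nat_numeral mult_ac)
  show ?thesis
    unfolding berwald_ber1_eq[OF assms] ray_deriv_def ber_x_def
    unfolding berwald_eq[OF assms(1)] funk1_def
    unfolding defs[symmetric] yy p2
    unfolding d34 times_divide_eq_right diff_divide_distrib[symmetric]
    by (rule arg_cong[where f = "\<lambda>z. z / D ^ 4"]) (use m in algebra)
qed

lemma dX_gten_berwald:
  fixes x y :: "real^'n"
  assumes "norm x < 1" "y \<noteq> 0"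
  shows "dX k (gten berwald i j) x y = frechet_derivative (\<lambda>x. gform x y (axis i 1) (axis j 1)) (at x) (axis k 1)"
proof (rule dX_eq[OF has_derivative_cong_nhds])
  show "\<forall>\<^sub>F z in nhds x. gform z y (axis i 1) (axis j 1) = gten berwald i j z y"
    using eventually_norm_less[OF assms(1)] by eventually_elim (simp add: gten_berwald assms)
  show "((\<lambda>x. gform x y (axis i 1) (axis j 1)) has_derivative
      frechet_derivative (\<lambda>x. gform x y (axis i 1) (axis j 1)) (at x)) (at x)"
    using differentiable_gform_x[OF assms] frechet_derivative_works by blast
qed

lemma matrix_inv_left: "invertible A \<Longrightarrow> matrix_inv A ** A = mat 1"
  using someI_ex[of "\<lambda>A'. A ** A' = mat 1 \<and> A' ** A = mat 1"]
  by (simp add: invertible_def matrix_inv_def)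

text \<open>The bracket in the definition of \<open>spray\<close> equals \<open>4 funk\<close> times
  the metric matrix applied to \<open>y\<close>, so the inverse matrix and the factor
  \<open>1/4\<close> cancel.\<close>

lemma spray_berwald:
  fixes x y :: "real^'n"
  assumes "norm x < 1"
  shows "spray berwald i x y = funk x y * y $ i"
proof (cases "y = 0")
  case False
  note a = assms False
  define G where "G = (\<lambda>i j. frechet_derivative (\<lambda>x. gform x y (axis i 1) (axis j 1)) (at x))"
  have G: "((\<lambda>x. gform x y (axis i 1) (axis j 1)) has_derivative G i j) (at x)" for i j
    unfolding G_def using differentiable_gform_x[OF a] frechet_derivative_works by blast
  \<comment> \<open>\<open>W l\<close> and \<open>E\<close> are the x-derivatives of
    \<open>g(y, e_l) = F F_l\<close> and of \<open>g(y, y) = F^2\<close>. Writing them first as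
    index sums identifies them with the terms of the spray formula.\<close>
  define W where "W = (\<lambda>u w. \<Sum>j\<in>UNIV. G j u w * y $ j)"
  have W: "((\<lambda>x. gform x y y (axis l 1)) has_derivative W l) (at x)" for l
  proof -
    have "((\<lambda>x. \<Sum>j\<in>UNIV. gform x y (axis j 1) (axis l 1) * y $ j) has_derivative W l) (at x)"
      unfolding W_def by (intro derivative_intros G)
    then show ?thesis
      by (simp only: gform_commute[of _ y _ "axis l 1"] linear_axis_sum[OF gform_linear])
  qed
  define E where "E = (\<lambda>w. \<Sum>j\<in>UNIV. \<Sum>k\<in>UNIV. G j k w * y $ j * y $ k)"
  have "((\<lambda>x. \<Sum>j\<in>UNIV. \<Sum>k\<in>UNIV. gform x y (axis j 1) (axis k 1) * y $ j * y $ k) has_derivative E) (at x)"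
    unfolding E_def by (intro derivative_intros G)
  then have E: "((\<lambda>x. gform x y y y) has_derivative E) (at x)"
    by (simp only: gform_axis_sum)
  have E_eq: "E w = 2 * berwald x y * ber_x x y w" for w
  proof -
    have "((\<lambda>x. (berwald x y)\<^sup>2) has_derivative (\<lambda>w. 2 * berwald x y * ber_x x y w)) (at x)"
      by (auto intro!: derivative_eq_intros has_derivative_berwald_x a)
    moreover have "((\<lambda>x. (berwald x y)\<^sup>2) has_derivative E) (at x)"
      by (rule has_derivative_cong_nhds[OF _ E])
        (use eventually_norm_less[OF assms] in eventually_elim, simp add: gform_self ber1_self False power2_eq_square)
    ultimately show ?thesis using has_derivative_unique by (metis (no_types, lifting))
  qed
  have W_eq: "W l y = ray_deriv x y (axis l 1)" for l
  proof -
    have "((\<lambda>x. berwald x y * ber1 x y (axis l 1)) has_derivative W l) (at x)"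
      by (rule has_derivative_cong_nhds[OF _ W])
        (use eventually_norm_less[OF assms] in eventually_elim, simp add: gform_self False)
    from has_derivative_along[OF this, of y] DERIV_berwald_ber1_along[OF a, of "axis l 1"]
    show ?thesis by (rule DERIV_unique)
  qed
  have V: "(\<Sum>j\<in>UNIV. \<Sum>k\<in>UNIV. (2 * dX k (gten berwald j l) x y - dX l (gten berwald j k) x y) * y $ j * y $ k)
      = 4 * funk x y * (gmat berwald x y *v y) $ l" for l
  proof -
    have "(\<Sum>j\<in>UNIV. \<Sum>k\<in>UNIV. (2 * dX k (gten berwald j l) x y - dX l (gten berwald j k) x y) * y $ j * y $ k)
       = 2 * (\<Sum>j\<in>UNIV. \<Sum>k\<in>UNIV. G j l (axis k 1) * y $ j * y $ k) - E (axis l 1)"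
      by (simp add: dX_gten_berwald[OF a] G_def E_def left_diff_distrib sum_subtractf sum_distrib_left mult.assoc)
    also have "(\<Sum>j\<in>UNIV. \<Sum>k\<in>UNIV. G j l (axis k 1) * y $ j * y $ k) = (\<Sum>k\<in>UNIV. W l (axis k 1) * y $ k)"
      unfolding W_def sum_distrib_right by (rule sum.swap)
    also have "\<dots> = W l y"
      by (rule linear_axis_sum[OF has_derivative_linear[OF W]])
    also have "2 * W l y - E (axis l 1) = 4 * funk x y * (berwald x y * ber1 x y (axis l 1))"
      unfolding W_eq E_eq by (rule spray_identity[OF a])
    also have "\<dots> = 4 * funk x y * (gmat berwald x y *v y) $ l"
      by (simp add: gmat_berwald_mult[OF a] gform_self[OF a])
    finally show ?thesis .
  qed
  have "(\<Sum>l\<in>UNIV. matrix_inv (gmat berwald x y) $ i $ l * (4 * funk x y * (gmat berwald x y *v y) $ l))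
      = 4 * funk x y * (\<Sum>l\<in>UNIV. matrix_inv (gmat berwald x y) $ i $ l * (gmat berwald x y *v y) $ l)"
    by (simp add: sum_distrib_left mult_ac)
  then have "spray berwald i x y = funk x y * (\<Sum>l\<in>UNIV. matrix_inv (gmat berwald x y) $ i $ l * (gmat berwald x y *v y) $ l)"
    using False by (simp only: spray_def V) simp
  also have "(\<Sum>l\<in>UNIV. matrix_inv (gmat berwald x y) $ i $ l * (gmat berwald x y *v y) $ l)
     = (matrix_inv (gmat berwald x y) *v (gmat berwald x y *v y)) $ i"
    by (simp add: matrix_vector_mult_def)
  also have "\<dots> = y $ i"
    using matrix_inv_left[OF invertible_gmat_berwald[OF a]] by (simp add: matrix_vector_mul_assoc)
  finally show ?thesis .
qed (simp add: spray_def)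

section \<open>Vanishing of the Riemann curvature\<close>

lemma has_derivative_spray_y:
  fixes x y :: "real^'n"
  assumes "norm x < 1" "y \<noteq> 0"
  shows "(spray berwald i x has_derivative (\<lambda>v. funk1 x y v * y $ i + funk x y * v $ i)) (at y)"
proof -
  have "((\<lambda>y. funk x y * y $ i) has_derivative (\<lambda>v. funk1 x y v * y $ i + funk x y * v $ i)) (at y)"
    by (auto intro!: derivative_eq_intros has_derivative_funk_y assms bounded_linear.has_derivative[OF bounded_linear_vec_nth])
  then show ?thesis by (simp add: spray_berwald[OF assms(1), abs_def])
qed

lemma has_derivative_spray_x:
  fixes x y :: "real^'n"
  assumes "norm x < 1" "y \<noteq> 0"
  shows "((\<lambda>x. spray berwald i x y) has_derivative (\<lambda>w. funk x y * funk1 x y w * y $ i)) (at x)"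
proof -
  have "((\<lambda>x. funk x y * y $ i) has_derivative (\<lambda>w. funk x y * funk1 x y w * y $ i)) (at x)"
    by (auto intro!: derivative_eq_intros has_derivative_funk_x assms)
  then show ?thesis
    by (rule has_derivative_cong_nhds[rotated])
      (use eventually_norm_less[OF assms(1)] in eventually_elim, simp add: spray_berwald)
qed

text \<open>With \<open>T = funk\<close> and \<open>T_k\<close> its y-derivative, the four terms
  contribute \<open>2 - 1 + 2 - 3 = 0\<close> times \<open>T T_k y_i\<close> and
  \<open>0 - 1 + 2 - 1 = 0\<close> times \<open>T^2\<close> at \<open>i = k\<close>.\<close>

lemma riem_berwald:
  fixes x y :: "real^'n"
  assumes "norm x < 1" "y \<noteq> 0"
  shows "riem berwald i k x y = 0"
proof -
  note c = conf_pos[OF assms(1)] and d = disc_pos[OF assms]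
  let ?e = "\<lambda>k. axis k (1::real)"
  let ?q = "\<lambda>x y. funk1 x y (?e k) * y $ i + funk x y * ?e k $ i"
  have dY: "dY k (spray berwald i) x y = funk1 x y (?e k) * y $ i + funk x y * ?e k $ i"
    if "norm x < 1" "y \<noteq> 0" for i k and x y :: "real^'n"
    using dY_eq[where h = "spray berwald i", OF has_derivative_spray_y[OF that]] .

  have fy: "funk x differentiable (at y)" and fx: "(\<lambda>x. funk x y) differentiable (at x)"
    using has_derivative_funk_y[OF assms] has_derivative_funk_x[OF assms] differentiableI by blast+
  have dy: "disc x differentiable (at y)"
    using has_derivative_disc_y[OF assms] differentiableI by blast
  have qx: "(\<lambda>x. ?q x y) differentiable (at x)"
    unfolding funk1_def using d
    by (intro differentiable_add differentiable_mult differentiable_divide fx differentiable_disc_x assms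
         differentiable_const differentiable_inner differentiable_ident) auto
  have qy: "(\<lambda>y. ?q x y) differentiable (at y)"
    unfolding funk1_def using d
    by (intro differentiable_add differentiable_mult differentiable_divide fy dy
         differentiable_const differentiable_inner differentiable_ident
         bounded_linear_imp_differentiable bounded_linear_vec_nth) auto
  define X where "X = frechet_derivative (\<lambda>x. ?q x y) (at x)"
  define Y where "Y = frechet_derivative (\<lambda>y. ?q x y) (at y)"
  have X: "((\<lambda>x. ?q x y) has_derivative X) (at x)"
    using qx frechet_derivative_works unfolding X_def by blast
  have Y: "((\<lambda>y. ?q x y) has_derivative Y) (at y)"
    using qy frechet_derivative_works unfolding Y_def by blast
  have "((\<lambda>x. dY k (spray berwald i) x y) has_derivative X) (at x)"
    by (rule has_derivative_cong_nhds[OF _ X])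
      (use eventually_norm_less[OF assms(1)] in eventually_elim, simp add: dY assms(2))
  then have dX': "dX j (dY k (spray berwald i)) x y = X (?e j)" for j
    by (rule dX_eq)
  have "((dY k (spray berwald i) x) has_derivative Y) (at y)"
    by (rule has_derivative_cong_nhds[OF _ Y])
      (use eventually_ne[OF assms(2)] in eventually_elim, simp add: dY assms(1))
  then have dY': "dY j (dY k (spray berwald i)) x y = Y (?e j)" for j
    by (rule dY_eq)
  \<comment> \<open>Only the contraction with \<open>y\<close> enters, so differentiating along the
    line through \<open>x\<close> in direction \<open>y\<close> avoids mixed second derivatives of
    \<open>funk\<close>.\<close>
  have "X y = funk x y * funk1 x y (?e k) * y $ i + (funk x y)\<^sup>2 * ?e k $ i"
  proof (rule DERIV_unique[OF has_derivative_along[OF X]])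
    show "((\<lambda>t. ?q (x + t *\<^sub>R y) y) has_real_derivative
        funk x y * funk1 x y (?e k) * y $ i + (funk x y)\<^sup>2 * ?e k $ i) (at 0)"
      unfolding funk1_def disc_along using d
      by (auto intro!: derivative_eq_intros DERIV_funk_along assms
          simp: inner_add_left field_simps power2_eq_square)
  qed
  \<comment> \<open>Euler's relation again: the y-derivative of the spray is homogeneous of degree 1
    in \<open>y\<close>.\<close>
  moreover have "Y y = ?q x y"
  proof (rule DERIV_unique[OF has_derivative_along[OF Y]])
    have der: "((\<lambda>t. (1 + t) * ?q x y) has_real_derivative ?q x y) (at 0)"
      by (auto intro!: derivative_eq_intros)
    have ev: "\<forall>\<^sub>F t in nhds 0. (1 + t) * ?q x y = ?q x (y + t *\<^sub>R y)"
    proof -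
      have "\<forall>\<^sub>F t in nhds (0::real). t > - 1"
        using eventually_nhds_in_open[of "{-1<..}" "0::real"] by simp
      then show ?thesis
      proof eventually_elim
        case (elim t)
        define s where "s = 1 + t"
        have s: "s > 0" "y + t *\<^sub>R y = s *\<^sub>R y" using elim by (auto simp: s_def algebra_simps)
        have "funk1 x (s *\<^sub>R y) (?e k) = s * (funk x y * (x \<bullet> ?e k) + y \<bullet> ?e k) / (s * disc x y)"
          unfolding funk1_def funk_scale[OF s(1)] disc_scale[OF s(1)] by (simp add: ring_distribs mult.assoc)
        then have "funk1 x (s *\<^sub>R y) (?e k) = funk1 x y (?e k)"
          using s(1) by (simp add: funk1_def)
        then show ?case
          unfolding s(2) funk_scale[OF s(1)] s_def[symmetric] by (simp add: algebra_simps)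
      qed
    qed
    show "((\<lambda>t. ?q x (y + t *\<^sub>R y)) has_real_derivative ?q x y) (at 0)"
      by (rule DERIV_cong_ev[OF refl ev refl, THEN iffD1, OF der])
  qed
  moreover have "(\<Sum>j\<in>UNIV. y $ j * X (?e j)) = X y"
    using linear_axis_sum[OF has_derivative_linear[OF X], of y] by (simp add: mult.commute)
  moreover have "(\<Sum>j\<in>UNIV. spray berwald j x y * Y (?e j)) = funk x y * Y y"
    using arg_cong[OF linear_axis_sum[OF has_derivative_linear[OF Y], of y], of "(*) (funk x y)"]
    by (simp add: spray_berwald[OF assms(1)] sum_distrib_left mult_ac)
  moreover have "(\<Sum>j\<in>UNIV. dY j (spray berwald i) x y * dY k (spray berwald j) x y)
      = 3 * funk x y * funk1 x y (?e k) * y $ i + (funk x y)\<^sup>2 * ?e k $ i"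
  proof -
    have lin: "linear (\<lambda>v. funk1 x y v * y $ i + funk x y * v $ i)"
      using has_derivative_linear[OF has_derivative_spray_y[OF assms]] .
    have "(\<Sum>j\<in>UNIV. dY j (spray berwald i) x y * dY k (spray berwald j) x y)
      = (\<Sum>j\<in>UNIV. (funk1 x y (?e j) * y $ i + funk x y * ?e j $ i) * (funk1 x y (?e k) *\<^sub>R y + funk x y *\<^sub>R ?e k) $ j)"
      by (simp add: dY assms)
    also have "\<dots> = funk1 x y (funk1 x y (?e k) *\<^sub>R y + funk x y *\<^sub>R ?e k) * y $ i
        + funk x y * (funk1 x y (?e k) *\<^sub>R y + funk x y *\<^sub>R ?e k) $ i"
      by (rule linear_axis_sum[OF lin])
    also have "funk1 x y (funk1 x y (?e k) *\<^sub>R y + funk x y *\<^sub>R ?e k)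
        = funk1 x y (?e k) * funk1 x y y + funk x y * funk1 x y (?e k)"
      using has_derivative_linear[OF has_derivative_funk_y[OF assms]]
      by (simp add: linear_add linear_scale)
    finally show ?thesis by (simp add: funk1_self[OF assms] algebra_simps power2_eq_square)
  qed
  moreover have "dX k (spray berwald i) x y = funk x y * funk1 x y (?e k) * y $ i"
    by (subst dX_eq[where h = "spray berwald i"], rule has_derivative_spray_x[OF assms], rule refl)
  ultimately show ?thesis
    unfolding riem_def dX' dY' by (simp add: algebra_simps power2_eq_square)
qed

lemma flag_curvature_berwald: "flag_curvature_const (ball 0 1) (berwald :: real^'n \<Rightarrow> _) 0"
proof -
  have "riem_op berwald x y v = 0" if "norm x < 1" "y \<noteq> 0" for x y v :: "real^'n"
    by (simp add: riem_op_def riem_berwald[OF that] vec_eq_iff)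
  then show ?thesis
    by (simp add: flag_curvature_const_def flag_curvature_def gprod_def)
qed

section \<open>Geodesics and isometric embeddings\<close>

text \<open>Allowing \<open>X\<close> to be constant or linear covers smoothness of each norm
  \<open>berwald x\<close> and joint smoothness in \<open>(x, y)\<close> together.\<close>

lemma Ck_on_berwald:
  assumes X: "bounded_linear X \<or> (\<exists>a. X = (\<lambda>_. a))" and Y: "bounded_linear Y"
    and S: "\<And>z. z \<in> S \<Longrightarrow> norm (X z) < 1 \<and> Y z \<noteq> 0"
  shows "Ck_on k S (\<lambda>z::'a::euclidean_space. berwald (X z :: real^'n) (Y z))"
proof -
  have XX: "Ck_on k S (\<lambda>z. X z \<bullet> X z)" and XY: "Ck_on k S (\<lambda>z. X z \<bullet> Y z)"
    using X Y Ck_on_inner[of X X] Ck_on_inner[of X Y]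
    by (auto intro: Ck_on_const Ck_on_bounded_linear bounded_linear_compose[OF bounded_linear_inner_right])
  have D: "Ck_on k S (\<lambda>z. disc (X z) (Y z))"
    unfolding disc_def conf_def
    by (intro Ck_on_sqrt Ck_on_add Ck_on_mult Ck_on_diff Ck_on_power Ck_on_const XX XY Ck_on_inner Y)
      (use disc_pos S in \<open>force simp: disc_def conf_def\<close>)
  have "Ck_on k S (\<lambda>z. (disc (X z) (Y z) + X z \<bullet> Y z)\<^sup>2 / ((1 - X z \<bullet> X z)\<^sup>2 * disc (X z) (Y z)))"
    by (intro Ck_on_divide Ck_on_add Ck_on_mult Ck_on_diff Ck_on_power Ck_on_const XX XY D)
      (use disc_pos conf_pos S in \<open>force simp: conf_def\<close>)
  then show ?thesis
    by (simp add: berwald_def disc_def conf_def power2_norm_eq_inner)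
qed

lemma minkowski_norm_berwald: "norm x < 1 \<Longrightarrow> minkowski_norm (berwald (x :: real^'n))"
  unfolding minkowski_norm_def Cinf_on_def
  by (auto simp: berwald_pos berwald_scale fund_quad_berwald gform_pos
      intro!: Ck_on_berwald[where X = "\<lambda>_. x" and Y = "\<lambda>y. y"] bounded_linear_ident)

lemma finsler_metric_berwald: "finsler_metric (ball 0 1) (berwald :: real^'n \<Rightarrow> _)"
  unfolding finsler_metric_def Cinf_on_def split_def
  by (auto simp: minkowski_norm_berwald intro!: Ck_on_berwald bounded_linear_fst bounded_linear_snd)

section \<open>Straight lines, geodesics and forward completeness\<close>

lemma norm_less_1_iff_conf: "norm x < 1 \<longleftrightarrow> conf x > 0"
  by (simp add: conf_def power2_norm_eq_inner[symmetric] abs_square_less_1)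

text \<open>For \<open>y \<noteq> 0\<close> the line leaves the ball at parameter
  \<open>1 / funk x y\<close>: along it \<open>conf\<close> factors as
  \<open>(1 - \<tau> T) (m + \<tau> (D - a))\<close>, and the second factor stays positive.\<close>

lemma funk_along_line:
  assumes "norm x < 1" "0 \<le> \<tau>" "\<tau> * funk x y < 1"
  shows "norm (x + \<tau> *\<^sub>R y) < 1" and "funk (x + \<tau> *\<^sub>R y) y = funk x y / (1 - \<tau> * funk x y)"
proof -
  define D T a m where defs: "D = disc x y" "T = funk x y" "a = x \<bullet> y" "m = conf x"
  have yy: "y \<bullet> y = T * (D - a)" using funk_disc_minus[OF assms(1), of y] by (simp add: defs)
  have m: "m * T = D + a" using conf_funk[OF assms(1), of y] by (simp add: defs)
  have "conf (x + \<tau> *\<^sub>R y) = m - 2 * \<tau> * a - \<tau>\<^sup>2 * (y \<bullet> y)"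
    by (simp add: conf_def defs inner_add_left inner_add_right inner_commute algebra_simps power2_eq_square)
  also have "\<dots> = (1 - \<tau> * T) * (m + \<tau> * (D - a))"
    unfolding yy using m by algebra
  finally have c: "conf (x + \<tau> *\<^sub>R y) = (1 - \<tau> * T) * (m + \<tau> * (D - a))" .
  have p1: "1 - \<tau> * T > 0" using assms(3) by (simp add: defs)
  have p2: "m + \<tau> * (D - a) > 0"
    using conf_pos[OF assms(1)] abs_inner_le_disc[OF assms(1), of y] assms(2)
    by (intro add_pos_nonneg mult_nonneg_nonneg) (auto simp: defs)
  show "norm (x + \<tau> *\<^sub>R y) < 1"
    using p1 p2 c by (simp add: norm_less_1_iff_conf)
  have "D + (a + \<tau> * (y \<bullet> y)) = T * (m + \<tau> * (D - a))"
    unfolding yy using m by algebra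
  then have "funk (x + \<tau> *\<^sub>R y) y = T * (m + \<tau> * (D - a)) / ((1 - \<tau> * T) * (m + \<tau> * (D - a)))"
    by (simp add: funk_def disc_along c inner_add_left flip: defs)
  then show "funk (x + \<tau> *\<^sub>R y) y = funk x y / (1 - \<tau> * funk x y)"
    using p2 by (simp add: defs)
qed

lemma geodesic_berwald_iff:
  "geodesic_on (ball 0 1) berwald I (\<gamma> :: real \<Rightarrow> real^'n) \<longleftrightarrow> (\<exists>\<gamma>'. \<forall>t\<in>I. norm (\<gamma> t) < 1 \<and>
      (\<gamma> has_vector_derivative \<gamma>' t) (at t within I) \<and>
      (\<gamma>' has_vector_derivative (- 2 * funk (\<gamma> t) (\<gamma>' t)) *\<^sub>R \<gamma>' t) (at t within I))"
proof -
  have "(\<chi> i. - 2 * spray berwald i x y) = (- 2 * funk x y) *\<^sub>R y" if "norm x < 1" for x y :: "real^'n"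
    by (simp add: vec_eq_iff spray_berwald[OF that])
  then show ?thesis
    unfolding geodesic_on_def by (intro ex_cong1 ball_cong refl) auto
qed

text \<open>Solving \<open>q' = - q^2\<close> gives \<open>q / (1 + q t)\<close>, hence velocity
  \<open>y / (1 + q t)^2\<close> and line parameter \<open>t / (1 + q t)\<close>. The latter stays
  in the range where \<open>\<tau> q < 1\<close> for all \<open>t \<ge> 0\<close>.\<close>

lemma geodesic_ray:
  fixes x y :: "real^'n"
  assumes "norm x < 1"
  shows "geodesic_on (ball 0 1) berwald {0..} (\<lambda>t. x + (t / (1 + funk x y * t)) *\<^sub>R y)"
proof -
  define q where "q = funk x y"
  have q: "q \<ge> 0" using funk_nonneg[OF assms] by (simp add: q_def)
  show ?thesis
    unfolding geodesic_berwald_iff q_def[symmetric]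
  proof (intro exI[of _ "\<lambda>t. (1 / (1 + q * t)\<^sup>2) *\<^sub>R y"] ballI conjI)
    fix t :: real assume "t \<in> {0..}"
    then have t: "1 + q * t > 0" using q by (simp add: add_pos_nonneg)
    let ?\<tau> = "t / (1 + q * t)"
    have \<tau>: "0 \<le> ?\<tau>" "?\<tau> * funk x y < 1" and e: "1 - ?\<tau> * funk x y = 1 / (1 + q * t)"
      using t \<open>t \<in> {0..}\<close> by (auto simp: q_def[symmetric] field_simps)
    show "norm (x + ?\<tau> *\<^sub>R y) < 1" by (rule funk_along_line[OF assms \<tau>])
    have "funk (x + ?\<tau> *\<^sub>R y) y = q * (1 + q * t)"
      using funk_along_line(2)[OF assms \<tau>] unfolding e by (simp add: q_def)
    then have f: "funk (x + ?\<tau> *\<^sub>R y) ((1 / (1 + q * t)\<^sup>2) *\<^sub>R y) = q / (1 + q * t)"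
      using t by (simp add: funk_scale power2_eq_square)
    have "((\<lambda>t. t / (1 + q * t)) has_real_derivative 1 / (1 + q * t)\<^sup>2) (at t within {0..})"
      using t by (auto intro!: derivative_eq_intros simp: field_simps power2_eq_square)
    from has_vector_derivative_add[OF has_vector_derivative_const[of x]
        has_vector_derivative_scaleR[OF this has_vector_derivative_const[of y]]]
    show "((\<lambda>t. x + (t / (1 + q * t)) *\<^sub>R y) has_vector_derivative (1 / (1 + q * t)\<^sup>2) *\<^sub>R y) (at t within {0..})"
      by simp
    have "((\<lambda>t. 1 + q * t) has_real_derivative q) (at t within {0..})"
      by (auto intro!: derivative_eq_intros)
    from DERIV_power[OF DERIV_inverse_fun[OF this], of 2]
    have "((\<lambda>t. 1 / (1 + q * t)\<^sup>2) has_real_derivative - 2 * q / (1 + q * t) ^ 3) (at t within {0..})"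
      using t by (simp add: divide_inverse power_inverse eval_nat_numeral mult_ac)
    from has_vector_derivative_scaleR[OF this has_vector_derivative_const[of y]]
    have "((\<lambda>t. (1 / (1 + q * t)\<^sup>2) *\<^sub>R y) has_vector_derivative (- 2 * q / (1 + q * t) ^ 3) *\<^sub>R y) (at t within {0..})"
      by simp
    then show "((\<lambda>t. (1 / (1 + q * t)\<^sup>2) *\<^sub>R y) has_vector_derivative
        (- 2 * funk (x + ?\<tau> *\<^sub>R y) ((1 / (1 + q * t)\<^sup>2) *\<^sub>R y)) *\<^sub>R (1 / (1 + q * t)\<^sup>2) *\<^sub>R y) (at t within {0..})"
      unfolding f by (simp add: power2_eq_square power3_eq_cube mult.assoc)
  qed
qed

text \<open>Along a given curve the geodesic equation is linear in the velocity with a continuous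
  scalar coefficient, so an integrating factor makes \<open>exp (A t)\<close> times the velocity
  constant. This keeps a moving geodesic away from the zero vector, where \<open>funk\<close> need
  not be differentiable.\<close>

lemma geodesic_velocity_zero_iff:
  fixes \<gamma> :: "real \<Rightarrow> real^'n"
  assumes "\<And>t. t \<in> {0..<1} \<Longrightarrow> norm (\<gamma> t) < 1"
    and "\<And>t. t \<in> {0..<1} \<Longrightarrow> (\<gamma> has_vector_derivative \<gamma>' t) (at t within {0..<1})"
    and "\<And>t. t \<in> {0..<1} \<Longrightarrow> (\<gamma>' has_vector_derivative (- 2 * funk (\<gamma> t) (\<gamma>' t)) *\<^sub>R \<gamma>' t) (at t within {0..<1})"
    and s: "s \<in> {0..<1}"
  shows "\<gamma>' s = 0 \<longleftrightarrow> \<gamma>' 0 = 0"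
proof -
  have sub: "{0..s} \<subseteq> {0..<1}" using s by auto
  have cont: "continuous_on {0..<1} \<gamma>" by (rule continuous_on_vector_derivative[OF assms(2)])
  have cont': "continuous_on {0..<1} \<gamma>'" by (rule continuous_on_vector_derivative[OF assms(3)])
  have "continuous_on {0..<1} (\<lambda>t. funk (\<gamma> t) (\<gamma>' t))"
    unfolding funk_def disc_def conf_def using conf_pos[OF assms(1)]
    by (intro continuous_intros cont cont') (force simp: conf_def)
  then have "continuous_on {0..s} (\<lambda>t. 2 * funk (\<gamma> t) (\<gamma>' t))"
    by (intro continuous_intros) (rule continuous_on_subset[OF _ sub])
  then obtain A where A: "\<And>t. t \<in> {0..s} \<Longrightarrow> (A has_vector_derivative 2 * funk (\<gamma> t) (\<gamma>' t)) (at t within {0..s})"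
    using antiderivative_continuous by blast
  have "((\<lambda>t. exp (A t) *\<^sub>R \<gamma>' t) has_vector_derivative 0) (at t within {0..s})" if t: "t \<in> {0..s}" for t
  proof -
    have "((\<lambda>t. exp (A t)) has_real_derivative exp (A t) * (2 * funk (\<gamma> t) (\<gamma>' t))) (at t within {0..s})"
      using A[OF t] by (intro DERIV_chain2[OF DERIV_exp]) (simp add: has_real_derivative_iff_has_vector_derivative)
    moreover have "(\<gamma>' has_vector_derivative (- 2 * funk (\<gamma> t) (\<gamma>' t)) *\<^sub>R \<gamma>' t) (at t within {0..s})"
      using assms(3)[of t] t sub has_vector_derivative_within_subset by blast
    ultimately have "((\<lambda>t. exp (A t) *\<^sub>R \<gamma>' t) has_vector_derivative
       exp (A t) *\<^sub>R ((- 2 * funk (\<gamma> t) (\<gamma>' t)) *\<^sub>R \<gamma>' t) + (exp (A t) * (2 * funk (\<gamma> t) (\<gamma>' t))) *\<^sub>R \<gamma>' t) (at t within {0..s})"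
      by (rule has_vector_derivative_scaleR)
    then show ?thesis by (simp add: scaleR_left_distrib[symmetric])
  qed
  then obtain c where c: "\<And>t. t \<in> {0..s} \<Longrightarrow> exp (A t) *\<^sub>R \<gamma>' t = c"
    by (rule has_vector_derivative_zero_constant[OF convex_real_interval(5)]) auto
  have "exp (A 0) *\<^sub>R \<gamma>' 0 = exp (A s) *\<^sub>R \<gamma>' s" using c[of 0] c[of s] s by auto
  then show ?thesis by (metis exp_not_eq_zero scaleR_eq_0_iff)
qed

lemma has_real_derivative_funk_geodesic:
  fixes \<gamma> :: "real \<Rightarrow> 'a::real_inner"
  assumes "norm (\<gamma> t) < 1" "\<gamma>' t \<noteq> 0"
    and g: "(\<gamma> has_vector_derivative \<gamma>' t) (at t within I)"
    and g': "(\<gamma>' has_vector_derivative (- 2 * funk (\<gamma> t) (\<gamma>' t)) *\<^sub>R \<gamma>' t) (at t within I)"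
  shows "((\<lambda>t. funk (\<gamma> t) (\<gamma>' t)) has_real_derivative - (funk (\<gamma> t) (\<gamma>' t))\<^sup>2) (at t within I)"
proof -
  define m N a D q where defs: "m = (\<lambda>t. conf (\<gamma> t))" "N = (\<lambda>t. \<gamma>' t \<bullet> \<gamma>' t)" "a = (\<lambda>t. \<gamma> t \<bullet> \<gamma>' t)"
    "D = (\<lambda>t. disc (\<gamma> t) (\<gamma>' t))" "q = (\<lambda>t. funk (\<gamma> t) (\<gamma>' t))"
  note inner' = bounded_bilinear.has_vector_derivative[OF bounded_bilinear_inner]
  have m0: "m t > 0" and D0: "D t > 0" and Dsq: "(D t)\<^sup>2 = m t * N t + (a t)\<^sup>2"
    and mq: "m t * q t = D t + a t" and Nq: "N t = q t * (D t - a t)"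
    using conf_pos[OF assms(1)] disc_pos[OF assms(1,2)] disc_sq[OF assms(1)]
      conf_funk[OF assms(1)] funk_disc_minus[OF assms(1)] by (simp_all add: defs)
  have m: "(m has_real_derivative - 2 * a t) (at t within I)"
    unfolding defs conf_def
    using inner'[OF g g] by (auto intro!: derivative_eq_intros simp: has_real_derivative_iff_has_vector_derivative[symmetric] inner_commute)
  have N: "(N has_real_derivative - 4 * q t * N t) (at t within I)"
    unfolding defs has_real_derivative_iff_has_vector_derivative
    using inner'[OF g' g'] by (simp add: algebra_simps)
  have a: "(a has_real_derivative N t - 2 * q t * a t) (at t within I)"
    unfolding defs has_real_derivative_iff_has_vector_derivative
    using inner'[OF g g'] by (simp add: algebra_simps)
  have S: "((\<lambda>t. m t * N t + (a t)\<^sup>2) has_real_derivative - 4 * q t * (D t)\<^sup>2) (at t within I)"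
    unfolding Dsq by (auto intro!: derivative_eq_intros m N a simp: algebra_simps power2_eq_square)
  have sqrt: "((\<lambda>t. sqrt (m t * N t + (a t)\<^sup>2)) has_real_derivative - 4 * q t * (D t)\<^sup>2 * (inverse (D t) / 2)) (at t within I)"
  proof -
    have "(sqrt has_real_derivative inverse (sqrt (m t * N t + (a t)\<^sup>2)) / 2) (at (m t * N t + (a t)\<^sup>2))"
      using D0 by (intro DERIV_real_sqrt) (simp flip: Dsq)
    from DERIV_chain2[OF this S] show ?thesis
      using D0 by (simp only: mult.commute[of "inverse _ / 2"] Dsq[symmetric] real_sqrt_abs abs_of_pos)
  qed
  have D: "(D has_real_derivative - 2 * q t * D t) (at t within I)"
  proof -
    have "(\<lambda>t. sqrt (m t * N t + (a t)\<^sup>2)) = D" by (simp add: defs disc_def)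
    moreover have "- 4 * q t * (D t)\<^sup>2 * (inverse (D t) / 2) = - 2 * q t * D t"
      using D0 by (simp add: power2_eq_square)
    ultimately show ?thesis using sqrt by (simp only:)
  qed
  have "((\<lambda>t. (D t + a t) / m t) has_real_derivative
      ((- 2 * q t * D t + (N t - 2 * q t * a t)) * m t - (D t + a t) * (- 2 * a t)) / (m t * m t)) (at t within I)"
    using m0 by (intro DERIV_divide DERIV_add D a m) auto
  moreover have "((- 2 * q t * D t + (N t - 2 * q t * a t)) * m t - (D t + a t) * (- 2 * a t)) = - (q t)\<^sup>2 * (m t * m t)"
    unfolding Nq using mq by algebra
  moreover have "(\<lambda>t. (D t + a t) / m t) = q" by (simp add: defs funk_def fun_eq_iff)
  ultimately show ?thesis using m0 by (simp add: defs)
qed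

text \<open>Three successive constants of motion identify any geodesic with a ray:
  \<open>1/q - s\<close> if it moves, then \<open>(1 + q t)^2\<close> times the velocity, then the
  position minus \<open>t / (1 + q t)\<close> times the initial velocity.\<close>

lemma forward_complete_berwald: "forward_complete (ball 0 1) (berwald :: real^'n \<Rightarrow> _)"
  unfolding forward_complete_def
proof (intro allI impI)
  fix \<gamma> :: "real \<Rightarrow> real^'n"
  let ?I = "{0..<1::real}"
  assume "geodesic_on (ball 0 1) berwald ?I \<gamma>"
  then obtain \<gamma>' where B: "\<And>t. t \<in> ?I \<Longrightarrow> norm (\<gamma> t) < 1"
    and g: "\<And>t. t \<in> ?I \<Longrightarrow> (\<gamma> has_vector_derivative \<gamma>' t) (at t within ?I)"
    and g': "\<And>t. t \<in> ?I \<Longrightarrow> (\<gamma>' has_vector_derivative (- 2 * funk (\<gamma> t) (\<gamma>' t)) *\<^sub>R \<gamma>' t) (at t within ?I)"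
    unfolding geodesic_berwald_iff by blast
  define x y q where "x = \<gamma> 0" and "y = \<gamma>' 0" and "q = funk (\<gamma> 0) (\<gamma>' 0)"
  have x: "norm x < 1" using B[of 0] by (simp add: x_def)
  have q: "q \<ge> 0" using funk_nonneg[OF x] by (simp add: x_def q_def)
  have pos: "1 + q * t > 0" if "t \<in> ?I" for t
    using q that by (simp add: add_pos_nonneg)
  note const = has_vector_derivative_zero_constant[of ?I, OF convex_real_interval(7)]
  have "funk (\<gamma> t) (\<gamma>' t) * (1 + q * t) = q" if t: "t \<in> ?I" for t
  proof (cases "y = 0")
    case True
    have "\<gamma>' t = 0" "\<gamma>' 0 = 0"
      using geodesic_velocity_zero_iff[OF B g g' t] True y_def by auto
    then show ?thesis by (simp add: q_def funk_def disc_def)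
  next
    case False
    then have nz: "\<gamma>' s \<noteq> 0" if "s \<in> ?I" for s
      using geodesic_velocity_zero_iff[OF B g g' that] y_def by auto
    let ?q = "\<lambda>t. funk (\<gamma> t) (\<gamma>' t)"
    have qp: "?q s > 0" if "s \<in> ?I" for s using funk_pos B nz that by blast
    have "((\<lambda>s. inverse (?q s) - s) has_vector_derivative 0) (at s within ?I)" if "s \<in> ?I" for s
      unfolding has_real_derivative_iff_has_vector_derivative[symmetric]
      using qp[OF that]
      by (auto intro!: derivative_eq_intros has_real_derivative_funk_geodesic B nz g g' that
          simp: power2_eq_square field_simps)
    then obtain c where "\<And>s. s \<in> ?I \<Longrightarrow> inverse (?q s) - s = c"
      by (rule const) auto
    from this[of t] this[of 0] t have "inverse (?q t) = inverse (?q 0) + t" by auto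
    then show ?thesis using qp[OF t] qp[of 0] by (simp add: q_def field_simps)
  qed
  then have qt: "funk (\<gamma> t) (\<gamma>' t) = q / (1 + q * t)" if "t \<in> ?I" for t
    using pos[OF that] that by (simp add: nonzero_eq_divide_eq)
  have "((\<lambda>t. (1 + q * t)\<^sup>2 *\<^sub>R \<gamma>' t) has_vector_derivative 0) (at t within ?I)" if t: "t \<in> ?I" for t
  proof -
    have "((\<lambda>t. (1 + q * t)\<^sup>2) has_real_derivative 2 * q * (1 + q * t)) (at t within ?I)"
      by (auto intro!: derivative_eq_intros)
    from has_vector_derivative_scaleR[OF this g'[OF t]]
    show ?thesis using pos[OF t] by (simp add: qt[OF t] power2_eq_square mult_ac)
  qed
  then obtain c where "\<And>t. t \<in> ?I \<Longrightarrow> (1 + q * t)\<^sup>2 *\<^sub>R \<gamma>' t = c"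
    by (rule const) auto
  from this[of 0] this have y: "(1 + q * t)\<^sup>2 *\<^sub>R \<gamma>' t = y" if "t \<in> ?I" for t
    using that by (simp add: y_def)
  have v: "\<gamma>' t = (1 / (1 + q * t)\<^sup>2) *\<^sub>R y" if "t \<in> ?I" for t
    using pos[OF that] by (simp flip: y[OF that])
  have "((\<lambda>t. \<gamma> t - (t / (1 + q * t)) *\<^sub>R y) has_vector_derivative 0) (at t within ?I)" if t: "t \<in> ?I" for t
  proof -
    have "((\<lambda>t. t / (1 + q * t)) has_real_derivative 1 / (1 + q * t)\<^sup>2) (at t within ?I)"
      using pos[OF t] by (auto intro!: derivative_eq_intros simp: field_simps power2_eq_square)
    from has_vector_derivative_diff[OF g[OF t] has_vector_derivative_scaleR[OF this has_vector_derivative_const[of y]]]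
    show ?thesis by (simp add: v[OF t])
  qed
  then obtain c where c: "\<And>t. t \<in> ?I \<Longrightarrow> \<gamma> t - (t / (1 + q * t)) *\<^sub>R y = c"
    by (rule const) auto
  have "x + (t / (1 + q * t)) *\<^sub>R y = \<gamma> t" if "t \<in> ?I" for t
    using c[OF that] c[of 0] by (simp add: x_def algebra_simps)
  moreover have "q = funk x y" by (simp add: q_def x_def y_def)
  ultimately show "\<exists>\<eta>. geodesic_on (ball 0 1) berwald {0..} \<eta> \<and> (\<forall>t\<in>?I. \<eta> t = \<gamma> t)"
    using geodesic_ray[OF x, of y] by blast
qed

section \<open>Irreversibility and the absence of embeddings into Minkowski spaces\<close>

lemma berwald_radial:
  fixes e :: "real^'n"
  assumes "norm e = 1" "0 \<le> r" "r < 1"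
  shows "berwald (r *\<^sub>R e) e = 1 / (1 - r)\<^sup>2" "berwald (r *\<^sub>R e) (- e) = 1 / (1 + r)\<^sup>2"
proof -
  have e: "e \<bullet> e = 1" using assms(1) by (simp add: dot_square_norm)
  have r: "norm (r *\<^sub>R e) < 1" using assms by simp
  have c: "conf (r *\<^sub>R e) = (1 - r) * (1 + r)" by (simp add: conf_def e algebra_simps)
  have "disc (r *\<^sub>R e) e = 1" "disc (r *\<^sub>R e) (- e) = 1"
    by (simp_all add: disc_def conf_def e power2_eq_square)
  moreover have "(1 + r) / ((1 - r) * (1 + r)) = 1 / (1 - r)" "(1 - r) / ((1 - r) * (1 + r)) = 1 / (1 + r)"
    using assms(2,3) by simp_all
  ultimately show "berwald (r *\<^sub>R e) e = 1 / (1 - r)\<^sup>2" "berwald (r *\<^sub>R e) (- e) = 1 / (1 + r)\<^sup>2"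
    by (simp_all add: berwald_eq[OF r] funk_def c e power_one_over)
qed

text \<open>The ratio of forward to backward length is continuous on the compact unit sphere, and
  homogeneity carries its bound to all nonzero vectors.\<close>

lemma minkowski_norm_reversibility:
  fixes \<phi> :: "'v::euclidean_space \<Rightarrow> real"
  assumes "minkowski_norm \<phi>"
  obtains \<Lambda> where "\<And>w. w \<noteq> 0 \<Longrightarrow> \<phi> w \<le> \<Lambda> * \<phi> (- w)"
proof -
  have pos: "\<And>w. w \<noteq> 0 \<Longrightarrow> \<phi> w > 0" and hom: "\<And>c w. c > 0 \<Longrightarrow> \<phi> (c *\<^sub>R w) = c * \<phi> w"
    and cont: "continuous_on (sphere 0 1) \<phi>"
    using assms by (auto simp: minkowski_norm_def intro: continuous_on_subset[OF Cinf_on_continuous_on])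
  have cont': "continuous_on (sphere 0 1) (\<lambda>w. \<phi> (- w))"
    by (rule continuous_on_compose2[OF cont]) (auto intro: continuous_intros)
  have "continuous_on (sphere 0 1) (\<lambda>w. \<phi> w / \<phi> (- w))"
    using pos by (intro continuous_on_divide cont cont') (metis mem_sphere_0 less_irrefl neg_equal_0_iff_equal norm_zero zero_neq_one)
  then have "bounded ((\<lambda>w. \<phi> w / \<phi> (- w)) ` sphere 0 1)"
    by (intro compact_imp_bounded compact_continuous_image) auto
  then obtain \<Lambda> where "\<forall>z\<in>(\<lambda>w. \<phi> w / \<phi> (- w)) ` sphere 0 1. norm z \<le> \<Lambda>"
    unfolding bounded_iff by blast
  then have \<Lambda>: "\<bar>\<phi> w / \<phi> (- w)\<bar> \<le> \<Lambda>" if "norm w = 1" for w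
    using that by auto
  have "\<phi> w \<le> \<Lambda> * \<phi> (- w)" if "w \<noteq> 0" for w
  proof -
    define u where "u = (1 / norm w) *\<^sub>R w"
    have u: "norm u = 1" "w = norm w *\<^sub>R u" "- w = norm w *\<^sub>R (- u)" using that by (auto simp: u_def)
    have "u \<noteq> 0" using u(1) by auto
    then have "\<phi> u \<le> \<Lambda> * \<phi> (- u)"
      using \<Lambda>[OF u(1)] pos[of "- u"] by (simp add: abs_le_iff pos_divide_le_eq)
    then show ?thesis
      using hom[of "norm w" u] hom[of "norm w" "- u"] u that by (metis mult.left_commute mult_left_mono norm_ge_zero zero_less_norm_iff)
  qed
  then show ?thesis using that by blast
qed

lemma no_isometric_embedding_berwald:
  fixes \<phi> :: "'v::euclidean_space \<Rightarrow> real" and \<psi> :: "real^'n \<Rightarrow> 'v"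
  assumes \<phi>: "minkowski_norm \<phi>" and \<psi>: "Cinf_on (ball 0 1) \<psi>"
    and iso: "\<And>x y. x \<in> ball 0 1 \<Longrightarrow> \<phi> (frechet_derivative \<psi> (at x) y) = berwald x y"
  shows False
proof -
  obtain \<Lambda> where \<Lambda>: "\<And>w. w \<noteq> 0 \<Longrightarrow> \<phi> w \<le> \<Lambda> * \<phi> (- w)"
    using minkowski_norm_reversibility[OF \<phi>] by blast
  obtain e :: "real^'n" where e: "norm e = 1" using vector_choose_size zero_le_one by blast
  \<comment> \<open>Chosen so that \<open>1 / (1 - r) = |\<Lambda>| + 2\<close>: the outward length
    exceeds \<Lambda> times the inward one, which is at most 1.\<close>
  define r where "r = 1 - 1 / (\<bar>\<Lambda>\<bar> + 2)"
  have r: "0 < r" "r < 1" by (auto simp: r_def field_simps)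
  let ?x = "r *\<^sub>R e"
  have x: "?x \<in> ball 0 1" using r e by simp
  define w where "w = frechet_derivative \<psi> (at ?x) e"
  have "linear (frechet_derivative \<psi> (at ?x))"
    using Cinf_on_differentiable[OF \<psi> x] by (rule linear_frechet_derivative)
  then have "- w = frechet_derivative \<psi> (at ?x) (- e)"
    by (simp add: w_def linear_neg)
  then have v: "\<phi> w = 1 / (1 - r)\<^sup>2" "\<phi> (- w) = 1 / (1 + r)\<^sup>2"
    using iso[OF x] berwald_radial[OF e less_imp_le[OF r(1)] r(2)] by (auto simp: w_def)
  \<comment> \<open>If the differential killed \<open>e\<close>, then \<open>w = - w\<close> would
    have equal forward and backward lengths, contradicting the two radial values.\<close>
  have "w \<noteq> 0"
  proof
    assume "w = 0"
    then have "(1 - r)\<^sup>2 = (1 + r)\<^sup>2" using v r by (simp add: power2_eq_square)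
    then show False using r by (simp add: power2_eq_square algebra_simps)
  qed
  have "\<bar>\<Lambda>\<bar> + 2 = 1 / (1 - r)" by (simp add: r_def)
  also have "\<dots> \<le> 1 / (1 - r)\<^sup>2"
    using r by (simp add: divide_simps power2_eq_square)
  also have "\<dots> \<le> \<Lambda> * (1 / (1 + r)\<^sup>2)" using \<Lambda>[OF \<open>w \<noteq> 0\<close>] v by simp
  also have "\<dots> \<le> \<bar>\<Lambda>\<bar> * 1"
    using r by (intro mult_mono) (auto simp: divide_simps)
  finally show False by simp
qed

section \<open>The distance from the origin\<close>

text \<open>Lebesgue differentiation with averages over \<open>[x, x + k]\<close> yields the right
  derivative; applied to the reflected integrand it yields the left one.\<close>

lemma indefinite_integral_DERIV_AE:
  fixes F h :: "real \<Rightarrow> real"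
  assumes int: "\<And>a b. a \<le> b \<Longrightarrow> (h has_integral F b - F a) {a..b}"
  obtains N where "negligible N" "\<And>x. x \<notin> N \<Longrightarrow> (F has_real_derivative h x) (at x)"
proof -
  have i: "h integrable_on cbox a b" for a b
    using int[of a b] by (cases "a \<le> b") auto
  have int': "((\<lambda>x. h (- x)) has_integral F (- a) - F (- b)) {a..b}" if "a \<le> b" for a b
    using int[of "- b" "- a"] that has_integral_reflect_real[where f = h and a = "- b" and b = "- a"] by simp
  then have i': "(\<lambda>x. h (- x)) integrable_on cbox a b" for a b
    by (cases "a \<le> b") auto
  obtain N1 where N1: "negligible N1" "\<And>x e. \<lbrakk>x \<notin> N1; 0 < e\<rbrakk> \<Longrightarrow> \<exists>d>0. \<forall>k. 0 < k \<and> k < d \<longrightarrow>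
      norm (integral (cbox x (x + k *\<^sub>R One)) h /\<^sub>R k ^ DIM(real) - h x) < e"
    using integrable_ccontinuous_explicit[OF i] by blast
  obtain N2 where N2: "negligible N2" "\<And>x e. \<lbrakk>x \<notin> N2; 0 < e\<rbrakk> \<Longrightarrow> \<exists>d>0. \<forall>k. 0 < k \<and> k < d \<longrightarrow>
      norm (integral (cbox x (x + k *\<^sub>R One)) (\<lambda>x. h (- x)) /\<^sub>R k ^ DIM(real) - h (- x)) < e"
    using integrable_ccontinuous_explicit[OF i'] by blast
  show ?thesis
  proof (rule that)
    have "negligible (uminus ` N2)"
      by (rule negligible_locally_Lipschitz_image[OF _ N2(1)])
        (auto intro!: exI[of _ UNIV] exI[of _ "1::real"] simp: abs_minus_commute)
    then show "negligible (N1 \<union> uminus ` N2)" using N1(1) by (rule negligible_Un[rotated])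
    fix x assume x: "x \<notin> N1 \<union> uminus ` N2"
    then have "- x \<notin> N2" by force
    show "(F has_real_derivative h x) (at x)"
      unfolding DERIV_def
    proof (rule LIM_I)
      fix e :: real assume e: "e > 0"
      obtain d1 where d1: "d1 > 0" "\<And>k. 0 < k \<Longrightarrow> k < d1 \<Longrightarrow> \<bar>(F (x + k) - F x) / k - h x\<bar> < e"
      proof -
        obtain d where "d > 0" "\<And>k. 0 < k \<Longrightarrow> k < d \<Longrightarrow>
            norm (integral (cbox x (x + k *\<^sub>R One)) h /\<^sub>R k ^ DIM(real) - h x) < e"
          using N1(2)[of x e] x e by blast
        then show ?thesis
          using that[of d] integral_unique[OF int] by (simp add: divide_inverse mult.commute)
      qed
      obtain d2 where d2: "d2 > 0" "\<And>k. 0 < k \<Longrightarrow> k < d2 \<Longrightarrow> \<bar>(F x - F (x - k)) / k - h x\<bar> < e"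
      proof -
        obtain d where "d > 0" "\<And>k. 0 < k \<Longrightarrow> k < d \<Longrightarrow>
            norm (integral (cbox (- x) (- x + k *\<^sub>R One)) (\<lambda>x. h (- x)) /\<^sub>R k ^ DIM(real) - h (- (- x))) < e"
          using N2(2)[OF \<open>- x \<notin> N2\<close> e] by blast
        then show ?thesis
          using that[of d] integral_unique[OF int'] by (simp add: divide_inverse mult.commute)
      qed
      show "\<exists>s>0. \<forall>k. k \<noteq> 0 \<and> norm (k - 0) < s \<longrightarrow> norm ((F (x + k) - F x) / k - h x) < e"
      proof (intro exI[of _ "min d1 d2"] conjI allI impI)
        fix k :: real assume k: "k \<noteq> 0 \<and> norm (k - 0) < min d1 d2"
        show "norm ((F (x + k) - F x) / k - h x) < e"
        proof (cases "k > 0")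
          case True
          then show ?thesis using d1(2)[of k] k by simp
        next
          case False
          then have "\<bar>(F x - F (x - (- k))) / (- k) - h x\<bar> < e" using k by (intro d2) auto
          moreover have "(F x - F (x + k)) / (- k) = (F (x + k) - F x) / k"
            by (metis minus_diff_eq minus_divide_divide)
          ultimately show ?thesis by simp
        qed
      qed (use d1 d2 in auto)
    qed
  qed
qed

text \<open>
  The image of Lebesgue measure under the inverse of \<open>F\<close> is absolutely continuous because the
  Lipschitz map \<open>F\<close> preserves null sets.
\<close>

lemma bilipschitz_density:
  fixes F :: "real \<Rightarrow> real"
  assumes lower: "\<And>s t. s \<le> t \<Longrightarrow> t - s \<le> F t - F s"
    and upper: "\<And>s t. s \<le> t \<Longrightarrow> F t - F s \<le> M * (t - s)"
  obtains h where "h \<in> borel_measurable borel" "\<And>t. h t \<ge> 0"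
    "\<And>a b. a \<le> b \<Longrightarrow> (\<integral>\<^sup>+t. ennreal (h t * indicator {a..b} t) \<partial>lborel) = ennreal (F b - F a)"
proof -
  have absF: "\<bar>s - t\<bar> \<le> \<bar>F s - F t\<bar>" "\<bar>F s - F t\<bar> \<le> M * \<bar>s - t\<bar>" for s t
    using lower[of s t] lower[of t s] upper[of s t] upper[of t s] by (auto simp: abs_if)
  have inj: "inj F" using absF(1) by (metis abs_le_zero_iff abs_zero eq_iff_diff_eq_0 injI)
  have lip: "M-lipschitz_on UNIV F"
  proof (rule lipschitz_onI)
    show "0 \<le> M" using lower[of 0 1] upper[of 0 1] by simp
  qed (use absF in \<open>auto simp: dist_real_def\<close>)
  then have cont: "continuous_on UNIV F" by (rule lipschitz_on_continuous_on)
  have surj: "\<exists>t. F t = y" for y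
  proof -
    \<comment> \<open>\<open>F\<close> grows with slope at least 1, so moving this far from 0 in
      either direction brackets \<open>y\<close>.\<close>
    define a where "a = \<bar>y\<bar> + \<bar>F 0\<bar>"
    have "a \<ge> 0" by (simp add: a_def)
    then have "F (- a) \<le> y" "y \<le> F a" "- a \<le> a"
      using lower[of 0 a] lower[of "- a" 0] abs_ge_self[of y] abs_ge_minus_self[of y]
        abs_ge_self[of "F 0"] abs_ge_minus_self[of "F 0"] unfolding a_def by linarith+
    then show ?thesis using IVT'[of F "- a" y a] continuous_on_subset[OF cont] by auto
  qed
  define G where "G = inv F"
  have FG: "F (G y) = y" and GF: "G (F t) = t" for y t
    using surj inj by (auto simp: G_def f_inv_into_f inv_f_f image_iff) (metis rangeI f_inv_into_f)
  have "1-lipschitz_on UNIV G"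
    using absF(1)[of "G _" "G _"] by (intro lipschitz_onI) (auto simp: dist_real_def FG)
  then have G: "G \<in> borel_measurable borel"
    by (intro borel_measurable_continuous_onI lipschitz_on_continuous_on)
  have vimage: "G -` A = F ` A" for A
    by (auto simp: GF image_iff) (metis FG)
  define \<mu> where "\<mu> = distr lborel borel G"
  have \<mu>: "emeasure \<mu> A = emeasure lborel (F ` A)" if "A \<in> sets borel" for A
    using that G by (simp add: \<mu>_def emeasure_distr vimage)
  have "absolutely_continuous lborel \<mu>"
    unfolding absolutely_continuous_def
  proof
    fix A :: "real set" assume A: "A \<in> null_sets lborel"
    then have "negligible A"
      by (simp add: negligible_iff_null_sets null_sets_completionI)
    then have "negligible (F ` A)"
      by (rule negligible_locally_Lipschitz_image[rotated])
        (use absF in \<open>auto intro!: exI[of _ UNIV] exI[of _ M]\<close>)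
    moreover have "F ` A \<in> sets lborel"
      using A measurable_sets_borel[OF G, of A] by (auto simp: vimage[symmetric])
    ultimately have "emeasure lborel (F ` A) = 0"
      by (simp add: negligible_iff_null_sets null_sets_def)
    then show "A \<in> null_sets \<mu>"
      using A by (auto simp: null_sets_def \<mu>) (simp add: \<mu>_def)
  qed
  then obtain f where f: "f \<in> borel_measurable lborel" "density lborel f = \<mu>"
    using sigma_finite_measure.Radon_Nikodym[OF sigma_finite_lborel, of \<mu>] by (auto simp: \<mu>_def)
  have nn: "(\<integral>\<^sup>+t. f t * indicator {a..b} t \<partial>lborel) = ennreal (F b - F a)" if "a \<le> b" for a b
  proof -
    have "F ` {a..b} = {F a..F b}"
    proof (intro equalityI subsetI)
      fix y assume "y \<in> {F a..F b}"
      then have "a \<le> G y" "G y \<le> b"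
        using lower[of "G y" a] lower[of b "G y"] by (auto simp: FG intro: leI)
      then show "y \<in> F ` {a..b}" by (metis FG atLeastAtMost_iff image_eqI)
    qed (use lower in force)
    then have "emeasure \<mu> {a..b} = ennreal (F b - F a)"
      using lower[OF that] that by (simp add: \<mu>)
    then show ?thesis
      using f(1) by (simp add: f(2)[symmetric] emeasure_density)
  qed
  show ?thesis
  proof (rule that)
    show "(\<lambda>t. enn2real (f t)) \<in> borel_measurable borel" using f(1) by simp
    show "0 \<le> enn2real (f t)" for t by simp
    fix a b :: real assume ab: "a \<le> b"
    \<comment> \<open>The density has finite integral over \<open>[a, b]\<close>, hence is finite
      almost everywhere there, and \<open>enn2real\<close> does not change its integral.\<close>
    have "AE t in lborel. f t * indicator {a..b} t \<noteq> \<infinity>"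
      using f(1) nn[OF ab] by (intro nn_integral_noteq_infinite) auto
    then have "(\<integral>\<^sup>+t. ennreal (enn2real (f t) * indicator {a..b} t) \<partial>lborel) = (\<integral>\<^sup>+t. f t * indicator {a..b} t \<partial>lborel)"
      by (intro nn_integral_cong_AE) (auto elim!: eventually_mono simp: indicator_def less_top split: if_splits)
    then show "(\<integral>\<^sup>+t. ennreal (enn2real (f t) * indicator {a..b} t) \<partial>lborel) = ennreal (F b - F a)"
      using nn[OF ab] by simp
  qed
qed

text \<open>\<open>c\<close> clamps the argument to \<open>[0, 1]\<close> and so extends
  \<open>f\<close> to the line; adding \<open>(L + 1) t\<close> forces all slopes between 1 and
  \<open>2 L + 1\<close>, where \<open>bilipschitz_density\<close> applies. The density of the sum
  minus \<open>L + 1\<close> is the derivative of \<open>f\<close>.\<close>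

lemma lipschitz_derivative_AE:
  fixes f :: "real \<Rightarrow> real"
  assumes lip: "L-lipschitz_on {0..1} f"
  obtains h where "h \<in> borel_measurable borel" "set_integrable lborel {0..1} h"
    "(LINT t:{0..1}|lborel. h t) = f 1 - f 0"
    "AE t in lborel. t \<in> {0<..<1} \<longrightarrow> (f has_real_derivative h t) (at t)"
proof -
  define c :: "real \<Rightarrow> real" where "c = (\<lambda>t. max 0 (min 1 t))"
  define F where "F = (\<lambda>t. f (c t) + (L + 1) * t)"
  have L: "L \<ge> 0" using lip by (rule lipschitz_on_nonneg)
  have g: "\<bar>f (c t) - f (c s)\<bar> \<le> L * (t - s)" if "s \<le> t" for s t
  proof -
    have "\<bar>f (c t) - f (c s)\<bar> \<le> L * \<bar>c t - c s\<bar>"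
      using lipschitz_onD[OF lip, of "c t" "c s"] by (auto simp: c_def dist_real_def)
    also have "\<dots> \<le> L * (t - s)"
      using L that by (intro mult_left_mono) (auto simp: c_def)
    finally show ?thesis .
  qed
  obtain h where h: "h \<in> borel_measurable borel" "\<And>t. h t \<ge> 0"
    "\<And>a b. a \<le> b \<Longrightarrow> (\<integral>\<^sup>+t. ennreal (h t * indicator {a..b} t) \<partial>lborel) = ennreal (F b - F a)"
  proof (rule bilipschitz_density[of F "2 * L + 1"])
    fix s t :: real assume "s \<le> t"
    from g[OF this] show "t - s \<le> F t - F s" "F t - F s \<le> (2 * L + 1) * (t - s)"
      unfolding F_def by (auto simp: abs_le_iff algebra_simps)
  qed blast
  have Fmono: "F a \<le> F b" if "a \<le> b" for a b
    using g[OF that] that unfolding F_def by (auto simp: abs_le_iff algebra_simps)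
  have hi: "((\<lambda>t. h t * indicator {a..b} t) has_integral F b - F a) UNIV" if "a \<le> b" for a b
    using h that Fmono[OF that] by (intro nn_integral_has_integral) auto
  then have "(h has_integral F b - F a) {a..b}" if "a \<le> b" for a b
  proof -
    have "(\<lambda>t. h t * indicator {a..b} t) = (\<lambda>t. if t \<in> {a..b} then h t else 0)"
      by (auto simp: indicator_def fun_eq_iff)
    then show ?thesis using hi[OF that] by (simp only: has_integral_restrict_UNIV)
  qed
  then obtain N where N: "negligible N" "\<And>x. x \<notin> N \<Longrightarrow> (F has_real_derivative h x) (at x)"
    using indefinite_integral_DERIV_AE[of h F] by blast
  show ?thesis
  proof (rule that[of "\<lambda>t. h t - (L + 1)"])
    have si: "set_integrable lborel {0..1} h"
      unfolding set_integrable_def using h(1,2) h(3)[of 0 1]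
      by (intro integrableI_nonneg) (auto simp: mult.commute)
    have c: "set_integrable lborel {0..1} (\<lambda>t::real. L + 1)"
      by (rule borel_integrable_atLeastAtMost') (rule continuous_on_const)
    show "set_integrable lborel {0..1} (\<lambda>t. h t - (L + 1))"
      by (rule set_integral_diff(1)[OF si c])
    have hF: "(LINT t:{0..1}|lborel. h t) = F 1 - F 0"
      unfolding set_lebesgue_integral_def using h Fmono[of 0 1]
      by (subst integral_eq_nn_integral) (auto simp: mult.commute)
    show "(LINT t:{0..1}|lborel. h t - (L + 1)) = f 1 - f 0"
    proof -
      have "(LINT t:{0..1::real}|lborel. L + 1) = L + 1" by (simp add: set_lebesgue_integral_def)
      then show ?thesis
        unfolding set_integral_diff(2)[OF si c] hF by (simp add: F_def c_def)
    qed
    obtain N' where N': "N' \<in> null_sets lborel" "N \<subseteq> N'"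
      using N(1) by (auto simp: negligible_iff_null_sets null_sets_completion_iff2)
    show "AE t in lborel. t \<in> {0<..<1} \<longrightarrow> (f has_real_derivative h t - (L + 1)) (at t)"
    proof (rule AE_I'[OF N'(1)], rule subsetI)
      fix t
      assume "t \<in> {t \<in> space lborel. \<not> (t \<in> {0<..<1} \<longrightarrow> (f has_real_derivative h t - (L + 1)) (at t))}"
      then have t: "t \<in> {0<..<1}" and nd: "\<not> (f has_real_derivative h t - (L + 1)) (at t)"
        by auto
      show "t \<in> N'"
      proof (rule ccontr)
        assume "t \<notin> N'"
        then have der: "((\<lambda>t. F t - (L + 1) * t) has_real_derivative h t - (L + 1)) (at t)"
          using N(2) N'(2) by (auto intro!: derivative_eq_intros)
        have ev: "\<forall>\<^sub>F s in nhds t. F s - (L + 1) * s = f s"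
          using eventually_nhds_in_open[of "{0<..<1}" t] t
          by (auto elim!: eventually_mono simp: F_def c_def)
        show False using nd DERIV_cong_ev[OF refl ev refl, THEN iffD1, OF der] by blast
      qed
    qed
  qed (use h in auto)
qed

text \<open>The velocity is tested against the direction of the displacement, scaled to norm
  \<open>1/K\<close>: the integral of \<open>u \<bullet> w\<close> is the displacement over
  \<open>K\<close>, while pointwise \<open>u \<bullet> w \<le> |w| / K \<le> c\<close>. The scalar
  result is applied to each coordinate, and the exceptional null sets are united.\<close>

lemma lipschitz_curve_length_ge:
  fixes \<zeta> :: "real \<Rightarrow> 'a::euclidean_space"
  assumes lip: "L-lipschitz_on {0..1} \<zeta>"
    and K: "K > 0" and le: "\<And>t. t \<in> {0..1} \<Longrightarrow> norm (vector_derivative \<zeta> (at t)) \<le> K * c t"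
  shows "ennreal (norm (\<zeta> 1 - \<zeta> 0) / K) \<le> (\<integral>\<^sup>+t\<in>{0..1}. ennreal (c t) \<partial>lborel)"
proof (cases "\<zeta> 1 = \<zeta> 0")
  case False
  define u where "u = (\<zeta> 1 - \<zeta> 0) /\<^sub>R (K * norm (\<zeta> 1 - \<zeta> 0))"
  have u: "norm u = 1 / K" and u': "u \<bullet> (\<zeta> 1 - \<zeta> 0) = norm (\<zeta> 1 - \<zeta> 0) / K"
    using False K by (simp_all add: u_def dot_square_norm power2_eq_square divide_simps)
  have "\<forall>b\<in>Basis. \<exists>h. h \<in> borel_measurable borel \<and> set_integrable lborel {0..1} h \<and>
    (LINT t:{0..1}|lborel. h t) = \<zeta> 1 \<bullet> b - \<zeta> 0 \<bullet> b \<and>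
    (AE t in lborel. t \<in> {0<..<1} \<longrightarrow> ((\<lambda>t. \<zeta> t \<bullet> b) has_real_derivative h t) (at t))" (is "\<forall>b\<in>_. ?H b")
  proof
    fix b :: 'a assume b: "b \<in> Basis"
    have "L-lipschitz_on {0..1} (\<lambda>t. \<zeta> t \<bullet> b)"
    proof (rule lipschitz_onI)
      fix s t :: real assume "s \<in> {0..1}" "t \<in> {0..1}"
      from lipschitz_onD[OF lip this] show "dist (\<zeta> s \<bullet> b) (\<zeta> t \<bullet> b) \<le> L * dist s t"
        using Basis_le_norm[OF b, of "\<zeta> s - \<zeta> t"] by (simp add: dist_norm inner_diff_left)
    qed (rule lipschitz_on_nonneg[OF lip])
    then show "?H b" by (rule lipschitz_derivative_AE) blast
  qed
  from bchoice[OF this] obtain h where h: "\<And>b. b \<in> Basis \<Longrightarrow> set_integrable lborel {0..1} (h b)"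
    "\<And>b. b \<in> Basis \<Longrightarrow> (LINT t:{0..1}|lborel. h b t) = \<zeta> 1 \<bullet> b - \<zeta> 0 \<bullet> b"
    "\<And>b. b \<in> Basis \<Longrightarrow> AE t in lborel. t \<in> {0<..<1} \<longrightarrow> ((\<lambda>t. \<zeta> t \<bullet> b) has_real_derivative h b t) (at t)"
    by blast
  define w where "w = (\<lambda>t. \<Sum>b\<in>Basis. h b t *\<^sub>R b)"
  have "AE t in lborel. \<forall>b\<in>Basis. t \<in> {0<..<1} \<longrightarrow> ((\<lambda>t. \<zeta> t \<bullet> b) has_real_derivative h b t) (at t)"
    using h(3) by (intro AE_finite_allI) auto
  moreover have "AE t in lborel. t \<noteq> (0::real)" "AE t in lborel. t \<noteq> (1::real)"
    by (auto intro: AE_lborel_singleton)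
  ultimately have vw: "AE t in lborel. t \<in> {0..1} \<longrightarrow> vector_derivative \<zeta> (at t) = w t"
  proof eventually_elim
    case (elim t)
    show ?case
    proof
      assume "t \<in> {0..1}"
      then have "t \<in> {0<..<1}" using elim by auto
      then have "((\<lambda>t. \<Sum>b\<in>Basis. (\<zeta> t \<bullet> b) *\<^sub>R b) has_vector_derivative w t) (at t)"
        unfolding w_def using elim(1)
        by (intro has_vector_derivative_sum)
          (auto intro!: has_vector_derivative_scaleR[THEN has_vector_derivative_eq_rhs])
      then have "(\<zeta> has_vector_derivative w t) (at t)"
        by (simp add: euclidean_representation)
      then show "vector_derivative \<zeta> (at t) = w t" by (rule vector_derivative_at)
    qed
  qed
  have uw: "u \<bullet> w t = (\<Sum>b\<in>Basis. (u \<bullet> b) * h b t)" for t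
    by (simp add: w_def inner_sum_right mult.commute)
  have i: "integrable lborel (\<lambda>t. indicator {0..1} t *\<^sub>R (u \<bullet> w t))"
    using h(1) unfolding uw set_integrable_def by (simp add: sum_distrib_left mult.left_commute)
  have "norm (\<zeta> 1 - \<zeta> 0) / K = (\<Sum>b\<in>Basis. (u \<bullet> b) * (\<zeta> 1 \<bullet> b - \<zeta> 0 \<bullet> b))"
    unfolding u'[symmetric] by (subst euclidean_inner) (simp add: inner_diff_left)
  also have "\<dots> = (\<Sum>b\<in>Basis. (u \<bullet> b) * (LINT t:{0..1}|lborel. h b t))"
    using h(2) by simp
  also have "\<dots> = (LINT t|lborel. indicator {0..1} t *\<^sub>R (u \<bullet> w t))"
    using h(1) unfolding uw set_integrable_def set_lebesgue_integral_def
    by (simp add: sum_distrib_left mult.left_commute)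
  finally have "ennreal (norm (\<zeta> 1 - \<zeta> 0) / K) = ennreal (LINT t|lborel. indicator {0..1} t *\<^sub>R (u \<bullet> w t))"
    by simp
  also have "\<dots> \<le> (\<integral>\<^sup>+t. ennreal (indicator {0..1} t *\<^sub>R (u \<bullet> w t)) \<partial>lborel)"
  proof -
    \<comment> \<open>\<open>ennreal\<close> truncates negative values to 0, so this is the integral
      of the positive part, which dominates the signed integral.\<close>
    let ?I = "\<integral>\<^sup>+t. ennreal (indicator {0..1} t *\<^sub>R (u \<bullet> w t)) \<partial>lborel"
    have le: "(LINT t|lborel. indicator {0..1} t *\<^sub>R (u \<bullet> w t)) \<le> enn2real ?I"
      using real_lebesgue_integral_def[OF i] by simp
    have fin: "?I < top"
      using i by (simp add: real_integrable_def less_top)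
    show ?thesis
      using ennreal_leI[OF le] unfolding ennreal_enn2real[OF fin] .
  qed
  also have "\<dots> \<le> (\<integral>\<^sup>+t\<in>{0..1}. ennreal (c t) \<partial>lborel)"
  proof (intro nn_integral_mono_AE)
    show "AE t in lborel. ennreal (indicator {0..1} t *\<^sub>R (u \<bullet> w t)) \<le> ennreal (c t) * indicator {0..1} t"
      using vw
    proof eventually_elim
      case (elim t)
      have "u \<bullet> w t \<le> norm (w t) / K" using norm_cauchy_schwarz[of u "w t"] u by simp
      also have "norm (w t) / K \<le> c t" if "t \<in> {0..1}"
        using that elim le[of t] K by (simp add: pos_divide_le_eq mult.commute)
      finally show ?case by (auto simp: indicator_def intro!: ennreal_leI)
    qed
  qed
  finally show ?thesis .
qed simp

text \<open>The lower bound comes from \<open>norm_le_4_berwald\<close> along every path, the upper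
  one from the straight segment, whose length integrand \<open>r / (1 - t r)^2\<close> integrates to
  \<open>r / (1 - r)\<close>. The first controls negative powers of the distance near the origin,
  the second positive powers near the boundary.\<close>

lemma finsler_dist_berwald_bounds:
  fixes x :: "real^'n"
  assumes x: "norm x < 1" "x \<noteq> 0"
  shows "norm x / 4 \<le> finsler_dist (ball 0 1) berwald 0 x"
    and "finsler_dist (ball 0 1) berwald 0 x \<le> norm x / (1 - norm x)"
proof -
  define P where "P = {\<zeta> :: real \<Rightarrow> real^'n. \<zeta> 0 = 0 \<and> \<zeta> 1 = x \<and> \<zeta> ` {0..1} \<subseteq> ball 0 1 \<and> (\<exists>L. L-lipschitz_on {0..1} \<zeta>)}"
  define len where "len = (\<lambda>\<zeta>::real \<Rightarrow> real^'n. \<integral>\<^sup>+ t\<in>{0..1}. ennreal (berwald (\<zeta> t) (vector_derivative \<zeta> (at t))) \<partial>lborel)"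
  have d: "finsler_dist (ball 0 1) berwald 0 x = enn2real (INF \<zeta>\<in>P. len \<zeta>)"
    by (simp add: finsler_dist_def P_def len_def)
  let ?r = "norm x"
  define e where "e = x /\<^sub>R ?r"
  have e: "norm e = 1" "x = ?r *\<^sub>R e" using x by (auto simp: e_def)
  have lower: "ennreal (?r / 4) \<le> len \<zeta>" if \<zeta>: "\<zeta> \<in> P" for \<zeta>
  proof -
    obtain L where lip: "L-lipschitz_on {0..1} \<zeta>" using \<zeta> unfolding P_def by blast
    have "ennreal (norm (\<zeta> 1 - \<zeta> 0) / 4) \<le> len \<zeta>"
      unfolding len_def
    proof (rule lipschitz_curve_length_ge[OF lip])
      fix t :: real assume "t \<in> {0..1}"
      then have "\<zeta> t \<in> ball 0 1" using \<zeta> unfolding P_def by blast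
      then show "norm (vector_derivative \<zeta> (at t)) \<le> 4 * berwald (\<zeta> t) (vector_derivative \<zeta> (at t))"
        by (intro norm_le_4_berwald) simp
    qed simp
    then show ?thesis using that by (simp add: P_def)
  qed
  have upper: "(INF \<zeta>\<in>P. len \<zeta>) \<le> ennreal (?r / (1 - ?r))"
  proof (rule INF_lower2[where i = "\<lambda>t. t *\<^sub>R x"])
    have "?r-lipschitz_on {0..1} (\<lambda>t. t *\<^sub>R x)"
      by (rule lipschitz_onI) (auto simp: dist_norm scaleR_diff_left[symmetric])
    moreover have "norm (t *\<^sub>R x) < 1" if "t \<in> {0..1}" for t
      using that x(1) mult_left_le_one_le[of ?r t] by auto
    ultimately show "(\<lambda>t. t *\<^sub>R x) \<in> P" by (auto simp: P_def)
    have b: "berwald (t *\<^sub>R x) x = ?r / (1 - t * ?r)\<^sup>2" if "t \<in> {0..1}" for t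
    proof -
      have tr: "0 \<le> t * ?r" "t * ?r < 1" using that x(1) mult_left_le_one_le[of ?r t] by auto
      have "berwald ((t * ?r) *\<^sub>R e) (?r *\<^sub>R e) = ?r * berwald ((t * ?r) *\<^sub>R e) e"
        using tr e(1) x by (intro berwald_scale) auto
      then show ?thesis using berwald_radial(1)[OF e(1) tr] e(2) by (metis mult.right_neutral scaleR_scaleR times_divide_eq_right)
    qed
    have vd: "vector_derivative (\<lambda>t. t *\<^sub>R x) (at t) = x" for t
      by (rule vector_derivative_at) (auto intro!: derivative_eq_intros)
    have "((\<lambda>t. 1 / (1 - t * ?r)) has_real_derivative ?r / (1 - t * ?r)\<^sup>2) (at t)" if "0 \<le> t" "t \<le> 1" for t
      using that x(1) mult_left_le_one_le[of ?r t] by (auto intro!: derivative_eq_intros simp: power2_eq_square)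
    then have FTC: "(\<integral>\<^sup>+ t. ennreal (?r / (1 - t * ?r)\<^sup>2) * indicator {0..1} t \<partial>lborel)
        = ennreal (1 / (1 - 1 * ?r) - 1 / (1 - 0 * ?r))"
      by (intro nn_integral_FTC_Icc[where F = "\<lambda>t. 1 / (1 - t * ?r)"])
        (auto simp: has_real_derivative_iff_has_vector_derivative intro: has_vector_derivative_at_within)
    have "len (\<lambda>t. t *\<^sub>R x) = (\<integral>\<^sup>+ t. ennreal (?r / (1 - t * ?r)\<^sup>2) * indicator {0..1} t \<partial>lborel)"
      unfolding len_def vd by (intro nn_integral_cong) (auto simp: b indicator_def)
    also have "\<dots> = ennreal (1 / (1 - 1 * ?r) - 1 / (1 - 0 * ?r))"
      by (rule FTC)
    also have "1 / (1 - 1 * ?r) - 1 / (1 - 0 * ?r) = ?r / (1 - ?r)"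
      using x(1) by (simp add: field_simps)
    finally show "len (\<lambda>t. t *\<^sub>R x) \<le> ennreal (?r / (1 - ?r))" by simp
  qed
  have low: "ennreal (?r / 4) \<le> (INF \<zeta>\<in>P. len \<zeta>)"
    by (rule INF_greatest) (rule lower)
  \<comment> \<open>Finiteness matters because \<open>enn2real\<close> would turn an infinite
    infimum into 0.\<close>
  have fin: "(INF \<zeta>\<in>P. len \<zeta>) < top" using upper by (simp add: le_less_trans)
  show "?r / 4 \<le> finsler_dist (ball 0 1) berwald 0 x"
    unfolding d using enn2real_mono[OF low fin] by simp
  show "finsler_dist (ball 0 1) berwald 0 x \<le> ?r / (1 - ?r)"
    unfolding d using enn2real_mono[OF upper] x(1) by simp
qed

section \<open>Radial cutoff functions and their energy\<close>

lemma Cinf_on_imp_borel: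
  fixes f :: "'a::euclidean_space \<Rightarrow> 'b::euclidean_space"
  shows "Cinf_on UNIV f \<Longrightarrow> f \<in> borel_measurable borel"
  by (intro borel_measurable_continuous_onI Cinf_on_continuous_on)

abbreviation supp :: "('a::topological_space \<Rightarrow> real) \<Rightarrow> 'a set" where
  "supp f \<equiv> closure {x. f x \<noteq> 0}"

section \<open>Test functions and integration by parts\<close>

lemma test_funD:
  assumes "test_fun S f"
  shows test_fun_Cinf: "Cinf_on UNIV f"
    and test_fun_eq_0: "x \<notin> supp f \<Longrightarrow> f x = 0"
    and test_fun_has_derivative: "(f has_derivative frechet_derivative f (at x)) (at x)"
    and test_fun_derivative_eq_0: "x \<notin> supp f \<Longrightarrow> frechet_derivative f (at x) = (\<lambda>_. 0)"
proof -
  show C: "Cinf_on UNIV f" using assms by (simp add: test_fun_def)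
  show z: "x \<notin> supp f \<Longrightarrow> f x = 0" for x
    using closure_subset[of "{x. f x \<noteq> 0}"] by auto
  show "(f has_derivative frechet_derivative f (at x)) (at x)"
    using Cinf_on_differentiable[OF C] frechet_derivative_works by blast
  assume x: "x \<notin> supp f"
  have "((\<lambda>_. 0) has_derivative (\<lambda>_. 0)) (at x)" by simp
  then have "(f has_derivative (\<lambda>_. 0)) (at x)"
    by (rule has_derivative_transform_within_open[where s = "- supp f"])
      (use x in \<open>auto intro: z\<close>)
  then show "frechet_derivative f (at x) = (\<lambda>_. 0)"
    using frechet_derivative_at by metis
qed

lemma test_fun_times:
  assumes "test_fun S f" "Cinf_on UNIV g"
  shows "test_fun S (\<lambda>x. f x * g x)"
proof -
  have "closure {x. f x * g x \<noteq> 0} \<subseteq> supp f"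
    by (rule closure_mono) auto
  moreover have "Cinf_on UNIV (\<lambda>x. f x * g x)"
    using assms unfolding test_fun_def Cinf_on_def by (simp add: Ck_on_mult)
  ultimately show ?thesis
    using assms(1) unfolding test_fun_def compact_eq_bounded_closed
    by (meson bounded_subset closed_closure order_trans)
qed

lemma integrable_compact_support:
  fixes f :: "'a::euclidean_space \<Rightarrow> real"
  assumes "continuous_on UNIV f" "compact K" "\<And>x. x \<notin> K \<Longrightarrow> f x = 0"
  shows "integrable lborel f"
proof -
  have "integrable lborel (\<lambda>x. indicator K x *\<^sub>R f x)"
    by (rule borel_integrable_compact[OF assms(2) continuous_on_subset[OF assms(1)]]) simp
  also have "(\<lambda>x. indicator K x *\<^sub>R f x) = f"
    using assms(3) by (auto simp: indicator_def fun_eq_iff)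
  finally show ?thesis .
qed

lemma compact_support_test_fun: "test_fun S f \<Longrightarrow> compact (supp f)"
  by (simp add: test_fun_def)

lemma integrable_test_fun: "test_fun S f \<Longrightarrow> integrable lborel f"
  by (rule integrable_compact_support[OF Cinf_on_continuous_on[OF test_fun_Cinf] compact_support_test_fun test_fun_eq_0])

text \<open>Translation invariance of Lebesgue measure makes every difference quotient integrate to
  0, and dominated convergence passes this to the derivative.\<close>

lemma integral_test_fun_derivative:
  fixes f :: "'a::euclidean_space \<Rightarrow> real"
  assumes "test_fun S f" shows "(LINT x|lborel. frechet_derivative f (at x) v) = 0"
proof -
  let ?f' = "\<lambda>x. frechet_derivative f (at x) v"
  define g where "g = (\<lambda>n x. real (Suc n) * (f (x + (1 / real (Suc n)) *\<^sub>R v) - f x))"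
  have cont: "continuous_on UNIV ?f'"
    by (rule Cinf_on_continuous_on[OF Cinf_on_frechet_derivative[OF test_fun_Cinf[OF assms]]])
  have K: "compact (supp f)" by (rule compact_support_test_fun[OF assms])
  then obtain R where R: "\<And>x. x \<in> supp f \<Longrightarrow> norm x \<le> R"
    using compact_imp_bounded bounded_iff by metis
  have "bounded (?f' ` supp f)"
    by (intro compact_imp_bounded compact_continuous_image continuous_on_subset[OF cont] K) simp
  then obtain M where "\<And>x. x \<in> supp f \<Longrightarrow> \<bar>?f' x\<bar> \<le> M"
    by (auto simp: bounded_iff)
  then have M: "\<bar>?f' x\<bar> \<le> max M 0" for x
    using test_fun_derivative_eq_0[OF assms, of x] by (cases "x \<in> supp f") (simp_all add: max.coboundedI1 fun_cong[OF test_fun_derivative_eq_0[OF assms]])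
  have der: "((\<lambda>t. f (x + t *\<^sub>R v)) has_real_derivative frechet_derivative f (at (x + t *\<^sub>R v)) v) (at t)" for x t
  proof -
    have "((\<lambda>s. f (x + t *\<^sub>R v + s *\<^sub>R v)) has_real_derivative frechet_derivative f (at (x + t *\<^sub>R v)) v) (at 0)"
      by (rule has_derivative_along[OF test_fun_has_derivative[OF assms]])
    then have "((\<lambda>s. f (x + (s + t) *\<^sub>R v)) has_real_derivative frechet_derivative f (at (x + t *\<^sub>R v)) v) (at 0)"
      by (simp add: algebra_simps)
    then have "((\<lambda>s. f (x + s *\<^sub>R v)) has_real_derivative frechet_derivative f (at (x + t *\<^sub>R v)) v) (at (0 + t))"
      by (subst DERIV_shift)
    then show ?thesis by simp
  qed
  have int0: "(LINT x|lborel. g n x) = 0" for n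
  proof -
    let ?c = "(1 / real (Suc n)) *\<^sub>R v"
    have m: "f \<in> borel_measurable borel" by (rule Cinf_on_imp_borel[OF test_fun_Cinf[OF assms]])
    have i: "integrable lborel f" by (rule integrable_test_fun[OF assms])
    have "integrable (distr lborel borel ((+) ?c)) f" unfolding lborel_distr_plus by (rule i)
    then have i': "integrable lborel (\<lambda>x. f (?c + x))"
      by (subst (asm) integrable_distr_eq) (use m in auto)
    have "(LINT x|lborel. f (?c + x)) = (LINT x|distr lborel borel ((+) ?c). f x)"
      by (rule integral_distr[symmetric]) (use m in auto)
    then have "(LINT x|lborel. f (?c + x)) = (LINT x|lborel. f x)"
      unfolding lborel_distr_plus .
    then show ?thesis
      unfolding g_def using i i' by (simp add: add.commute)
  qed
  have "(\<lambda>n. LINT x|lborel. g n x) \<longlonglongrightarrow> (LINT x|lborel. ?f' x)"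
  \<comment> \<open>The mean value theorem bounds each quotient by the supremum of the derivative; a
    shift by at most \<open>|v|\<close> enlarges the support radius \<open>R\<close> by at most
    \<open>|v|\<close>.\<close>
  proof (rule integral_dominated_convergence[where w = "\<lambda>x. max M 0 * indicator (cball 0 (R + norm v)) x"])
    show "?f' \<in> borel_measurable lborel"
      using borel_measurable_continuous_onI[OF cont] by simp
    show "g n \<in> borel_measurable lborel" for n
    proof -
      have [measurable]: "f \<in> borel_measurable borel" by (rule Cinf_on_imp_borel[OF test_fun_Cinf[OF assms]])
      show ?thesis unfolding g_def by measurable
    qed
    show "integrable lborel (\<lambda>x::'a. max M 0 * indicator (cball 0 (R + norm v)) x)"
      by (intro integrable_mult_right integrable_real_indicator) (use emeasure_lborel_cball_finite[of "0 :: 'a" "R + norm v"] in auto)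
    show "AE x in lborel. (\<lambda>n. g n x) \<longlonglongrightarrow> ?f' x"
    proof (rule AE_I2)
      fix x :: 'a
      have "((\<lambda>t. (f (x + t *\<^sub>R v) - f x) / t) \<longlongrightarrow> ?f' x) (at 0)"
        using der[of x 0] by (simp add: DERIV_def)
      moreover have "filterlim (\<lambda>n. 1 / real (Suc n)) (at 0) sequentially"
        unfolding filterlim_at using LIMSEQ_inverse_real_of_nat by (auto simp: inverse_eq_divide)
      ultimately have "((\<lambda>n. (f (x + (1 / real (Suc n)) *\<^sub>R v) - f x) / (1 / real (Suc n))) \<longlongrightarrow> ?f' x) sequentially"
        by (rule filterlim_compose)
      then show "(\<lambda>n. g n x) \<longlonglongrightarrow> ?f' x" by (simp add: g_def mult.commute)
    qed
    fix n
    show "AE x in lborel. norm (g n x) \<le> max M 0 * indicator (cball 0 (R + norm v)) x"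
    proof (rule AE_I2)
      fix x :: 'a
      let ?t = "1 / real (Suc n)"
      have "\<exists>s>0. s < ?t \<and> f (x + ?t *\<^sub>R v) - f (x + 0 *\<^sub>R v)
          = (?t - 0) * frechet_derivative f (at (x + s *\<^sub>R v)) v"
        by (rule MVT2) (use der in auto)
      then obtain s where "f (x + ?t *\<^sub>R v) - f (x + 0 *\<^sub>R v)
          = (?t - 0) * frechet_derivative f (at (x + s *\<^sub>R v)) v" by blast
      then have g: "g n x = frechet_derivative f (at (x + s *\<^sub>R v)) v"
        by (simp add: g_def)
      show "norm (g n x) \<le> max M 0 * indicator (cball 0 (R + norm v)) x"
      proof (cases "x \<in> cball 0 (R + norm v)")
        case False
        then have x: "norm x > R + norm v" by simp
        have "norm x \<le> norm (x + ?t *\<^sub>R v) + norm (?t *\<^sub>R v)"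
          by (metis add_diff_cancel_right' norm_triangle_ineq4)
        moreover have "norm (?t *\<^sub>R v) \<le> norm v" by (simp add: divide_le_eq mult_le_cancel_left1)
        ultimately have "norm (x + ?t *\<^sub>R v) > R" "norm x > R" using x norm_ge_zero[of v] by linarith+
        then have "f (x + ?t *\<^sub>R v) = 0" "f x = 0" using R test_fun_eq_0[OF assms] by (meson not_le)+
        then show ?thesis using False by (simp add: g_def)
      qed (simp add: g M)
    qed
  qed
  then show ?thesis using int0 LIMSEQ_unique[OF tendsto_const] by fastforce
qed

text \<open>Falls from 1 at \<open>|x|^2 = 1 - 2 \<epsilon>\<close> to 0 at
  \<open>|x|^2 = 1 - \<epsilon>\<close>. Using \<open>|x|^2\<close> keeps it smooth at the origin
  and makes its differential a multiple of \<open>x \<bullet> v\<close>.\<close>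

definition cutoff :: "real \<Rightarrow> real^'n \<Rightarrow> real" where
  "cutoff \<epsilon> x = step ((1 - \<epsilon> - x \<bullet> x) / \<epsilon>)"

lemma Cinf_on_cutoff: "Cinf_on UNIV (cutoff \<epsilon>)"
  unfolding Cinf_on_def cutoff_def[abs_def] divide_inverse
  by (intro allI Ck_on_compose_real[OF Ck_on_step] Ck_on_mult Ck_on_diff Ck_on_const Ck_on_inner bounded_linear_ident)

lemma cutoff_bounds: "0 \<le> cutoff \<epsilon> x" "cutoff \<epsilon> x \<le> 1"
  by (simp_all add: cutoff_def step_bounds)

lemma cutoff_eq_1: "\<epsilon> > 0 \<Longrightarrow> x \<bullet> x \<le> 1 - 2 * \<epsilon> \<Longrightarrow> cutoff \<epsilon> x = 1"
  by (simp add: cutoff_def step_eq_1 field_simps)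

lemma cutoff_eq_0: "\<epsilon> > 0 \<Longrightarrow> x \<bullet> x \<ge> 1 - \<epsilon> \<Longrightarrow> cutoff \<epsilon> x = 0"
  by (simp add: cutoff_def step_eq_0 divide_nonpos_pos)

lemma test_fun_cutoff:
  assumes "\<epsilon> > 0" shows "test_fun (ball 0 1) (cutoff \<epsilon> :: real^'n \<Rightarrow> real)"
proof -
  let ?K = "{x :: real^'n. x \<bullet> x \<le> 1 - \<epsilon>}"
  have K: "closed ?K" by (intro closed_Collect_le continuous_intros)
  have sub: "?K \<subseteq> ball 0 1"
    using assms by (auto simp: norm_less_1_iff_conf conf_def)
  have "supp (cutoff \<epsilon>) \<subseteq> ?K"
    by (rule closure_minimal[OF _ K]) (use cutoff_eq_0[OF assms] linear in blast)
  with sub have "supp (cutoff \<epsilon>) \<subseteq> ball (0 :: real^'n) 1" by (rule order_trans[rotated])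
  then show ?thesis
    unfolding test_fun_def compact_eq_bounded_closed
    using Cinf_on_cutoff bounded_subset[OF bounded_ball] by blast
qed

lemma frechet_derivative_cutoff:
  "frechet_derivative (cutoff \<epsilon>) (at x) = (\<lambda>v. - (2 * deriv step ((1 - \<epsilon> - x \<bullet> x) / \<epsilon>) / \<epsilon>) * (x \<bullet> v))"
proof -
  have "((\<lambda>x::real^'n. (1 - \<epsilon> - x \<bullet> x) / \<epsilon>) has_derivative (\<lambda>v. - (2 * (x \<bullet> v)) / \<epsilon>)) (at x)" for x
    unfolding divide_inverse by (auto intro!: derivative_eq_intros simp: inner_commute algebra_simps)
  from diff_chain_at[OF this step_deriv[unfolded has_field_derivative_def]]
  have "(cutoff \<epsilon> has_derivative (\<lambda>v. - (2 * deriv step ((1 - \<epsilon> - x \<bullet> x) / \<epsilon>) / \<epsilon>) * (x \<bullet> v))) (at x)"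
    by (simp add: o_def cutoff_def[abs_def] mult_ac)
  then show ?thesis by (rule frechet_derivative_at[symmetric])
qed

text \<open>A real supremum dominates its members only if the set is bounded above; linearity of
  \<eta> together with \<open>norm_le_4_berwald\<close> provides the bound.\<close>

lemma cometric_upper:
  fixes \<eta> :: "real^'n \<Rightarrow> real"
  assumes x: "norm x < 1" and \<eta>: "linear \<eta>" and y: "y \<noteq> 0"
  shows "\<eta> y / berwald x y \<le> cometric berwald x \<eta>"
proof -
  obtain C where C: "\<And>z. \<bar>\<eta> z\<bar> \<le> C * norm z" "C > 0"
    using linear_bounded_pos[OF \<eta>] by auto
  have "\<eta> z / berwald x z \<le> C * 4" if "z \<noteq> 0" for z
  proof -
    have "\<eta> z \<le> C * norm z" using C(1)[of z] by simp
    also have "\<dots> \<le> C * (4 * berwald x z)"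
      using norm_le_4_berwald[OF x, of z] C(2) by (intro mult_left_mono) auto
    finally show ?thesis using berwald_pos[OF x that] by (simp add: pos_divide_le_eq mult_ac)
  qed
  then have "bdd_above ((\<lambda>y. \<eta> y / berwald x y) ` (UNIV - {0}))"
    by (intro bdd_aboveI2) auto
  then show ?thesis unfolding cometric_def using y by (intro cSUP_upper) auto
qed

lemma cometric_nonneg:
  fixes \<eta> :: "real^'n \<Rightarrow> real"
  assumes x: "norm x < 1" and \<eta>: "linear \<eta>"
  shows "cometric berwald x \<eta> \<ge> 0"
proof -
  obtain y :: "real^'n" where y: "y \<noteq> 0" using vector_choose_size[of 1] by fastforce
  have "\<eta> y / berwald x y \<le> cometric berwald x \<eta>" "\<eta> (- y) / berwald x (- y) \<le> cometric berwald x \<eta>"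
    using cometric_upper[OF x \<eta>] y by auto
  moreover have "\<eta> y / berwald x y \<ge> 0 \<or> \<eta> (- y) / berwald x (- y) \<ge> 0"
    using berwald_pos[OF x, of y] berwald_pos[OF x, of "- y"] y linear_neg[OF \<eta>, of y]
    by (cases "\<eta> y \<ge> 0") (auto intro: divide_nonneg_pos divide_nonpos_pos)
  ultimately show ?thesis by linarith
qed

text \<open>Dividing \<open>a\<close> by \<open>funk^2 / disc\<close> gives
  \<open>a D / (D + a)^2\<close> times \<open>conf^2\<close>, and the fraction is at most
  \<open>1/4\<close> because \<open>(D - a)^2 \<ge> 0\<close>. The sign \<open>c \<ge> 0\<close>
  selects the outward direction, where the bound decays quadratically at the boundary.\<close>

lemma cometric_radial_le:
  fixes x :: "real^'n"
  assumes x: "norm x < 1" and c: "c \<ge> 0"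
  shows "cometric berwald x (\<lambda>v. c * (x \<bullet> v)) \<le> c * (conf x)\<^sup>2 / 4"
  unfolding cometric_def
proof (rule cSUP_least)
  show "UNIV - {0 :: real^'n} \<noteq> {}" using vector_choose_size[of 1, where 'a = "real^'n"] by fastforce
  fix y :: "real^'n" assume "y \<in> UNIV - {0}"
  then have y: "y \<noteq> 0" by simp
  define a D where "a = x \<bullet> y" and "D = disc x y"
  have D: "D > 0" "D + a > 0" and m: "conf x > 0"
    using disc_pos[OF x y] abs_inner_less_disc[OF x y] conf_pos[OF x] by (auto simp: D_def a_def)
  have "0 \<le> (D - a)\<^sup>2" by simp
  then have "a * D * 4 \<le> (D + a)\<^sup>2" by (simp add: power2_eq_square algebra_simps)
  then have "a * D / (D + a)\<^sup>2 \<le> 1 / 4" using D by (simp add: divide_le_eq)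
  then have "c * (a * D / (D + a)\<^sup>2 * (conf x)\<^sup>2) \<le> c * (1 / 4 * (conf x)\<^sup>2)"
    by (intro mult_left_mono mult_right_mono c) auto
  moreover have "c * (x \<bullet> y) / berwald x y = c * (a * D / (D + a)\<^sup>2 * (conf x)\<^sup>2)"
    by (simp add: berwald_eq[OF x] funk_def a_def D_def power_divide)
  ultimately show "c * (x \<bullet> y) / berwald x y \<le> c * (conf x)\<^sup>2 / 4" by simp
qed

text \<open>Bounded by radii, so its volume is explicit. It still contains the layer
  \<open>|x|^2 > 1 - 2 \<epsilon>\<close> of the ball, since \<open>|x|^2 \<le> |x|\<close>
  there.\<close>

definition shell :: "real \<Rightarrow> (real^'n) set" where
  "shell \<epsilon> = ball 0 1 - ball 0 (1 - 2 * \<epsilon>)"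

definition shell_vol :: "nat \<Rightarrow> real \<Rightarrow> real" where
  "shell_vol N \<epsilon> = unit_ball_vol (real N) * (1 - (1 - 2 * \<epsilon>) ^ N)"

lemma in_shell:
  fixes x :: "real^'n"
  assumes "0 < \<epsilon>" "\<epsilon> \<le> 1/2" "norm x < 1" "x \<bullet> x > 1 - 2 * \<epsilon>" shows "x \<in> shell \<epsilon>"
proof -
  have "norm x * norm x \<le> norm x" using assms(3) by (simp add: mult_left_le)
  then show ?thesis using assms by (simp add: shell_def dot_square_norm power2_eq_square)
qed

lemma emeasure_shell:
  assumes "0 < \<epsilon>" "\<epsilon> \<le> 1/2"
  shows "emeasure lborel (shell \<epsilon> :: (real^'n) set)
     = ennreal (shell_vol CARD('n) \<epsilon>)"
proof -
  have "emeasure lborel (shell \<epsilon> :: (real^'n) set)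
      = emeasure lborel (ball (0 :: real^'n) 1) - emeasure lborel (ball (0 :: real^'n) (1 - 2 * \<epsilon>))"
    unfolding shell_def using assms
    by (intro emeasure_Diff) (auto simp: emeasure_ball)
  also have "\<dots> = ennreal (shell_vol CARD('n) \<epsilon>)"
    using assms by (simp add: emeasure_ball ennreal_minus right_diff_distrib shell_vol_def)
  finally show ?thesis .
qed

text \<open>The slope is of order \<open>1/\<epsilon>\<close> and is nonzero only where
  \<open>conf x \<le> 2 \<epsilon>\<close>, so the quadratic decay leaves one factor \<epsilon>. The
  minus sign turns the differential outward.\<close>

lemma cometric_cutoff:
  obtains M where "M > 0" "\<And>\<epsilon> x. 0 < \<epsilon> \<Longrightarrow> \<epsilon> \<le> 1/2 \<Longrightarrow> norm (x :: real^'n) < 1 \<Longrightarrow>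
    cometric berwald x (\<lambda>v. - frechet_derivative (cutoff \<epsilon>) (at x) v) \<le> M * \<epsilon> * indicator (shell \<epsilon>) x"
proof -
  obtain M where M: "M > 0" "\<And>t. \<bar>deriv step t\<bar> \<le> M" using deriv_step_bounded by blast
  have "cometric berwald x (\<lambda>v. - frechet_derivative (cutoff \<epsilon>) (at x) v) \<le> 2 * M * \<epsilon> * indicator (shell \<epsilon>) x"
    if \<epsilon>: "0 < \<epsilon>" "\<epsilon> \<le> 1/2" and x: "norm x < 1" for \<epsilon> and x :: "real^'n"
  proof -
    let ?\<eta> = "\<lambda>v. - frechet_derivative (cutoff \<epsilon>) (at x) v"
    let ?t = "(1 - \<epsilon> - x \<bullet> x) / \<epsilon>"
    have c: "2 * deriv step ?t / \<epsilon> \<ge> 0" using deriv_step_nonneg \<epsilon> by simp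
    have "?\<eta> = (\<lambda>v. 2 * deriv step ?t / \<epsilon> * (x \<bullet> v))"
      by (simp add: frechet_derivative_cutoff)
    then have le: "cometric berwald x ?\<eta> \<le> 2 * deriv step ?t / \<epsilon> * (conf x)\<^sup>2 / 4"
      using cometric_radial_le[OF x c] by simp
    show ?thesis
    proof (cases "x \<bullet> x > 1 - 2 * \<epsilon>")
      case True
      then have "conf x \<le> 2 * \<epsilon>" by (simp add: conf_def)
      then have "(conf x)\<^sup>2 \<le> (2 * \<epsilon>)\<^sup>2" using conf_pos[OF x] by (intro power_mono) auto
      then have "2 * deriv step ?t / \<epsilon> * (conf x)\<^sup>2 / 4 \<le> 2 * M / \<epsilon> * (2 * \<epsilon>)\<^sup>2 / 4"
        using M(2)[of ?t] deriv_step_nonneg[of ?t] M(1) \<epsilon>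
        by (intro divide_right_mono mult_mono) auto
      also have "\<dots> = 2 * M * \<epsilon>" using \<epsilon> by (simp add: power2_eq_square)
      finally show ?thesis using le in_shell[OF \<epsilon> x True] by simp
    next
      case False
      then have "deriv step ?t = 0" using \<epsilon> by (intro deriv_step_eq_0) (auto simp: field_simps)
      moreover have "0 \<le> 2 * M * \<epsilon> * indicator (shell \<epsilon>) x" using M(1) \<epsilon> by simp
      ultimately show ?thesis using le by simp
    qed
  qed
  then show ?thesis using that[of "2 * M"] M(1) by auto
qed

lemma linear_frechet_cutoff: "linear (\<lambda>v. - frechet_derivative (cutoff \<epsilon>) (at x) v)"
  unfolding frechet_derivative_cutoff by (rule linearI) (auto simp: inner_add_right algebra_simps add_divide_distrib)

lemma frechet_derivative_minus_cutoff:
  "frechet_derivative (\<lambda>x. - cutoff \<epsilon> x) (at x) = (\<lambda>v. - frechet_derivative (cutoff \<epsilon>) (at x) v)"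
proof -
  have "cutoff \<epsilon> differentiable (at x)"
    by (rule Cinf_on_differentiable[OF Cinf_on_cutoff]) simp
  then have "((\<lambda>x. - cutoff \<epsilon> x) has_derivative (\<lambda>v. - frechet_derivative (cutoff \<epsilon>) (at x) v)) (at x)"
    by (intro has_derivative_minus) (simp add: frechet_derivative_works)
  from frechet_derivative_at[OF this] show ?thesis by simp
qed

definition energy :: "real \<Rightarrow> (real^'n \<Rightarrow> real) \<Rightarrow> ennreal" where
  "energy p f = (\<integral>\<^sup>+ x\<in>ball 0 1. ennreal (cometric berwald x (frechet_derivative f (at x)) powr p) \<partial>lborel)"

definition mass :: "real \<Rightarrow> real \<Rightarrow> (real^'n \<Rightarrow> real) \<Rightarrow> ennreal" where
  "mass p q f = (\<integral>\<^sup>+ x\<in>ball 0 1. ennreal (\<bar>f x\<bar> powr p * finsler_dist (ball 0 1) berwald 0 x powr q) \<partial>lborel)"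

lemma energy_cutoff:
  obtains M where "M > 0" "\<And>\<epsilon> p. 0 < \<epsilon> \<Longrightarrow> \<epsilon> \<le> 1/2 \<Longrightarrow> p > 1 \<Longrightarrow>
    energy p (\<lambda>x :: real^'n. - cutoff \<epsilon> x)
      \<le> ennreal ((M * \<epsilon>) powr p * shell_vol CARD('n) \<epsilon>)"
proof -
  obtain M where M: "M > 0" "\<And>\<epsilon> x. 0 < \<epsilon> \<Longrightarrow> \<epsilon> \<le> 1/2 \<Longrightarrow> norm (x :: real^'n) < 1 \<Longrightarrow>
    cometric berwald x (\<lambda>v. - frechet_derivative (cutoff \<epsilon>) (at x) v) \<le> M * \<epsilon> * indicator (shell \<epsilon>) x"
    using cometric_cutoff by blast
  show ?thesis
  proof (rule that[OF M(1)])
    fix \<epsilon> p :: real assume \<epsilon>: "0 < \<epsilon>" "\<epsilon> \<le> 1/2" and p: "p > 1"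
    have "energy p (\<lambda>x :: real^'n. - cutoff \<epsilon> x)
      \<le> (\<integral>\<^sup>+ x. ennreal ((M * \<epsilon>) powr p) * indicator (shell \<epsilon> :: (real^'n) set) x \<partial>lborel)"
      unfolding energy_def frechet_derivative_minus_cutoff
    proof (rule nn_integral_mono)
      fix x :: "real^'n"
      have "cometric berwald x (\<lambda>v. - frechet_derivative (cutoff \<epsilon>) (at x) v) powr p
          \<le> (M * \<epsilon>) powr p * indicator (shell \<epsilon>) x" if x: "norm x < 1"
      proof -
        have "cometric berwald x (\<lambda>v. - frechet_derivative (cutoff \<epsilon>) (at x) v) powr p
            \<le> (M * \<epsilon> * indicator (shell \<epsilon>) x) powr p"
          using M(2)[OF \<epsilon> x] cometric_nonneg[OF x linear_frechet_cutoff] p by (intro powr_mono2) auto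
        also have "\<dots> = (M * \<epsilon>) powr p * indicator (shell \<epsilon>) x" using p by (simp add: indicator_def)
        finally show ?thesis .
      qed
      then show "ennreal (cometric berwald x (\<lambda>v. - frechet_derivative (cutoff \<epsilon>) (at x) v) powr p) * indicator (ball 0 1) x
          \<le> ennreal ((M * \<epsilon>) powr p) * indicator (shell \<epsilon>) x"
        by (auto simp: indicator_def shell_def intro!: ennreal_leI split: if_splits)
    qed
    also have "\<dots> = ennreal ((M * \<epsilon>) powr p) * emeasure lborel (shell \<epsilon> :: (real^'n) set)"
      by (rule nn_integral_cmult_indicator) (simp add: shell_def)
    also have "\<dots> = ennreal ((M * \<epsilon>) powr p * shell_vol CARD('n) \<epsilon>)"
      unfolding emeasure_shell[OF \<epsilon>] by (rule ennreal_mult'[symmetric]) simp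
    finally show "energy p (\<lambda>x :: real^'n. - cutoff \<epsilon> x)
      \<le> ennreal ((M * \<epsilon>) powr p * shell_vol CARD('n) \<epsilon>)" .
  qed
qed

section \<open>The Sobolev space\<close>

lemma enn_powr_le:
  assumes "a \<le> ennreal b" "b \<ge> 0" "r \<ge> 0"
  shows "enn_powr a r \<le> ennreal (b powr r)"
proof -
  have "a \<noteq> \<infinity>" using assms(1) by (auto simp: top_unique)
  moreover have "enn2real a \<le> b" using assms(1,2) by (simp add: enn2real_leI)
  ultimately show ?thesis
    using assms(3) by (auto simp: enn_powr_def intro!: ennreal_leI powr_mono2)
qed

lemma enn_powr_leD:
  assumes "enn_powr a r \<le> ennreal (b powr r)" "b \<ge> 0" "r > 0"
  shows "a \<le> ennreal b"
proof -
  have a: "a \<noteq> \<infinity>" using assms(1) by (auto simp: enn_powr_def top_unique)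
  then have "enn2real a powr r \<le> b powr r"
    using assms(1) by (simp add: enn_powr_def)
  then have "enn2real a \<le> b"
    using assms(2,3) by (meson enn2real_nonneg not_le powr_less_mono2)
  then show ?thesis
    using a assms(2) by (metis ennreal_enn2real ennreal_leI infinity_ennreal_def less_top)
qed

lemma tendsto_inverse_shift: "(\<lambda>k. 1 / real (k + 4)) \<longlonglongrightarrow> 0"
  using LIMSEQ_ignore_initial_segment[OF lim_1_over_n, of 4] by simp

lemma shell_vol_tendsto: "(\<lambda>k. shell_vol N (1 / real (k + 4))) \<longlonglongrightarrow> 0"
proof -
  have "(\<lambda>k. shell_vol N (1 / real (k + 4))) \<longlonglongrightarrow> unit_ball_vol (real N) * (1 - (1 - 2 * 0) ^ N)"
    unfolding shell_vol_def by (intro tendsto_intros tendsto_inverse_shift)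
  then show ?thesis by simp
qed

lemma shell_vol_nonneg: "0 \<le> \<epsilon> \<Longrightarrow> \<epsilon> \<le> 1/2 \<Longrightarrow> 0 \<le> shell_vol N \<epsilon>"
  unfolding shell_vol_def by (intro mult_nonneg_nonneg) (auto intro: power_le_one)

lemma powr_p_powr_inverse: "a \<ge> 0 \<Longrightarrow> b \<ge> 0 \<Longrightarrow> p > 1 \<Longrightarrow> (a powr p * b) powr (1 / p) = a * b powr (1 / (p::real))"
  by (simp add: powr_mult powr_powr)

lemma set_integral_test_fun_derivative:
  assumes "test_fun S f"
  shows "(LINT x:S|lborel. frechet_derivative f (at x) v) = 0"
proof -
  have "indicator S x *\<^sub>R frechet_derivative f (at x) v = frechet_derivative f (at x) v" for x
    using assms fun_cong[OF test_fun_derivative_eq_0[OF assms], of x v]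
    by (cases "x \<in> S") (auto simp: test_fun_def)
  then show ?thesis
    using integral_test_fun_derivative[OF assms] by (simp only: set_lebesgue_integral_def)
qed

lemma weak_gradient_const: "weak_gradient S (\<lambda>_. c) (\<lambda>_. 0)"
proof -
  have "set_integrable lborel K (\<lambda>_. c)" if "compact K" for K :: "(real^'n) set"
    unfolding set_integrable_def using borel_integrable_compact[OF that continuous_on_const] .
  moreover have "set_integrable lborel K (\<lambda>_. 0 :: real^'n)" for K :: "(real^'n) set"
    by (simp add: set_integrable_def)
  ultimately show ?thesis
    unfolding weak_gradient_def
    using set_integral_test_fun_derivative[where 'a = "real^'n"]
    by (auto simp: set_lebesgue_integral_def mult.left_commute)
qed

lemma energy_cutoff_sequence:
  obtains M :: real and \<epsilon> V :: "nat \<Rightarrow> real"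
  where "M > 0" "\<And>k. 0 < \<epsilon> k" "\<And>k. \<epsilon> k \<le> 1/4" "\<epsilon> \<longlonglongrightarrow> 0" "\<And>k. V k \<ge> 0" "V \<longlonglongrightarrow> 0"
    "\<And>k. emeasure lborel (shell (\<epsilon> k) :: (real^'n) set) = ennreal (V k)"
    "\<And>k p. p > 1 \<Longrightarrow> energy p (\<lambda>x :: real^'n. - cutoff (\<epsilon> k) x) \<le> ennreal ((M * \<epsilon> k) powr p * V k)"
proof -
  \<comment> \<open>The shift by 4 gives \<epsilon> at most \<open>1/4\<close> from the start, so
    that all cutoffs equal 1 on the ball of radius \<open>1/2\<close>.\<close>
  define \<epsilon> where "\<epsilon> = (\<lambda>k::nat. 1 / real (k + 4))"
  have \<epsilon>: "0 < \<epsilon> k" "\<epsilon> k \<le> 1/4" "\<epsilon> k \<le> 1/2" for k by (auto simp: \<epsilon>_def field_simps)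
  obtain M where M: "M > 0" "\<And>\<epsilon> p. 0 < \<epsilon> \<Longrightarrow> \<epsilon> \<le> 1/2 \<Longrightarrow> p > 1 \<Longrightarrow>
    energy p (\<lambda>x :: real^'n. - cutoff \<epsilon> x) \<le> ennreal ((M * \<epsilon>) powr p * shell_vol CARD('n) \<epsilon>)"
    using energy_cutoff[where 'n = 'n] by blast
  show ?thesis
  proof (rule that[of M \<epsilon> "\<lambda>k. shell_vol CARD('n) (\<epsilon> k)"])
    show "\<epsilon> \<longlonglongrightarrow> 0" "(\<lambda>k. shell_vol CARD('n) (\<epsilon> k)) \<longlonglongrightarrow> 0"
      unfolding \<epsilon>_def by (rule tendsto_inverse_shift shell_vol_tendsto)+
  qed (use M \<epsilon> emeasure_shell[OF \<epsilon>(1,3)] shell_vol_nonneg[OF less_imp_le[OF \<epsilon>(1)] \<epsilon>(3)] in auto)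
qed

text \<open>The approximants are the cutoffs. The error \<open>1 - cutoff\<close> rises outward, the
  cheap direction for the co-metric, and differs from 0 only in the shell, whose volume tends to
  0.\<close>

lemma one_in_sobolev_berwald:
  assumes p: "p > 1"
  shows "(\<lambda>_. 1) \<in> sobolev_W0 p (ball 0 1) (berwald :: real^'n \<Rightarrow> _)"
proof -
  obtain M \<epsilon> V where M: "M > 0" and \<epsilon>: "\<And>k. 0 < \<epsilon> k" "\<And>k. \<epsilon> k \<le> 1/4" "\<epsilon> \<longlonglongrightarrow> 0"
    and V: "\<And>k. V k \<ge> 0" "V \<longlonglongrightarrow> 0"
    and shell: "\<And>k. emeasure lborel (shell (\<epsilon> k) :: (real^'n) set) = ennreal (V k)"
    and energy: "\<And>k p. p > 1 \<Longrightarrow> energy p (\<lambda>x :: real^'n. - cutoff (\<epsilon> k) x) \<le> ennreal ((M * \<epsilon> k) powr p * V k)"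
    by (rule energy_cutoff_sequence[where 'n = 'n]) blast
  define A where "A = (\<lambda>k. \<integral>\<^sup>+ x\<in>ball 0 1. ennreal (\<bar>1 - cutoff (\<epsilon> k) (x :: real^'n)\<bar> powr p) \<partial>lborel)"
  define B where "B = (\<lambda>k. \<integral>\<^sup>+ x\<in>ball 0 1. ennreal (cometric berwald x
              (\<lambda>v. (0 :: real^'n) \<bullet> v - frechet_derivative (cutoff (\<epsilon> k)) (at x) v) powr p) \<partial>lborel)"
  have "enn_powr (A k) (1/p) \<le> ennreal (V k powr (1/p))" for k
  proof (rule enn_powr_le)
    have "A k \<le> (\<integral>\<^sup>+ x. indicator (shell (\<epsilon> k) :: (real^'n) set) x \<partial>lborel)"
      unfolding A_def
    proof (rule nn_integral_mono)
      fix x :: "real^'n"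
      have "\<bar>1 - cutoff (\<epsilon> k) x\<bar> powr p \<le> 1 powr p"
        using cutoff_bounds[of "\<epsilon> k" x] p by (intro powr_mono2) auto
      then have "ennreal (\<bar>1 - cutoff (\<epsilon> k) x\<bar> powr p) \<le> 1" by simp
      moreover have "cutoff (\<epsilon> k) x = 1" if "norm x < 1" "x \<notin> shell (\<epsilon> k)"
        using that in_shell[OF \<epsilon>(1) order_trans[OF \<epsilon>(2)] that(1)] by (intro cutoff_eq_1 \<epsilon>) (auto simp: not_less[symmetric])
      ultimately show "ennreal (\<bar>1 - cutoff (\<epsilon> k) x\<bar> powr p) * indicator (ball 0 1) x \<le> indicator (shell (\<epsilon> k)) x"
        by (cases "x \<in> shell (\<epsilon> k)") (auto simp: indicator_def)
    qed
    also have "\<dots> = ennreal (V k)"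
      unfolding shell[symmetric] by (rule nn_integral_indicator) (simp add: shell_def)
    finally show "A k \<le> ennreal (V k)" .
  qed (use V p in auto)
  moreover have "enn_powr (B k) (1/p) \<le> ennreal (M * \<epsilon> k * V k powr (1/p))" for k
  proof -
    have "enn_powr (B k) (1/p) \<le> ennreal (((M * \<epsilon> k) powr p * V k) powr (1/p))"
      using energy[OF p, of k] V(1)[of k] p
      by (intro enn_powr_le) (auto simp: B_def energy_def frechet_derivative_minus_cutoff)
    then show ?thesis using V(1)[of k] M \<epsilon>(1)[of k] p by (simp add: powr_p_powr_inverse)
  qed
  ultimately have le: "enn_powr (A k) (1/p) + enn_powr (B k) (1/p) \<le> ennreal (V k powr (1/p) + M * \<epsilon> k * V k powr (1/p))" for k
    using V(1)[of k] M \<epsilon>(1)[of k] by (subst ennreal_plus) (auto intro!: add_mono)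
  have lim: "(\<lambda>k. ennreal (V k powr (1/p) + M * \<epsilon> k * V k powr (1/p))) \<longlonglongrightarrow> ennreal (0 powr (1/p) + M * 0 * 0 powr (1/p))"
  proof (rule tendsto_ennrealI)
    have L: "(\<lambda>k. V k powr (1/p)) \<longlonglongrightarrow> 0 powr (1/p)"
      using V p by (intro tendsto_powr2) auto
    show "(\<lambda>k. V k powr (1/p) + M * \<epsilon> k * V k powr (1/p)) \<longlonglongrightarrow> 0 powr (1/p) + M * 0 * 0 powr (1/p)"
      by (intro tendsto_add tendsto_mult tendsto_const L \<epsilon>(3))
  qed
  have "(\<lambda>k. enn_powr (A k) (1/p) + enn_powr (B k) (1/p)) \<longlonglongrightarrow> 0"
    by (rule tendsto_sandwich[OF _ _ tendsto_const lim[simplified]]) (use le in simp_all)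
  then show ?thesis
    unfolding sobolev_W0_def A_def B_def
    using weak_gradient_const test_fun_cutoff[OF \<epsilon>(1)]
    by (intro CollectI exI[of _ "\<lambda>_. 0"] exI[of _ "\<lambda>k. cutoff (\<epsilon> k)"]) auto
qed

text \<open>A replacement for Hoelder's inequality through
  \<open>W \<le> \<delta> + \<delta> powr (1 - p) * W powr p\<close>. In the application \<phi> may
  be the co-metric, known only through pointwise bounds and an integral bound; the measurable
  \<open>W\<close>, the positive part of \<open>w\<close> over \<open>C\<close>, is therefore
  interposed.\<close>

lemma set_integral_le_of_powr:
  fixes w \<phi> :: "'a::euclidean_space \<Rightarrow> real"
  assumes p: "p > 1" and \<delta>: "\<delta> > 0" and C: "C > 0" and V: "V \<ge> 0" and E: "E \<ge> 0"
    and B: "B \<in> sets borel" "emeasure lborel B = ennreal V"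
    and w: "set_integrable lborel B w"
    and le: "\<And>x. x \<in> B \<Longrightarrow> w x \<le> C * \<phi> x" "\<And>x. x \<in> B \<Longrightarrow> \<phi> x \<ge> 0"
    and int: "(\<integral>\<^sup>+ x\<in>B. ennreal (\<phi> x powr p) \<partial>lborel) \<le> ennreal E"
  shows "(LINT x:B|lborel. w x) \<le> C * (\<delta> * V + \<delta> powr (1 - p) * E)"
proof -
  define W where "W = (\<lambda>x. max 0 (indicator B x *\<^sub>R w x) / C)"
  have i: "integrable lborel (\<lambda>x. indicator B x *\<^sub>R w x)"
    using w by (simp add: set_integrable_def)
  have iW: "integrable lborel W"
    unfolding W_def using i by (intro integrable_divide integrable_max) auto
  have mW [measurable]: "W \<in> borel_measurable lborel" using iW by auto
  have W0: "W x \<ge> 0" for x using C by (simp add: W_def)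
  have WB: "W x = 0" if "x \<notin> B" for x using that by (simp add: W_def)
  have W\<phi>: "W x \<le> \<phi> x" if "x \<in> B" for x
    using le[OF that] that C by (auto simp: W_def pos_divide_le_eq mult.commute)
  \<comment> \<open>If \<open>W x > \<delta>\<close>, multiply by
    \<open>(W x / \<delta>) powr (p - 1) \<ge> 1\<close>.\<close>
  have young: "W x \<le> \<delta> + \<delta> powr (1 - p) * W x powr p" for x
  proof (cases "W x \<le> \<delta>")
    case False
    then have "W x > 0" using \<delta> by linarith
    have "1 \<le> (W x / \<delta>) powr (p - 1)"
      using False \<delta> p by (intro ge_one_powr_ge_zero) auto
    then have "W x * 1 \<le> W x * (W x / \<delta>) powr (p - 1)"
      using W0 by (intro mult_left_mono) auto
    also have "\<dots> = \<delta> powr (1 - p) * W x powr p"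
      using \<open>W x > 0\<close> \<delta> by (simp add: powr_divide powr_diff powr_minus field_simps)
    finally show ?thesis using \<delta> by simp
  qed (simp add: add_increasing2)
  have "ennreal (LINT x|lborel. W x) = (\<integral>\<^sup>+ x. ennreal (W x) \<partial>lborel)"
    using iW W0 by (intro nn_integral_eq_integral[symmetric]) auto
  also have "\<dots> \<le> (\<integral>\<^sup>+ x. ennreal \<delta> * indicator B x + ennreal (\<delta> powr (1 - p)) * ennreal (W x powr p) \<partial>lborel)"
  proof (rule nn_integral_mono)
    fix x
    show "ennreal (W x) \<le> ennreal \<delta> * indicator B x + ennreal (\<delta> powr (1 - p)) * ennreal (W x powr p)"
    proof (cases "x \<in> B")
      case True
      then show ?thesis
        using ennreal_leI[OF young[of x]] \<delta> by (simp add: ennreal_mult)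
    qed (simp add: WB)
  qed
  also have "\<dots> = ennreal \<delta> * ennreal V + ennreal (\<delta> powr (1 - p)) * (\<integral>\<^sup>+ x. ennreal (W x powr p) \<partial>lborel)"
    using B by (subst nn_integral_add) (auto simp: nn_integral_cmult)
  also have "\<dots> \<le> ennreal \<delta> * ennreal V + ennreal (\<delta> powr (1 - p)) * ennreal E"
  proof (intro add_left_mono mult_left_mono)
    have "(\<integral>\<^sup>+ x. ennreal (W x powr p) \<partial>lborel) \<le> (\<integral>\<^sup>+ x\<in>B. ennreal (\<phi> x powr p) \<partial>lborel)"
    proof (rule nn_integral_mono)
      fix x show "ennreal (W x powr p) \<le> ennreal (\<phi> x powr p) * indicator B x"
        using W\<phi>[of x] W0[of x] WB[of x] p by (cases "x \<in> B") (auto intro!: ennreal_leI powr_mono2)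
    qed
    then show "(\<integral>\<^sup>+ x. ennreal (W x powr p) \<partial>lborel) \<le> ennreal E" using int by simp
  qed simp
  also have "\<dots> = ennreal (\<delta> * V + \<delta> powr (1 - p) * E)"
    using \<delta> V E by (simp add: ennreal_mult)
  finally have "(LINT x|lborel. W x) \<le> \<delta> * V + \<delta> powr (1 - p) * E"
    using \<delta> V E by (subst (asm) ennreal_le_iff) auto
  then have "C * (LINT x|lborel. W x) \<le> C * (\<delta> * V + \<delta> powr (1 - p) * E)"
    using C by (intro mult_left_mono) auto
  moreover have "(LINT x:B|lborel. w x) \<le> (LINT x|lborel. C * W x)"
    unfolding set_lebesgue_integral_def using i iW C
    by (intro integral_mono) (auto simp: W_def)
  ultimately show ?thesis using iW by simp
qed

text \<open>Rises from 0 at \<open>x $ i = 1/4\<close> to 1 at \<open>x $ i = 1/2\<close>. Where it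
  is nonzero, the direction \<open>- axis i 1\<close> points inward with bounded Berwald
  length.\<close>

definition ramp :: "'n \<Rightarrow> real^'n \<Rightarrow> real" where
  "ramp i x = step (4 * x $ i - 1)"

lemma Cinf_on_ramp: "Cinf_on UNIV (ramp i)"
  unfolding Cinf_on_def ramp_def[abs_def]
  by (intro allI Ck_on_compose_real[OF Ck_on_step] Ck_on_mult Ck_on_diff Ck_on_const
      Ck_on_bounded_linear bounded_linear_vec_nth)

lemma frechet_derivative_ramp:
  fixes x :: "real^'n"
  shows "(ramp i has_derivative (\<lambda>v. 4 * deriv step (4 * x $ i - 1) * v $ i)) (at x)"
    "frechet_derivative (ramp i) (at x) (axis i 1) = 4 * deriv step (4 * x $ i - 1)"
proof -
  have "((\<lambda>x::real^'n. 4 * x $ i - 1) has_derivative (\<lambda>v. 4 * v $ i)) (at x)" for x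
    by (auto intro!: derivative_eq_intros bounded_linear.has_derivative[OF bounded_linear_vec_nth])
  from diff_chain_at[OF this step_deriv[unfolded has_field_derivative_def]]
  show *: "(ramp i has_derivative (\<lambda>v. 4 * deriv step (4 * x $ i - 1) * v $ i)) (at x)"
    by (simp add: o_def ramp_def[abs_def] mult_ac)
  show "frechet_derivative (ramp i) (at x) (axis i 1) = 4 * deriv step (4 * x $ i - 1)"
    by (simp add: frechet_derivative_at[OF *, symmetric])
qed

lemma ramp_integrable: "set_integrable lborel (ball 0 1) (\<lambda>x :: real^'n. deriv step (4 * x $ i - 1))"
proof -
  have "continuous_on UNIV (\<lambda>x :: real^'n. deriv step (4 * x $ i - 1))"
    by (intro continuous_on_compose2[OF continuous_on_deriv_step] continuous_intros) auto
  then have "set_integrable lborel (cball 0 1) (\<lambda>x :: real^'n. deriv step (4 * x $ i - 1))"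
    unfolding set_integrable_def by (intro borel_integrable_compact) (auto intro: continuous_on_subset)
  then show ?thesis by (rule set_integrable_subset) auto
qed

lemma ramp_integral_pos: "(LINT x:ball (0 :: real^'n) 1|lborel. deriv step (4 * x $ i - 1)) > 0"
proof -
  obtain t where t: "t \<in> {0<..<1}" "deriv step t > 0" using deriv_step_pos by blast
  define d where "d = deriv step t / 2"
  define x0 :: "real^'n" where "x0 = ((t + 1) / 4) *\<^sub>R axis i 1"
  let ?h = "\<lambda>x :: real^'n. deriv step (4 * x $ i - 1)"
  have "continuous_on UNIV ?h"
    by (intro continuous_on_compose2[OF continuous_on_deriv_step] continuous_intros) auto
  then have "open {x. d < ?h x}"
    by (intro open_Collect_less continuous_on_const)
  moreover have "4 * x0 $ i - 1 = t" by (simp add: x0_def field_simps)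
  then have "x0 \<in> {x. d < ?h x}" using t by (simp add: d_def)
  moreover have "x0 \<in> ball 0 1" using t by (simp add: x0_def)
  ultimately obtain r where r: "r > 0" "ball x0 r \<subseteq> {x. d < ?h x} \<inter> ball 0 1"
    using open_contains_ball[of "{x. d < ?h x} \<inter> ball 0 1"] by blast
  have "0 < d * measure lborel (ball x0 r)"
    using t r(1) content_ball_pos[of r x0] by (simp add: d_def measure_def)
  also have "\<dots> = (LINT x|lborel. d * indicator (ball x0 r) x)"
    by simp
  also have "\<dots> \<le> (LINT x:ball 0 1|lborel. ?h x)"
    unfolding set_lebesgue_integral_def
  proof (rule integral_mono)
    show "integrable lborel (\<lambda>x. d * indicator (ball x0 r) x)"
      by (intro integrable_mult_right integrable_real_indicator) (use emeasure_lborel_ball_finite[of x0 r] in auto)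
    show "integrable lborel (\<lambda>x. indicator (ball 0 1) x *\<^sub>R ?h x)"
      using ramp_integrable[of i] by (simp add: set_integrable_def)
    show "d * indicator (ball x0 r) x \<le> indicator (ball 0 1) x *\<^sub>R ?h x" for x
      using r(2) deriv_step_nonneg by (auto simp: indicator_def subset_iff intro: less_imp_le)
  qed
  finally show ?thesis .
qed

text \<open>With \<open>z\<close> a support point of largest norm,
  \<open>\<epsilon> = conf z / 2\<close> makes \<open>1 - 2 \<epsilon> = z \<bullet> z\<close>.
  Multiplying by this cutoff turns the ramp into a test function without changing it on the
  support.\<close>

lemma test_fun_cutoff_support:
  assumes "test_fun (ball (0 :: real^'n) 1) f"
  obtains \<epsilon> where "0 < \<epsilon>" "\<And>x. x \<in> supp f \<Longrightarrow> cutoff \<epsilon> x = 1"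
proof (cases "supp f = {}")
  case False
  have "\<exists>z\<in>supp f. \<forall>x\<in>supp f. x \<bullet> x \<le> z \<bullet> z"
    by (intro continuous_attains_sup compact_support_test_fun[OF assms] False continuous_intros)
  then obtain z where z: "z \<in> supp f" "\<And>x. x \<in> supp f \<Longrightarrow> x \<bullet> x \<le> z \<bullet> z"
    by blast
  have "norm z < 1" using z(1) assms by (auto simp: test_fun_def)
  then have "conf z > 0" by (rule conf_pos)
  then show ?thesis
    using z(2) by (intro that[of "conf z / 2"] cutoff_eq_1) (auto simp: conf_def field_simps)
qed (use that[of 1] in auto)

text \<open>Here \<open>x \<bullet> y = - x $ i\<close> is negative, so \<open>disc\<close> and
  \<open>disc - x \<bullet> y\<close> are both at least \<open>1/4\<close>. Then
  \<open>funk_disc_minus\<close> gives \<open>funk \<le> 4\<close>, and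
  \<open>16 / (1/4) = 64\<close>.\<close>

lemma berwald_inward_le:
  fixes x :: "real^'n"
  assumes x: "norm x < 1" and xi: "x $ i \<ge> 1/4"
  shows "berwald x (- axis i 1) \<le> 64"
proof -
  let ?y = "- axis i (1::real) :: real^'n"
  have y: "?y \<noteq> 0" "?y \<bullet> ?y = 1" by (auto simp: inner_axis_axis)
  have a: "x \<bullet> ?y = - x $ i" by (simp add: inner_axis)
  have D: "disc x ?y \<ge> 1/4" using abs_inner_less_disc[OF x y(1)] xi unfolding a by linarith
  have "funk x ?y * (1/4) \<le> funk x ?y * (disc x ?y - x \<bullet> ?y)"
    using D xi a funk_pos[OF x y(1)] by (intro mult_left_mono) auto
  then have "funk x ?y \<le> 4" using funk_disc_minus[OF x, of ?y] y(2) by simp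
  then have "(funk x ?y)\<^sup>2 \<le> 4\<^sup>2" using funk_pos[OF x y(1)] by (intro power_mono) auto
  then have "(funk x ?y)\<^sup>2 / disc x ?y \<le> 4\<^sup>2 / (1/4)"
    using D by (intro frac_le) auto
  then show ?thesis by (simp add: berwald_eq[OF x])
qed

text \<open>For an approximant \<open>f\<close>, integration by parts splits the integral
  \<open>J\<close> of the ramp's slope into that of \<open>1 + f\<close> times the slope and that of
  \<open>(f' - G_i)\<close> \<psi>. The first is controlled by the L^p distance of \<open>f\<close>
  to -1. The second needs only an upper bound on \<open>f' - G_i\<close>, the value of
  \<open>G - df\<close> at the inward vector \<open>- e_i\<close>; that is a one-sided bound, as the
  asymmetric co-metric provides it. Both parts can be made small, but \<open>J > 0\<close> is
  fixed.\<close>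

lemma minus_one_notin_sobolev_berwald:
  assumes p: "p > 1"
  shows "(\<lambda>_. - 1) \<notin> sobolev_W0 p (ball 0 1) (berwald :: real^'n \<Rightarrow> _)"
proof
  let ?B = "ball (0 :: real^'n) 1"
  assume "(\<lambda>_. - 1) \<in> sobolev_W0 p ?B berwald"
  then obtain G uk where G: "weak_gradient ?B (\<lambda>_. - 1) G" and uk: "\<And>k. test_fun ?B (uk k)"
    and lim: "(\<lambda>k. enn_powr (\<integral>\<^sup>+ x\<in>?B. ennreal (\<bar>- 1 - uk k x\<bar> powr p) \<partial>lborel) (1/p)
         + enn_powr (\<integral>\<^sup>+ x\<in>?B. ennreal (cometric berwald x
              (\<lambda>v. G x \<bullet> v - frechet_derivative (uk k) (at x) v) powr p) \<partial>lborel) (1/p)) \<longlonglongrightarrow> 0"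
    unfolding sobolev_W0_def by blast
  let ?P = "\<lambda>f. \<integral>\<^sup>+ x\<in>?B. ennreal (\<bar>- 1 - f x\<bar> powr p) \<partial>lborel"
  let ?Q = "\<lambda>f. \<integral>\<^sup>+ x\<in>?B. ennreal (cometric berwald x
              (\<lambda>v. G x \<bullet> v - frechet_derivative f (at x) v) powr p) \<partial>lborel"
  fix i :: 'n
  let ?e = "axis i (1::real) :: real^'n"
  let ?s = "\<lambda>x :: real^'n. deriv step (4 * x $ i - 1)"
  define J where "J = (LINT x:?B|lborel. 4 * ?s x)"
  have J: "J > 0" using ramp_integral_pos[of i] by (simp add: J_def)
  obtain M where M: "M > 0" "\<And>t. \<bar>deriv step t\<bar> \<le> M" using deriv_step_bounded by blast
  define V where "V = unit_ball_vol CARD('n)"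
  have V: "V \<ge> 0" "emeasure lborel ?B = ennreal V" by (auto simp: V_def emeasure_ball)
  have cs: "continuous_on UNIV ?s"
    by (intro continuous_on_compose2[OF continuous_on_deriv_step] continuous_intros) auto
  have est: "J \<le> (4 * M + 64) * (\<delta> * V + \<delta> powr (1 - p) * E)"
    if \<delta>: "\<delta> > 0" and E: "E > 0" for \<delta> E
  proof -
    have "\<forall>\<^sub>F k in sequentially. enn_powr (?P (uk k)) (1/p) + enn_powr (?Q (uk k)) (1/p) < ennreal (E powr (1/p))"
      using E by (intro order_tendstoD(2)[OF lim]) simp
    then obtain k where k: "enn_powr (?P (uk k)) (1/p) + enn_powr (?Q (uk k)) (1/p) < ennreal (E powr (1/p))"
      by (auto simp: eventually_sequentially)
    define f where "f = uk k"
    have f: "test_fun ?B f" using uk by (simp add: f_def)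
    have "enn_powr (?P f) (1/p) \<le> ennreal (E powr (1/p))"
      "enn_powr (?Q f) (1/p) \<le> ennreal (E powr (1/p))"
      unfolding f_def
      by (rule order_trans[OF add_increasing2[OF zero_le order_refl] less_imp_le[OF k]],
          rule order_trans[OF add_increasing[OF zero_le order_refl] less_imp_le[OF k]])
    then have E1: "?P f \<le> ennreal E"
      and E2: "?Q f \<le> ennreal E"
      using E p by (auto intro!: enn_powr_leD[of _ "1/p"])
    let ?f' = "\<lambda>x. frechet_derivative f (at x) ?e"
    obtain \<epsilon> where \<epsilon>: "0 < \<epsilon>" and c1: "\<And>x. x \<in> supp f \<Longrightarrow> cutoff \<epsilon> x = 1"
      using test_fun_cutoff_support[OF f] by blast
    \<comment> \<open>\<open>\<psi>\<close> agrees with the ramp on the support of \<open>f\<close>, and being a test function of the ball it is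
      orthogonal to the weak gradient \<open>G\<close> of a constant.\<close>
    define \<psi> where "\<psi> = (\<lambda>x. cutoff \<epsilon> x * ramp i x)"
    have \<psi>: "test_fun ?B \<psi>"
      unfolding \<psi>_def by (rule test_fun_times[OF test_fun_cutoff[OF \<epsilon>] Cinf_on_ramp])
    have \<psi>01: "0 \<le> \<psi> x" "\<psi> x \<le> 1" for x
      using cutoff_bounds[of \<epsilon> x] step_bounds by (auto simp: \<psi>_def ramp_def intro: mult_le_one)
    have f\<psi>: "?f' x * \<psi> x = ?f' x * ramp i x" for x
      using c1[of x] fun_cong[OF test_fun_derivative_eq_0[OF f], of x ?e] by (cases "x \<in> supp f") (auto simp: \<psi>_def)
    have fB: "f x = 0" "?f' x = 0" if "x \<notin> ?B" for x
    proof -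
      have nx: "x \<notin> supp f" using that f by (auto simp: test_fun_def)
      show "f x = 0" by (rule test_fun_eq_0[OF f nx])
      show "?f' x = 0" by (rule fun_cong[OF test_fun_derivative_eq_0[OF f nx]])
    qed
    have cf: "continuous_on UNIV f" by (rule Cinf_on_continuous_on[OF test_fun_Cinf[OF f]])
    have cf': "continuous_on UNIV ?f'"
      by (rule Cinf_on_continuous_on[OF Cinf_on_frechet_derivative[OF test_fun_Cinf[OF f]]])
    have cr: "continuous_on UNIV (ramp i)" by (rule Cinf_on_continuous_on[OF Cinf_on_ramp])
    have f'0: "?f' x = 0" if "x \<notin> supp f" for x
      by (rule fun_cong[OF test_fun_derivative_eq_0[OF f that]])
    have if1: "integrable lborel (\<lambda>x. ?f' x * ramp i x)"
      by (rule integrable_compact_support[OF continuous_on_mult[OF cf' cr] compact_support_test_fun[OF f]])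
        (simp add: f'0)
    have if2: "integrable lborel (\<lambda>x. f x * (4 * ?s x))"
      by (rule integrable_compact_support[OF continuous_on_mult[OF cf continuous_on_mult[OF continuous_on_const cs]] compact_support_test_fun[OF f]])
        (drule test_fun_eq_0[OF f], simp only: mult_zero_left)
    have parts: "(LINT x|lborel. ?f' x * ramp i x) = - (LINT x|lborel. f x * (4 * ?s x))"
    proof -
      have "frechet_derivative (\<lambda>x. f x * ramp i x) (at x) ?e = f x * (4 * ?s x) + ?f' x * ramp i x" for x
      proof -
        have "((\<lambda>x. f x * ramp i x) has_derivative (\<lambda>v. f x * (4 * ?s x * v $ i) + frechet_derivative f (at x) v * ramp i x)) (at x)"
          by (rule has_derivative_mult[OF test_fun_has_derivative[OF f] frechet_derivative_ramp(1)])
        from frechet_derivative_at[OF this, symmetric] show ?thesis by simp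
      qed
      then have "(LINT x|lborel. f x * (4 * ?s x) + ?f' x * ramp i x) = 0"
        using integral_test_fun_derivative[OF test_fun_times[OF f Cinf_on_ramp], of i ?e] by simp
      then show ?thesis using if1 if2 by simp
    qed
    have G\<psi>: "(LINT x:?B|lborel. G x $ i * \<psi> x) = 0"
    proof -
      have "(LINT x:?B|lborel. - 1 * frechet_derivative \<psi> (at x) ?e) = - (LINT x:?B|lborel. G x $ i * \<psi> x)"
        using G \<psi> unfolding weak_gradient_def by blast
      then show ?thesis
        using set_integral_test_fun_derivative[OF \<psi>, of ?e] by (simp add: set_lebesgue_integral_def)
    qed
    have iG: "set_integrable lborel ?B (\<lambda>x. G x $ i * \<psi> x)"
    proof -
      let ?K = "supp \<psi>"
      have K: "compact ?K" "?K \<subseteq> ?B" using \<psi> by (auto simp: test_fun_def)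
      then have "integrable lborel (\<lambda>x. indicator ?K x *\<^sub>R G x)"
        using G unfolding weak_gradient_def set_integrable_def by blast
      then have i: "integrable lborel (\<lambda>x. (indicator ?K x *\<^sub>R G x) $ i)"
        by (rule integrable_bounded_linear[OF bounded_linear_vec_nth])
      have [measurable]: "\<psi> \<in> borel_measurable borel" by (rule Cinf_on_imp_borel[OF test_fun_Cinf[OF \<psi>]])
      have "integrable lborel (\<lambda>x. (indicator ?K x *\<^sub>R G x) $ i * \<psi> x)"
        by (rule Bochner_Integration.integrable_bound[OF i])
          (use i \<psi>01 in \<open>auto simp: abs_mult intro!: mult_left_le\<close>)
      also have "(\<lambda>x. (indicator ?K x *\<^sub>R G x) $ i * \<psi> x) = (\<lambda>x. indicator ?B x *\<^sub>R (G x $ i * \<psi> x))"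
      proof
        fix x show "(indicator ?K x *\<^sub>R G x) $ i * \<psi> x = indicator ?B x *\<^sub>R (G x $ i * \<psi> x)"
          using K(2) test_fun_eq_0[OF \<psi>, of x] by (cases "x \<in> ?K") (auto simp: indicator_def)
      qed
      finally show ?thesis by (simp add: set_integrable_def)
    qed
    have indf: "indicator ?B x *\<^sub>R (?f' x * \<psi> x) = ?f' x * ramp i x" for x
      using fB(2)[of x] f\<psi>[of x] by (cases "x \<in> ?B") auto
    have ifB: "set_integrable lborel ?B (\<lambda>x. ?f' x * \<psi> x)"
      unfolding set_integrable_def indf by (rule if1)
    have I2: "(LINT x:?B|lborel. (?f' x - G x $ i) * \<psi> x) = (LINT x|lborel. ?f' x * ramp i x)"
      using set_integral_diff(2)[OF ifB iG] G\<psi>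
      by (simp add: left_diff_distrib set_lebesgue_integral_def indf del: real_scaleR_def)
    have i2: "set_integrable lborel ?B (\<lambda>x. (?f' x - G x $ i) * \<psi> x)"
      using set_integral_diff(1)[OF ifB iG] by (simp add: left_diff_distrib)
    have ind1: "indicator ?B x *\<^sub>R (f x * (4 * ?s x)) = f x * (4 * ?s x)" for x
      using fB(1)[of x] by (cases "x \<in> ?B") auto
    have ifs: "set_integrable lborel ?B (\<lambda>x. f x * (4 * ?s x))"
      unfolding set_integrable_def ind1 by (rule if2)
    have i4: "set_integrable lborel ?B (\<lambda>x. 4 * ?s x)"
      using ramp_integrable[of i] by (intro set_integrable_mult_right) auto
    have i1: "set_integrable lborel ?B (\<lambda>x. (1 + f x) * (4 * ?s x))"
      using set_integral_add(1)[OF i4 ifs] by (simp add: ring_distribs)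
    have "(LINT x:?B|lborel. (1 + f x) * (4 * ?s x)) = J + (LINT x|lborel. f x * (4 * ?s x))"
      using set_integral_add(2)[OF i4 ifs]
      by (simp add: ring_distribs J_def set_lebesgue_integral_def ind1 del: real_scaleR_def)
    then have "J = (LINT x:?B|lborel. (1 + f x) * (4 * ?s x)) + (LINT x:?B|lborel. (?f' x - G x $ i) * \<psi> x)"
      unfolding I2 parts by simp
    also have "(LINT x:?B|lborel. (1 + f x) * (4 * ?s x)) \<le> 4 * M * (\<delta> * V + \<delta> powr (1 - p) * E)"
    proof (rule set_integral_le_of_powr[OF p \<delta> _ V(1) less_imp_le[OF E] _ V(2) i1 _ _ E1])
      fix x
      have "(1 + f x) * (4 * ?s x) \<le> \<bar>1 + f x\<bar> * (4 * M)"
        using M(2)[of "4 * x $ i - 1"] deriv_step_nonneg[of "4 * x $ i - 1"] by (intro mult_mono) auto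
      moreover have abs_eq: "\<bar>- 1 - f x\<bar> = \<bar>1 + f x\<bar>" by linarith
      ultimately show "(1 + f x) * (4 * ?s x) \<le> 4 * M * \<bar>- 1 - f x\<bar>"
        by (simp only: mult.commute[of "4 * M"] abs_eq)
    qed (use M in auto)
    also have "(LINT x:?B|lborel. (?f' x - G x $ i) * \<psi> x) \<le> 64 * (\<delta> * V + \<delta> powr (1 - p) * E)"
    proof (rule set_integral_le_of_powr[OF p \<delta> _ V(1) less_imp_le[OF E] _ V(2) i2 _ _ E2])
      fix x assume "x \<in> ?B"
      then have x: "norm x < 1" by simp
      let ?\<eta> = "\<lambda>v. G x \<bullet> v - frechet_derivative f (at x) v"
      have lin: "linear ?\<eta>"
        using has_derivative_linear[OF test_fun_has_derivative[OF f]]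
        by (intro linear_compose_sub bounded_linear.linear[OF bounded_linear_inner_right])
      show cm: "0 \<le> cometric berwald x ?\<eta>" by (rule cometric_nonneg[OF x lin])
      have \<eta>e: "?\<eta> (- ?e) = ?f' x - G x $ i"
        using linear_neg[OF has_derivative_linear[OF test_fun_has_derivative[OF f]]] by (simp add: inner_axis)
      show "(?f' x - G x $ i) * \<psi> x \<le> 64 * cometric berwald x ?\<eta>"
      \<comment> \<open>Otherwise \<psi> vanishes or the product is nonpositive, and the upper bound
        is trivial.\<close>
      proof (cases "x $ i \<ge> 1/4 \<and> ?f' x - G x $ i \<ge> 0")
        case True
        have e: "- ?e \<noteq> 0" by simp
        have "(?f' x - G x $ i) * \<psi> x \<le> ?\<eta> (- ?e)"
          unfolding \<eta>e using True \<psi>01[of x] by (intro mult_left_le) auto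
        also have "\<dots> \<le> berwald x (- ?e) * cometric berwald x ?\<eta>"
          using cometric_upper[OF x lin e] berwald_pos[OF x e] by (simp add: pos_divide_le_eq mult.commute)
        also have "\<dots> \<le> 64 * cometric berwald x ?\<eta>"
          using berwald_inward_le[OF x] True cm by (intro mult_right_mono) auto
        finally show ?thesis .
      next
        case False
        then consider "x $ i < 1/4" | "?f' x - G x $ i < 0" by linarith
        then have "(?f' x - G x $ i) * \<psi> x \<le> 0"
        proof cases
          case 1
          then have "\<psi> x = 0" by (simp add: \<psi>_def ramp_def step_eq_0)
          then show ?thesis by simp
        next
          case 2
          then show ?thesis using \<psi>01(1)[of x] by (intro mult_nonpos_nonneg) auto
        qed
        then show ?thesis using cm by simp
      qed
    qed auto
    finally show ?thesis by (simp add: ring_distribs)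
  qed
  have "J \<le> (4 * M + 64) * (V + 1) * \<delta>" if "\<delta> > 0" for \<delta>
  proof -
    \<comment> \<open>Taking \<open>E = \<delta> powr p\<close> balances the two error terms, so the
      whole bound is linear in \<delta>.\<close>
    have "\<delta> powr (1 - p) * \<delta> powr p = \<delta>" using that by (simp flip: powr_add)
    then show ?thesis using est[OF that, of "\<delta> powr p"] that by (simp add: algebra_simps)
  qed
  note le = this
  define K where "K = (4 * M + 64) * (V + 1)"
  have "K > 0" unfolding K_def using M(1) V(1) by (intro mult_pos_pos) auto
  then have "J / (2 * K) > 0" using J by simp
  from le[OF this, folded K_def] have "J \<le> K * (J / (2 * K))" .
  then show False using J \<open>K > 0\<close> by simp
qed

lemma sobolev_berwald_not_vector_space:
  assumes "p > 1" shows "\<not> is_vector_space (sobolev_W0 p (ball 0 1) (berwald :: real^'n \<Rightarrow> _))"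
proof
  let ?W = "sobolev_W0 p (ball 0 1) (berwald :: real^'n \<Rightarrow> _)"
  assume "is_vector_space ?W"
  then have "\<forall>c. \<forall>u\<in>?W. (\<lambda>x. c * u x) \<in> ?W"
    unfolding is_vector_space_def by simp
  from this[rule_format, OF one_in_sobolev_berwald[OF assms], of "- 1"]
  show False using minus_one_notin_sobolev_berwald[OF assms, where 'n = 'n] by simp
qed

section \<open>The Hardy and uncertainty quotients\<close>

lemma test_fun_minus_cutoff:
  assumes "0 < \<epsilon>" "\<epsilon> \<le> 1/4"
  shows "(\<lambda>x. - cutoff \<epsilon> x) \<in> {f :: real^'n \<Rightarrow> real. test_fun (ball 0 1) f \<and> f \<noteq> (\<lambda>_. 0)}"
proof -
  have "test_fun (ball 0 1) (\<lambda>x :: real^'n. cutoff \<epsilon> x * - 1)"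
    by (rule test_fun_times[OF test_fun_cutoff[OF assms(1)]]) (simp add: Cinf_on_def Ck_on_const)
  moreover have "cutoff \<epsilon> (0 :: real^'n) = 1" using assms by (intro cutoff_eq_1) auto
  ultimately show ?thesis by (auto simp: fun_eq_iff intro!: exI[of _ 0])
qed

text \<open>On the ball of radius \<open>1/2\<close> the cutoff is 1 and the distance is at most 1,
  so its nonpositive power is at least 1. This bounds the denominators of both quotients away from
  0, uniformly in \<epsilon>.\<close>

lemma weighted_integral_cutoff_ge:
  assumes \<epsilon>: "0 < \<epsilon>" "\<epsilon> \<le> 1/4" and q: "q \<le> 0" and p: "p > 0"
  shows "ennreal (measure lborel (ball (0 :: real^'n) (1/2))) \<le>
    mass p q (\<lambda>x :: real^'n. - cutoff \<epsilon> x)"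
proof -
  have "ennreal (measure lborel (ball (0 :: real^'n) (1/2))) = (\<integral>\<^sup>+ x. indicator (ball (0 :: real^'n) (1/2)) x \<partial>lborel)"
    using emeasure_lborel_ball_finite[of "0 :: real^'n" "1/2"] by (simp add: emeasure_eq_ennreal_measure)
  also have "\<dots> \<le> mass p q (\<lambda>x :: real^'n. - cutoff \<epsilon> x)"
    unfolding mass_def
  proof (rule nn_integral_mono_AE)
    \<comment> \<open>The distance bounds are stated away from the origin, which is a null
      set.\<close>
    have "AE x in lborel. x \<noteq> (0 :: real^'n)" by (rule AE_lborel_singleton)
    then show "AE x in lborel. indicator (ball (0 :: real^'n) (1/2)) x \<le>
      ennreal (\<bar>- cutoff \<epsilon> x\<bar> powr p * finsler_dist (ball 0 1) berwald (0 :: real^'n) x powr q) * indicator (ball 0 1) x"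
    proof eventually_elim
      case (elim x)
      let ?d = "finsler_dist (ball 0 1) berwald (0 :: real^'n) x"
      show ?case
      proof (cases "x \<in> ball 0 (1/2)")
        case True
        then have x: "norm x < 1/2" by simp
        have "norm x * norm x \<le> (1/2) * (1/2)" using x by (intro mult_mono) auto
        then have c: "cutoff \<epsilon> x = 1" using \<epsilon> by (intro cutoff_eq_1) (auto simp: dot_square_norm power2_eq_square)
        have "?d \<le> norm x / (1 - norm x)" "norm x / 4 \<le> ?d"
          using finsler_dist_berwald_bounds[of x] x elim by auto
        moreover have "norm x / (1 - norm x) \<le> 1" using x by (simp add: divide_le_eq)
        moreover have "norm x > 0" using elim by simp
        ultimately have "0 < ?d" "?d \<le> 1" by linarith+
        then have "1 \<le> ?d powr q" using q powr_mono2'[of q ?d 1] by simp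
        then show ?thesis using c True x by (simp add: indicator_def)
      qed simp
    qed
  qed
  finally show ?thesis .
qed

text \<open>The singularity is dominated by weighted indicators of dyadic balls; their integrals
  form a geometric series with ratio \<open>2 powr (q - n)\<close>, which is below 1.\<close>

lemma nn_integral_norm_powr_finite:
  assumes q: "0 < q" "q < real DIM('a)"
  shows "(\<integral>\<^sup>+ x\<in>ball (0 :: 'a::euclidean_space) 1. ennreal (norm x powr (- q)) \<partial>lborel) < \<infinity>"
proof -
  let ?n = "DIM('a)"
  define b :: "nat \<Rightarrow> 'a set" where "b = (\<lambda>k. ball 0 ((1/2) ^ k))"
  define c where "c = (\<lambda>k. (2 powr q) ^ Suc k)"
  have cov: "ennreal (norm x powr (- q)) * indicator (ball 0 1) x \<le> (\<Sum>k. ennreal (c k) * indicator (b k) x)"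
    if "x \<noteq> 0" for x :: 'a
  proof (cases "norm x < 1")
    case True
    have ex: "\<exists>k. (1/2) ^ k \<le> norm x"
      using real_arch_pow_inv[of "norm x" "1/2"] that by (auto intro: less_imp_le)
    \<comment> \<open>Minimality gives \<open>2^(-k) \<le> |x| < 2^(-(k - 1))\<close>. So
      \<open>x\<close> lies in the ball of index \<open>j = k - 1\<close>, which explains the
      exponent \<open>Suc k\<close> in \<open>c\<close>.\<close>
    define k where "k = (LEAST k. (1/2) ^ k \<le> norm x)"
    have k: "(1/2) ^ k \<le> norm x" unfolding k_def using ex by (rule LeastI_ex)
    have "k \<noteq> 0" using k True by (cases k) auto
    then obtain j where j: "k = Suc j" by (cases k) auto
    have xb: "x \<in> b j" using not_less_Least[of j "\<lambda>k. (1/2) ^ k \<le> norm x"] j by (simp add: b_def k_def[symmetric])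
    have "norm x powr (- q) \<le> ((1/2) ^ k) powr (- q)"
      using k q by (intro powr_mono2') auto
    also have "(1/2::real) ^ k = 2 powr (- real k)"
      by (simp add: powr_minus powr_realpow power_one_over inverse_eq_divide)
    also have "(2 powr (- real k)) powr (- q) = (2 powr q) ^ k"
      by (simp only: powr_realpow[symmetric] powr_powr powr_gt_zero) (simp add: mult.commute)
    also have "\<dots> = c j"
      by (simp add: c_def j)
    finally have "ennreal (norm x powr (- q)) * indicator (ball 0 1) x \<le> ennreal (c j) * indicator (b j) x"
      using xb True by (simp add: ennreal_leI)
    also have "\<dots> \<le> (\<Sum>k. ennreal (c k) * indicator (b k) x)"
    proof -
      have "t j \<le> suminf t" for t :: "nat \<Rightarrow> ennreal"
        using sum_le_suminf[of t "{j}"] by simp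
      then show ?thesis .
    qed
    finally show ?thesis .
  qed simp
  have "(\<integral>\<^sup>+ x\<in>ball (0 :: 'a) 1. ennreal (norm x powr (- q)) \<partial>lborel)
      \<le> (\<integral>\<^sup>+ x. (\<Sum>k. ennreal (c k) * indicator (b k) x) \<partial>lborel)"
    by (rule nn_integral_mono_AE) (use AE_lborel_singleton[of "0 :: 'a"] cov in \<open>auto elim!: eventually_mono\<close>)
  also have "\<dots> = (\<Sum>k. \<integral>\<^sup>+ x. ennreal (c k) * indicator (b k) x \<partial>lborel)"
    by (rule nn_integral_suminf) (auto simp: b_def intro!: borel_measurable_times_ennreal borel_measurable_indicator)
  also have "\<dots> = (\<Sum>k. ennreal (unit_ball_vol ?n * 2 powr q * (2 powr (q - ?n)) ^ k))"
  proof (rule suminf_cong)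
    fix k
    have "(\<integral>\<^sup>+ x. ennreal (c k) * indicator (b k) x \<partial>lborel) = ennreal (c k) * emeasure lborel (b k)"
      by (rule nn_integral_cmult_indicator) (simp add: b_def)
    also have "\<dots> = ennreal (c k * (unit_ball_vol ?n * ((1/2) ^ k) ^ ?n))"
      by (simp add: b_def emeasure_ball c_def ennreal_mult)
    also have "c k * (unit_ball_vol ?n * ((1/2) ^ k) ^ ?n) = unit_ball_vol ?n * 2 powr q * (2 powr (q - ?n)) ^ k"
      by (simp add: c_def powr_diff powr_realpow power_divide power_mult[symmetric] mult.commute)
    finally show "(\<integral>\<^sup>+ x. ennreal (c k) * indicator (b k) x \<partial>lborel)
        = ennreal (unit_ball_vol ?n * 2 powr q * (2 powr (q - ?n)) ^ k)" .
  qed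
  also have "\<dots> < \<infinity>"
  proof -
    have "(2::real) powr (q - ?n) < 2 powr 0" using q by (intro powr_less_mono) auto
    then have "summable (\<lambda>k. unit_ball_vol ?n * 2 powr q * (2 powr (q - ?n)) ^ k)"
      by (intro summable_mult summable_geometric) simp
    then have "(\<Sum>k. ennreal (unit_ball_vol ?n * 2 powr q * (2 powr (q - ?n)) ^ k)) \<noteq> top"
      by (rule ennreal_suminf_neq_top) simp
    then show ?thesis unfolding infinity_ennreal_def less_top[symmetric] .
  qed
  finally show ?thesis .
qed

text \<open>For \<open>s \<ge> 0\<close> the weight is largest near the boundary, where the distance
  is at most \<open>2/\<epsilon>\<close> on the support and \<open>p' s \<le> p'\<close>. For
  \<open>s < 0\<close> it is singular at the origin with exponent \<open>q = - p' s < p < n\<close>,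
  hence integrable.\<close>

lemma weighted_integral_cutoff_le:
  assumes p: "1 < p" "p < real CARD('n)" and s: "1 - p < s" "s \<le> 1" and p': "p' = p / (p - 1)"
  obtains C where "C \<ge> 0" "\<And>\<epsilon>. 0 < \<epsilon> \<Longrightarrow> \<epsilon> \<le> 1/4 \<Longrightarrow>
    mass p (p' * s) (\<lambda>x :: real^'n. - cutoff \<epsilon> x)
      \<le> ennreal (C * (1 / \<epsilon>) powr p')"
proof -
  have p'0: "p' > 0" using p by (simp add: p')
  have AE0: "AE x in lborel. x \<noteq> (0 :: real^'n)" by (rule AE_lborel_singleton)
  let ?d = "\<lambda>x. finsler_dist (ball 0 1) berwald (0 :: real^'n) x"
  let ?I = "\<lambda>\<epsilon>. mass p (p' * s) (\<lambda>x :: real^'n. - cutoff \<epsilon> x)"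
  have cp: "\<bar>- cutoff \<epsilon> x\<bar> powr p \<le> 1" for \<epsilon> and x :: "real^'n"
    using cutoff_bounds[of \<epsilon> x] p by (simp add: powr_le1)
  show ?thesis
  proof (cases "s \<ge> 0")
    case True
    define V where "V = unit_ball_vol CARD('n)"
    have V: "V \<ge> 0" "emeasure lborel (ball (0 :: real^'n) 1) = ennreal V" by (auto simp: V_def emeasure_ball)
    show ?thesis
    proof (rule that[of "2 powr p' * V"])
      fix \<epsilon> :: real assume \<epsilon>: "0 < \<epsilon>" "\<epsilon> \<le> 1/4"
      have "?I \<epsilon> \<le> (\<integral>\<^sup>+ x. ennreal (2 powr p' * (1 / \<epsilon>) powr p') * indicator (ball (0 :: real^'n) 1) x \<partial>lborel)"
        unfolding mass_def
      proof (rule nn_integral_mono_AE, use AE0 in eventually_elim)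
        fix x :: "real^'n" assume x0: "x \<noteq> 0"
        have "\<bar>- cutoff \<epsilon> x\<bar> powr p * ?d x powr (p' * s) \<le> 2 powr p' * (1 / \<epsilon>) powr p'" if x: "norm x < 1"
        proof (cases "x \<bullet> x \<ge> 1 - \<epsilon>")
          case True
          then show ?thesis using cutoff_eq_0[OF \<epsilon>(1) True] p by simp
        next
          case False
          let ?r = "norm x"
          \<comment> \<open>Where the cutoff does not vanish,
            \<open>\<epsilon> < (1 - r) (1 + r) \<le> 2 (1 - r)\<close>.\<close>
          have "?r * ?r < 1 - \<epsilon>" using False by (simp add: dot_square_norm power2_eq_square)
          moreover have "(1 + ?r) * (1 - ?r) \<le> 2 * (1 - ?r)" using x by (intro mult_right_mono) auto
          ultimately have r: "\<epsilon> \<le> 2 * (1 - ?r)" by (simp add: algebra_simps)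
          have "?d x \<le> ?r / (1 - ?r)" "0 \<le> ?d x"
            using finsler_dist_berwald_bounds[OF x x0] norm_ge_zero[of x] by linarith+
          moreover have "?r / (1 - ?r) \<le> 2 / \<epsilon>"
          proof -
            have "?r * \<epsilon> \<le> 1 * \<epsilon>" using x \<epsilon> by (intro mult_right_mono) auto
            then have "?r * \<epsilon> \<le> 2 * (1 - ?r)" using r by simp
            then show ?thesis using x \<epsilon> by (simp add: frac_le_eq pos_divide_le_eq pos_le_divide_eq mult.commute)
          qed
          ultimately have "?d x powr (p' * s) \<le> (2 / \<epsilon>) powr (p' * s)"
            using p'0 \<open>s \<ge> 0\<close> by (intro powr_mono2) auto
          also have "\<dots> \<le> (2 / \<epsilon>) powr (p' * 1)"
            using p'0 s \<epsilon> by (intro powr_mono mult_left_mono) (auto simp: field_simps)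
          also have "\<dots> = 2 powr p' * (1 / \<epsilon>) powr p'"
            using \<epsilon> by (simp add: powr_divide)
          finally have "\<bar>- cutoff \<epsilon> x\<bar> powr p * ?d x powr (p' * s) \<le> 1 * (2 powr p' * (1 / \<epsilon>) powr p')"
            using cp by (intro mult_mono) auto
          then show ?thesis by simp
        qed
        then show "ennreal (\<bar>- cutoff \<epsilon> x\<bar> powr p * ?d x powr (p' * s)) * indicator (ball 0 1) x
            \<le> ennreal (2 powr p' * (1 / \<epsilon>) powr p') * indicator (ball 0 1) x"
          by (auto simp: indicator_def intro!: ennreal_leI)
      qed
      also have "\<dots> = ennreal (2 powr p' * (1 / \<epsilon>) powr p') * ennreal V"
        unfolding V(2)[symmetric] by (rule nn_integral_cmult_indicator) simp
      also have "\<dots> = ennreal (2 powr p' * V * (1 / \<epsilon>) powr p')"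
        using V(1) by (simp add: ennreal_mult'[symmetric] mult_ac)
      finally show "?I \<epsilon> \<le> ennreal (2 powr p' * V * (1 / \<epsilon>) powr p')" .
    qed (simp add: V_def)
  next
    case False
    define q where "q = - (p' * s)"
    \<comment> \<open>The condition \<open>1 - p < s\<close> is exactly what makes
      \<open>q = - s p / (p - 1)\<close> smaller than \<open>p\<close>.\<close>
    have "(- s) * p < (p - 1) * p"
      by (rule mult_strict_right_mono) (use s p in linarith)+
    then have "(- s) * p < p * (p - 1)" by (simp only: mult.commute[of p "p - 1"])
    then have "(- s) * p / (p - 1) < p"
      using p by (subst pos_divide_less_eq) auto
    moreover have "q = (- s) * p / (p - 1)" by (simp add: q_def p' mult.commute)
    ultimately have "q < p" by simp
    have q0: "q > 0" using False p'0 by (simp add: q_def mult_pos_neg)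
    have qn: "q < real DIM(real^'n)" using \<open>q < p\<close> p by simp
    let ?K = "\<integral>\<^sup>+ x\<in>ball (0 :: real^'n) 1. ennreal (norm x powr (- q)) \<partial>lborel"
    have K: "?K < \<infinity>" by (rule nn_integral_norm_powr_finite[OF q0 qn])
    show ?thesis
    proof (rule that[of "4 powr q * enn2real ?K"])
      fix \<epsilon> :: real assume \<epsilon>: "0 < \<epsilon>" "\<epsilon> \<le> 1/4"
      have "?I \<epsilon> \<le> (\<integral>\<^sup>+ x. ennreal (4 powr q) * (ennreal (norm x powr (- q)) * indicator (ball (0 :: real^'n) 1) x) \<partial>lborel)"
        unfolding mass_def
      proof (rule nn_integral_mono_AE, use AE0 in eventually_elim)
        fix x :: "real^'n" assume x0: "x \<noteq> 0"
        have "\<bar>- cutoff \<epsilon> x\<bar> powr p * ?d x powr (p' * s) \<le> 4 powr q * norm x powr (- q)" if x: "norm x < 1"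
        proof -
          have "?d x powr (- q) \<le> (norm x / 4) powr (- q)"
            using finsler_dist_berwald_bounds(1)[OF x x0] x0 q0 by (intro powr_mono2') auto
          also have "\<dots> = norm x powr (- q) / 4 powr (- q)"
            by (simp add: powr_divide)
          also have "\<dots> = 4 powr q * norm x powr (- q)"
            by (simp only: powr_minus[of 4 q] divide_inverse inverse_inverse_eq mult.commute)
          finally have "\<bar>- cutoff \<epsilon> x\<bar> powr p * ?d x powr (p' * s) \<le> 1 * (4 powr q * norm x powr (- q))"
            using cp by (intro mult_mono) (auto simp: q_def)
          then show ?thesis by simp
        qed
        then show "ennreal (\<bar>- cutoff \<epsilon> x\<bar> powr p * ?d x powr (p' * s)) * indicator (ball 0 1) x
            \<le> ennreal (4 powr q) * (ennreal (norm x powr (- q)) * indicator (ball 0 1) x)"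
          by (auto simp: indicator_def ennreal_mult'[symmetric] intro!: ennreal_leI)
      qed
      also have "\<dots> = ennreal (4 powr q) * ?K"
      proof (rule nn_integral_cmult)
        have "(\<lambda>x :: real^'n. ennreal (norm x powr (- q))) \<in> borel_measurable borel" by measurable
        then show "(\<lambda>x :: real^'n. ennreal (norm x powr (- q)) * indicator (ball 0 1) x) \<in> borel_measurable lborel"
          by (auto intro!: borel_measurable_times_ennreal borel_measurable_indicator)
      qed
      also have "\<dots> = ennreal (4 powr q * enn2real ?K)"
        using K by (simp add: ennreal_mult)
      \<comment> \<open>The bound is already uniform in \<epsilon>; a factor that is at least 1 is
        inserted to share one form with the other case.\<close>
      also have "\<dots> \<le> ennreal (4 powr q * enn2real ?K * (1 / \<epsilon>) powr p')"
      proof (rule ennreal_leI)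
        have "1 \<le> (1 / \<epsilon>) powr p'" using \<epsilon> p'0 by (intro ge_one_powr_ge_zero) (auto simp: field_simps)
        then have "4 powr q * enn2real ?K * 1 \<le> 4 powr q * enn2real ?K * (1 / \<epsilon>) powr p'"
          by (intro mult_left_mono) auto
        then show "4 powr q * enn2real ?K \<le> 4 powr q * enn2real ?K * (1 / \<epsilon>) powr p'" by simp
      qed
      finally show "?I \<epsilon> \<le> ennreal (4 powr q * enn2real ?K * (1 / \<epsilon>) powr p')" .
    qed simp
  qed
qed

lemma ennreal_divide_le:
  assumes "a \<le> ennreal A" "ennreal c \<le> b" "c > 0" "A \<ge> 0"
  shows "a / b \<le> ennreal (A / c)"
proof (cases b rule: ennreal_cases)
  case (real t)
  then have "t \<ge> c" using assms by simp
  have "a / b \<le> ennreal A / b" by (rule divide_right_mono_ennreal[OF assms(1)])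
  also have "\<dots> = ennreal (A / t)" using real assms \<open>t \<ge> c\<close> by (simp add: divide_ennreal)
  also have "\<dots> \<le> ennreal (A / c)" using assms \<open>t \<ge> c\<close> by (intro ennreal_leI frac_le) auto
  finally show ?thesis .
qed (simp add: ennreal_divide_top)

lemma INF_ennreal_eq_0:
  assumes "\<And>k. f k \<in> A" "\<And>k. \<Phi> (f k) \<le> ennreal (r k)" "r \<longlonglongrightarrow> 0"
  shows "(INF x\<in>A. \<Phi> x) = (0 :: ennreal)"
proof -
  have "(INF x\<in>A. \<Phi> x) \<le> ennreal (r k)" for k
    by (rule order_trans[OF INF_lower[of "f k" A \<Phi>, OF assms(1)] assms(2)])
  moreover have "(\<lambda>k. ennreal (r k)) \<longlonglongrightarrow> ennreal 0" by (rule tendsto_ennrealI[OF assms(3)])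
  ultimately have "(INF x\<in>A. \<Phi> x) \<le> ennreal 0" by (intro LIMSEQ_le_const) auto
  then show ?thesis by simp
qed

lemma hardy_quotient_berwald:
  assumes p: "1 < p"
  shows "(INF f\<in>{f :: real^'n \<Rightarrow> real. test_fun (ball 0 1) f \<and> f \<noteq> (\<lambda>_. 0)}. energy p f / mass p (- p) f) = 0"
proof -
  obtain M \<epsilon> V where M: "M > 0" and \<epsilon>: "\<And>k. 0 < \<epsilon> k" "\<And>k. \<epsilon> k \<le> 1/4" "\<epsilon> \<longlonglongrightarrow> 0"
    and V: "\<And>k. V k \<ge> 0" "V \<longlonglongrightarrow> 0"
    and energy: "\<And>k p. p > 1 \<Longrightarrow> energy p (\<lambda>x :: real^'n. - cutoff (\<epsilon> k) x) \<le> ennreal ((M * \<epsilon> k) powr p * V k)"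
    by (rule energy_cutoff_sequence[where 'n = 'n]) blast
  define c where "c = measure lborel (ball (0 :: real^'n) (1/2))"
  have c: "c > 0" using content_ball_pos[of "1/2" "0 :: real^'n"] by (simp add: c_def measure_def)
  show ?thesis
  proof (rule INF_ennreal_eq_0[where f = "\<lambda>k x. - cutoff (\<epsilon> k) x" and r = "\<lambda>k. (M * \<epsilon> k) powr p * V k / c"])
    fix k
    show "(\<lambda>x. - cutoff (\<epsilon> k) x) \<in> {f :: real^'n \<Rightarrow> real. test_fun (ball 0 1) f \<and> f \<noteq> (\<lambda>_. 0)}"
      by (rule test_fun_minus_cutoff[OF \<epsilon>(1,2)])
    show "energy p (\<lambda>x :: real^'n. - cutoff (\<epsilon> k) x) / mass p (- p) (\<lambda>x :: real^'n. - cutoff (\<epsilon> k) x)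
     \<le> ennreal ((M * \<epsilon> k) powr p * V k / c)"
    proof (rule ennreal_divide_le[OF _ _ c])
      show "energy p (\<lambda>x :: real^'n. - cutoff (\<epsilon> k) x)
        \<le> ennreal ((M * \<epsilon> k) powr p * V k)"
        by (rule energy[OF p])
      show "ennreal c \<le> mass p (- p) (\<lambda>x :: real^'n. - cutoff (\<epsilon> k) x)"
        unfolding c_def using p by (intro weighted_integral_cutoff_ge \<epsilon>(1,2)) auto
    qed (use V in simp)
  next
    have "(\<lambda>k. (M * \<epsilon> k) powr p * V k / c) \<longlonglongrightarrow> (M * 0) powr p * 0 / c"
      using M \<epsilon> p c
      by (intro tendsto_divide tendsto_mult tendsto_powr2 tendsto_const \<epsilon>(3) V(2))
        (auto intro!: always_eventually mult_nonneg_nonneg less_imp_le)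
    then show "(\<lambda>k. (M * \<epsilon> k) powr p * V k / c) \<longlonglongrightarrow> 0" by simp
  qed
qed

text \<open>The roots are at most \<open>M \<epsilon> V^(1/p)\<close> and
  \<open>C^(1/p') / \<epsilon>\<close>: the factors \<epsilon> cancel, and the shell volume
  \<open>V\<close> drives the quotient to 0 over a denominator bounded below.\<close>

lemma uncertainty_quotient_berwald:
  assumes p: "1 < p" "p < real CARD('n)" and s: "1 - p < s" "s \<le> 1" and p': "p' = p / (p - 1)"
  shows "(INF f\<in>{f :: real^'n \<Rightarrow> real. test_fun (ball 0 1) f \<and> f \<noteq> (\<lambda>_. 0)}.
       enn_powr (energy p f) (1/p) * enn_powr (mass p (p' * s) f) (1/p') / mass p (s - 1) f) = 0"
proof -
  have p'1: "p' > 1" using p by (simp add: p')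
  obtain M \<epsilon> V where M: "M > 0" and \<epsilon>: "\<And>k. 0 < \<epsilon> k" "\<And>k. \<epsilon> k \<le> 1/4" "\<epsilon> \<longlonglongrightarrow> 0"
    and V: "\<And>k. V k \<ge> 0" "V \<longlonglongrightarrow> 0"
    and energy: "\<And>k p. p > 1 \<Longrightarrow> energy p (\<lambda>x :: real^'n. - cutoff (\<epsilon> k) x) \<le> ennreal ((M * \<epsilon> k) powr p * V k)"
    by (rule energy_cutoff_sequence[where 'n = 'n]) blast
  obtain C where C: "C \<ge> 0" "\<And>\<epsilon>. 0 < \<epsilon> \<Longrightarrow> \<epsilon> \<le> 1/4 \<Longrightarrow>
    mass p (p' * s) (\<lambda>x :: real^'n. - cutoff \<epsilon> x)
      \<le> ennreal (C * (1 / \<epsilon>) powr p')"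
    using weighted_integral_cutoff_le[OF p s p'] by blast
  define c where "c = measure lborel (ball (0 :: real^'n) (1/2))"
  have c: "c > 0" using content_ball_pos[of "1/2" "0 :: real^'n"] by (simp add: c_def measure_def)
  let ?A = "\<lambda>k. energy p (\<lambda>x :: real^'n. - cutoff (\<epsilon> k) x)"
  let ?B = "\<lambda>k q. mass p q (\<lambda>x :: real^'n. - cutoff (\<epsilon> k) x)"
  show ?thesis
  proof (rule INF_ennreal_eq_0[where f = "\<lambda>k x. - cutoff (\<epsilon> k) x" and r = "\<lambda>k. M * V k powr (1/p) * C powr (1/p') / c"])
    fix k
    show "(\<lambda>x. - cutoff (\<epsilon> k) x) \<in> {f :: real^'n \<Rightarrow> real. test_fun (ball 0 1) f \<and> f \<noteq> (\<lambda>_. 0)}"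
      by (rule test_fun_minus_cutoff[OF \<epsilon>(1,2)])
    show "enn_powr (?A k) (1/p) * enn_powr (?B k (p' * s)) (1/p') / ?B k (s - 1)
      \<le> ennreal (M * V k powr (1/p) * C powr (1/p') / c)"
    proof (rule ennreal_divide_le[OF _ _ c])
      have "enn_powr (?A k) (1/p) \<le> ennreal (((M * \<epsilon> k) powr p * V k) powr (1/p))"
        using energy[OF p(1), of k] V(1)[of k] p by (intro enn_powr_le) auto
      also have "((M * \<epsilon> k) powr p * V k) powr (1/p) = M * \<epsilon> k * V k powr (1/p)"
        using M \<epsilon>(1)[of k] V(1)[of k] p by (intro powr_p_powr_inverse) auto
      finally have 1: "enn_powr (?A k) (1/p) \<le> ennreal (M * \<epsilon> k * V k powr (1/p))" .
      have "enn_powr (?B k (p' * s)) (1/p') \<le> ennreal ((C * (1 / \<epsilon> k) powr p') powr (1/p'))"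
        using C(2)[OF \<epsilon>(1,2), of k] C(1) p'1 by (intro enn_powr_le) auto
      also have "(C * (1 / \<epsilon> k) powr p') powr (1/p') = 1 / \<epsilon> k * C powr (1/p')"
        unfolding mult.commute[of C] using C(1) \<epsilon>(1)[of k] p'1 by (intro powr_p_powr_inverse) auto
      finally have 2: "enn_powr (?B k (p' * s)) (1/p') \<le> ennreal (1 / \<epsilon> k * C powr (1/p'))" .
      have "enn_powr (?A k) (1/p) * enn_powr (?B k (p' * s)) (1/p')
          \<le> ennreal (M * \<epsilon> k * V k powr (1/p)) * ennreal (1 / \<epsilon> k * C powr (1/p'))"
        by (rule mult_mono[OF 1 2]) auto
      also have "\<dots> = ennreal ((M * \<epsilon> k * V k powr (1/p)) * (1 / \<epsilon> k * C powr (1/p')))"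
        using M \<epsilon>(1)[of k] by (intro ennreal_mult[symmetric]) auto
      also have "(M * \<epsilon> k * V k powr (1/p)) * (1 / \<epsilon> k * C powr (1/p')) = M * V k powr (1/p) * C powr (1/p')"
        using \<epsilon>(1)[of k] by (simp add: field_simps)
      finally show "enn_powr (?A k) (1/p) * enn_powr (?B k (p' * s)) (1/p') \<le> ennreal (M * V k powr (1/p) * C powr (1/p'))" .
      show "ennreal c \<le> ?B k (s - 1)"
        unfolding c_def using p s by (intro weighted_integral_cutoff_ge \<epsilon>(1,2)) auto
    qed (use M in simp)
  next
    have "(\<lambda>k. V k powr (1/p)) \<longlonglongrightarrow> 0 powr (1/p)"
      using V p by (intro tendsto_powr2) auto
    then have "(\<lambda>k. M * V k powr (1/p) * C powr (1/p') / c) \<longlonglongrightarrow> M * 0 powr (1/p) * C powr (1/p') / c"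
      using c by (intro tendsto_divide tendsto_mult tendsto_const) auto
    then show "(\<lambda>k. M * V k powr (1/p) * C powr (1/p') / c) \<longlonglongrightarrow> 0" by simp
  qed
qed

text \<open>The gradient enters through \<open>F(grad f) = F*(df)\<close>, as the co-metric of the
  differential. Quotients and infima are taken in the extended nonnegative reals, so a possibly
  infinite denominator needs no separate treatment.\<close>

theorem theorem1p1:
  fixes n_type :: "'n::finite itself" and m_type :: "'m::euclidean_space itself"
  assumes "CARD('n) \<ge> 2"
  defines "\<B> \<equiv> ball (0 :: real^'n) 1"
  shows "finsler_metric \<B> berwald \<and> simply_connected \<B> \<and> forward_complete \<B> berwald
           \<and> flag_curvature_const \<B> berwald 0
     \<and> \<not> (\<exists>(\<phi> :: 'm \<Rightarrow> real) (\<psi> :: real^'n \<Rightarrow> 'm). minkowski_norm \<phi> \<and> Cinf_on \<B> \<psi> \<and>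
            (\<forall>x\<in>\<B>. \<forall>y. \<phi> (frechet_derivative \<psi> (at x) y) = berwald x y))
     \<and> (\<forall>p::real. p > 1 \<longrightarrow> \<not> is_vector_space (sobolev_W0 p \<B> berwald))
     \<and> (\<forall>p::real. 1 < p \<and> p < real CARD('n) \<longrightarrow>
          (INF f\<in>{f. test_fun \<B> f \<and> f \<noteq> (\<lambda>_. 0)}.
             (\<integral>\<^sup>+ x\<in>\<B>. ennreal (cometric berwald x (frechet_derivative f (at x)) powr p) \<partial>lborel)
           / (\<integral>\<^sup>+ x\<in>\<B>. ennreal (\<bar>f x\<bar> powr p * finsler_dist \<B> berwald 0 x powr (- p)) \<partial>lborel)) = 0)
     \<and> (\<forall>p s::real. 1 - p < s \<and> s \<le> 1 \<and> 1 < p \<and> p < real CARD('n) \<longrightarrow>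
          (let p' = p / (p - 1) in
          (INF f\<in>{f. test_fun \<B> f \<and> f \<noteq> (\<lambda>_. 0)}.
             enn_powr (\<integral>\<^sup>+ x\<in>\<B>. ennreal (cometric berwald x (frechet_derivative f (at x)) powr p) \<partial>lborel) (1/p)
           * enn_powr (\<integral>\<^sup>+ x\<in>\<B>. ennreal (\<bar>f x\<bar> powr p * finsler_dist \<B> berwald 0 x powr (p' * s)) \<partial>lborel) (1/p')
           / (\<integral>\<^sup>+ x\<in>\<B>. ennreal (\<bar>f x\<bar> powr p * finsler_dist \<B> berwald 0 x powr (s - 1)) \<partial>lborel)) = 0))"
proof (intro conjI allI impI)
  show "\<not> (\<exists>(\<phi> :: 'm \<Rightarrow> real) (\<psi> :: real^'n \<Rightarrow> 'm). minkowski_norm \<phi> \<and> Cinf_on \<B> \<psi> \<and>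
            (\<forall>x\<in>\<B>. \<forall>y. \<phi> (frechet_derivative \<psi> (at x) y) = berwald x y))"
    unfolding \<B>_def using no_isometric_embedding_berwald by blast
  show "simply_connected \<B>"
    unfolding \<B>_def by (rule convex_imp_simply_connected) simp
qed (use hardy_quotient_berwald uncertainty_quotient_berwald in \<open>auto simp: \<B>_def Let_def energy_def mass_def
    finsler_metric_berwald forward_complete_berwald flag_curvature_berwald sobolev_berwald_not_vector_space\<close>)

end
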